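(* Let $R$ be a real closed field, let $X \subseteq R^n$ be an irreducible, non-singular algebraic variety, and let $f \in R(X)$ be a rational function. Then $f$ is locally bounded on $X$, i.e. $f \in R_b(X)$, if and only if for every continuous semi-algebraic arc $\gamma : [0,1] \to X$ with $\gamma((0,1]) \subseteq \mathrm{dom}(f)$, the function $f \circ \gamma : (0,1] \to R$ is bounded.
   Context: Algebraic varieties over the real closed field $R$ are taken in the sense of Bochnak–Coste–Roy (zero sets in $R^n$ of polynomials). $\mathcal{P}(X)$ is the ring of polynomial functions on $X$, and $R(X)$ is the field of rational functions, i.e. quotients $p/q$ with $p,q\in\mathcal{P}(X)$, $q \neq 0$. For $f\in R(X)$, $\mathrm{dom}(f)$ is the largest dense Zariski open subset $U$ of $X$ on which $f$ is regular (given as a quotient of polynomials with nowhere vanishing denominator on $U$, hence $R$-valued). A rational function $f\in R(X)$ is locally bounded if every $x\in X$ has a neighbourhood $V_x$ in the euclidean topology (induced by the order of $R$) such that $f(V_x\cap \mathrm{dom}(f))$ is a bounded subset of $R$. $R_b(X)$ denotes the set of all locally bounded rational functions on $X$. *)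

theory Defs
  imports
    "HOL-Analysis.Analysis"
    "HOL-Algebra.Ideal"
    "HOL-Library.Poly_Mapping"
    "HOL-Library.Extended_Nat"
begin

text \<open>The Artin--Schreier axioms. The type of univariate polynomials is not available inside a class
  specification, so a polynomial of odd degree is given by its coefficients.\<close>

class real_closed_field = linordered_field +
  assumes pos_square: "0 < a \<Longrightarrow> \<exists>b. b * b = a"
    and odd_degree_root: "odd n \<Longrightarrow> c n \<noteq> 0 \<Longrightarrow> \<exists>x. (\<Sum>k\<le>n. c k * x ^ k) = 0"

subsection \<open>Polynomials in several variables\<close>

type_synonym ('a, 'i) mpoly = "('i \<Rightarrow>\<^sub>0 nat) \<Rightarrow>\<^sub>0 'a"

definition mon_eval :: "('i::finite \<Rightarrow>\<^sub>0 nat) \<Rightarrow> 'a::comm_ring_1 ^ 'i \<Rightarrow> 'a" where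
  "mon_eval m x = (\<Prod>i\<in>UNIV. (x $ i) ^ Poly_Mapping.lookup m i)"

definition mp_eval :: "('a::comm_ring_1, 'i::finite) mpoly \<Rightarrow> 'a ^ 'i \<Rightarrow> 'a" where
  "mp_eval p x = (\<Sum>m\<in>Poly_Mapping.keys p. Poly_Mapping.lookup p m * mon_eval m x)"

definition mp_partial :: "'i::finite \<Rightarrow> ('a::comm_ring_1, 'i) mpoly \<Rightarrow> ('a, 'i) mpoly" where
  "mp_partial i p = (\<Sum>m\<in>Poly_Mapping.keys p.
     Poly_Mapping.single (m - Poly_Mapping.single i 1)
       (of_nat (Poly_Mapping.lookup m i) * Poly_Mapping.lookup p m))"

lemma mp_eval_zero [simp]: "mp_eval 0 x = 0"
  by (simp add: mp_eval_def)

lemma mp_eval_single: "mp_eval (Poly_Mapping.single m c) x = c * mon_eval m x"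
  by (cases "c = 0") (simp_all add: mp_eval_def)

lemma mp_eval_one [simp]: "mp_eval 1 x = 1"
  using mp_eval_single[of 0 1 x] by (simp add: mon_eval_def)

lemma mp_eval_add [simp]: "mp_eval (p + q) x = mp_eval p x + mp_eval q x"
  unfolding mp_eval_def
  by (rule setsum_keys_plus_distrib[where f = "\<lambda>m c. c * mon_eval m x"])
     (simp_all add: distrib_right)

lemma mp_eval_minus [simp]: "mp_eval (- p) x = - mp_eval p x"
  by (metis add.right_inverse add_eq_0_iff mp_eval_add mp_eval_zero)

lemma mp_eval_sum: "mp_eval (sum f A) x = (\<Sum>a\<in>A. mp_eval (f a) x)"
  by (induction A rule: infinite_finite_induct) simp_all

lemma sum_single_lookup:
  "(\<Sum>m\<in>Poly_Mapping.keys p. Poly_Mapping.single m (Poly_Mapping.lookup p m)) = p"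
proof (rule poly_mapping_eqI)
  fix k
  have "(\<Sum>m\<in>Poly_Mapping.keys p. Poly_Mapping.lookup p m when m = k) = Poly_Mapping.lookup p k"
    by (cases "k \<in> Poly_Mapping.keys p") (auto simp: when_def sum.delta in_keys_iff)
  then show "Poly_Mapping.lookup (\<Sum>m\<in>Poly_Mapping.keys p.
      Poly_Mapping.single m (Poly_Mapping.lookup p m)) k = Poly_Mapping.lookup p k"
    by (simp add: lookup_sum lookup_single)
qed

lemma mp_eval_mult [simp]: "mp_eval (p * q) x = mp_eval p x * mp_eval q x"
proof -
  have "p * q =
     (\<Sum>m\<in>Poly_Mapping.keys p. Poly_Mapping.single m (Poly_Mapping.lookup p m)) *
     (\<Sum>k\<in>Poly_Mapping.keys q. Poly_Mapping.single k (Poly_Mapping.lookup q k))"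
    by (simp add: sum_single_lookup)
  also have "\<dots> = (\<Sum>m\<in>Poly_Mapping.keys p. \<Sum>k\<in>Poly_Mapping.keys q.
      Poly_Mapping.single (m + k) (Poly_Mapping.lookup p m * Poly_Mapping.lookup q k))"
    by (simp add: sum_product mult_single)
  finally have pq: "p * q = \<dots>" .
  have mon: "mon_eval (m + k) x = mon_eval m x * mon_eval k x" for m k
    by (simp add: mon_eval_def lookup_add power_add prod.distrib)
  show ?thesis
    unfolding pq mp_eval_sum mp_eval_single mon
    by (simp add: mp_eval_def sum_product algebra_simps)
qed

subsection \<open>Algebraic sets and the Zariski topology\<close>

definition zero_set :: "('a::comm_ring_1, 'i::finite) mpoly set \<Rightarrow> ('a ^ 'i) set" where
  "zero_set B = {x. \<forall>p\<in>B. mp_eval p x = 0}"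

definition algebraic_set :: "('a::comm_ring_1 ^ 'i::finite) set \<Rightarrow> bool" where
  "algebraic_set X \<longleftrightarrow> (\<exists>B. X = zero_set B)"

definition vanishing_ideal :: "('a::comm_ring_1 ^ 'i::finite) set \<Rightarrow> ('a, 'i) mpoly set" where
  "vanishing_ideal X = {p. \<forall>x\<in>X. mp_eval p x = 0}"

definition irreducible_set :: "('a::comm_ring_1 ^ 'i::finite) set \<Rightarrow> bool" where
  "irreducible_set X \<longleftrightarrow> X \<noteq> {} \<and>
     (\<forall>F G. algebraic_set F \<and> algebraic_set G \<and> X = F \<union> G \<longrightarrow> X = F \<or> X = G)"

lemma algebraic_set_Un:
  fixes F G :: "('a::idom ^ 'i::finite) set"
  assumes "algebraic_set F" "algebraic_set G"
  shows "algebraic_set (F \<union> G)"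
proof -
  obtain B C where "F = zero_set B" "G = zero_set C"
    using assms by (auto simp: algebraic_set_def)
  then have "F \<union> G = zero_set {p * q |p q. p \<in> B \<and> q \<in> C}"
    by (fastforce simp: zero_set_def)
  then show ?thesis
    by (auto simp: algebraic_set_def)
qed

lemma algebraic_set_Inter:
  assumes "\<And>F. F \<in> \<F> \<Longrightarrow> algebraic_set F"
  shows "algebraic_set (\<Inter>\<F>)"
proof -
  obtain B where "\<And>F. F \<in> \<F> \<Longrightarrow> F = zero_set (B F)"
    using assms unfolding algebraic_set_def by metis
  then have "\<Inter>\<F> = zero_set (\<Union>F\<in>\<F>. B F)"
    by (fastforce simp: zero_set_def)
  then show ?thesis
    by (auto simp: algebraic_set_def)
qed

definition zariski :: "('a::idom ^ 'i::finite) topology" where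
  "zariski = topology (\<lambda>U. algebraic_set (- U))"

lemma openin_zariski:
  fixes U :: "('a::idom ^ 'i::finite) set"
  shows "openin zariski U \<longleftrightarrow> algebraic_set (- U)"
proof -
  have "istopology (\<lambda>U :: ('a ^ 'i) set. algebraic_set (- U))"
    unfolding istopology_def
  proof (intro conjI allI impI)
    show "algebraic_set (- (S \<inter> T))" if "algebraic_set (- S)" "algebraic_set (- T)"
      for S T :: "('a ^ 'i) set"
      using algebraic_set_Un[OF that] by (simp add: Compl_Int)
    show "algebraic_set (- \<Union>\<K>)" if "\<forall>K\<in>\<K>. algebraic_set (- K)"
      for \<K> :: "('a ^ 'i) set set"
      using algebraic_set_Inter[of "uminus ` \<K>"] that by (auto simp: uminus_Sup)
  qed
  then show ?thesis
    by (simp add: zariski_def topology_inverse')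
qed

subsection \<open>Polynomial functions, dimension, non-singularity\<close>

definition polynomial_functions :: "('a::comm_ring_1 ^ 'i::finite) set \<Rightarrow> ('a ^ 'i \<Rightarrow> 'a) ring" where
  "polynomial_functions X =
    \<lparr>carrier = {restrict (mp_eval p) X |p. True},
     mult = (\<lambda>f g. \<lambda>x\<in>X. f x * g x),
     one = (\<lambda>x\<in>X. 1),
     zero = (\<lambda>x\<in>X. 0),
     add = (\<lambda>f g. \<lambda>x\<in>X. f x + g x)\<rparr>"

lemma cring_polynomial_functions: "cring (polynomial_functions X)"
proof (rule cringI)
  show "abelian_group (polynomial_functions X)"
  proof (rule abelian_groupI)
    show "x \<oplus>\<^bsub>polynomial_functions X\<^esub> y \<in> carrier (polynomial_functions X)"
      if xy: "x \<in> carrier (polynomial_functions X)" "y \<in> carrier (polynomial_functions X)" for x y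
    proof -
      obtain p q where "x = restrict (mp_eval p) X" "y = restrict (mp_eval q) X"
        using xy by (auto simp: polynomial_functions_def)
      then have "x \<oplus>\<^bsub>polynomial_functions X\<^esub> y = restrict (mp_eval (p + q)) X"
        by (auto simp: polynomial_functions_def)
      then show ?thesis
        by (auto simp: polynomial_functions_def)
    qed
    show "\<zero>\<^bsub>polynomial_functions X\<^esub> \<in> carrier (polynomial_functions X)"
      by (auto simp: polynomial_functions_def intro!: exI[of _ 0])
    show "\<exists>y\<in>carrier (polynomial_functions X).
        y \<oplus>\<^bsub>polynomial_functions X\<^esub> x = \<zero>\<^bsub>polynomial_functions X\<^esub>"
      if xy: "x \<in> carrier (polynomial_functions X)" for x
    proof -
      obtain p where "x = restrict (mp_eval p) X"
        using xy by (auto simp: polynomial_functions_def)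
      then show ?thesis
        by (intro bexI[of _ "restrict (mp_eval (- p)) X"]) (auto simp: polynomial_functions_def)
    qed
  qed (auto simp: polynomial_functions_def add_ac)
  show "comm_monoid (polynomial_functions X)"
  proof (rule comm_monoidI)
    show "x \<otimes>\<^bsub>polynomial_functions X\<^esub> y \<in> carrier (polynomial_functions X)"
      if xy: "x \<in> carrier (polynomial_functions X)" "y \<in> carrier (polynomial_functions X)" for x y
    proof -
      obtain p q where "x = restrict (mp_eval p) X" "y = restrict (mp_eval q) X"
        using xy by (auto simp: polynomial_functions_def)
      then have "x \<otimes>\<^bsub>polynomial_functions X\<^esub> y = restrict (mp_eval (p * q)) X"
        by (auto simp: polynomial_functions_def)
      then show ?thesis
        by (auto simp: polynomial_functions_def)
    qed
    show "\<one>\<^bsub>polynomial_functions X\<^esub> \<in> carrier (polynomial_functions X)"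
      by (auto simp: polynomial_functions_def intro!: exI[of _ 1])
  qed (auto simp: polynomial_functions_def mult_ac)
qed (auto simp: polynomial_functions_def distrib_right)

definition krull_dim :: "('b, 'm) ring_scheme \<Rightarrow> enat" where
  "krull_dim A = Sup {enat d |d. \<exists>P :: nat \<Rightarrow> 'b set.
     (\<forall>i\<le>d. primeideal (P i) A) \<and> (\<forall>i<d. P i \<subset> P (Suc i))}"

definition variety_dim :: "('a::comm_ring_1 ^ 'i::finite) set \<Rightarrow> enat" where
  "variety_dim X = krull_dim (polynomial_functions X)"

definition zariski_tangent_space :: "('a::field ^ 'i::finite) set \<Rightarrow> 'a ^ 'i \<Rightarrow> ('a ^ 'i) set" where
  "zariski_tangent_space X x =
     {v. \<forall>p\<in>vanishing_ideal X. (\<Sum>i\<in>UNIV. mp_eval (mp_partial i p) x * v $ i) = 0}"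

text \<open>This is the Jacobian criterion: the tangent space is the kernel of the Jacobian matrix at
  \<open>x\<close> of any generating family of the ideal of \<open>X\<close>, so the condition says that this matrix has
  rank \<open>n - dim X\<close>. It agrees with regularity of the local rings of an irreducible \<open>X\<close>.\<close>

definition nonsingular :: "('a::field ^ 'i::finite) set \<Rightarrow> bool" where
  "nonsingular X \<longleftrightarrow> (\<forall>x\<in>X. enat (vec.dim (zariski_tangent_space X x)) = variety_dim X)"

subsection \<open>Rational functions\<close>

definition fraction_rel ::
    "('a::field ^ 'i::finite) set \<Rightarrow> (('a ^ 'i \<Rightarrow> 'a) \<times> ('a ^ 'i \<Rightarrow> 'a)) rel" where
  "fraction_rel X = (let A = polynomial_functions X in
     {((p, q), (p', q')). p \<in> carrier A \<and> q \<in> carrier A - {\<zero>\<^bsub>A\<^esub>} \<and>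
        p' \<in> carrier A \<and> q' \<in> carrier A - {\<zero>\<^bsub>A\<^esub>} \<and>
        p \<otimes>\<^bsub>A\<^esub> q' = p' \<otimes>\<^bsub>A\<^esub> q})"

text \<open>A rational function is the class of all pairs \<open>(p, q)\<close> representing it as \<open>p / q\<close>.\<close>

type_synonym ('a, 'i) rational_function = "(('a ^ 'i \<Rightarrow> 'a) \<times> ('a ^ 'i \<Rightarrow> 'a)) set"

definition rational_functions ::
    "('a::field ^ 'i::finite) set \<Rightarrow> ('a, 'i) rational_function set" where
  "rational_functions X =
     (carrier (polynomial_functions X) \<times>
       (carrier (polynomial_functions X) - {\<zero>\<^bsub>polynomial_functions X\<^esub>})) // fraction_rel X"

definition regular_on :: "('a::field, 'i::finite) rational_function \<Rightarrow> ('a ^ 'i) set \<Rightarrow> bool" where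
  "regular_on f U \<longleftrightarrow> (\<exists>(p, q)\<in>f. \<forall>x\<in>U. q x \<noteq> 0)"

definition rat_dom ::
    "('a::field ^ 'i::finite) set \<Rightarrow> ('a, 'i) rational_function \<Rightarrow> ('a ^ 'i) set" where
  "rat_dom X f = (GREATEST U. openin (subtopology zariski X) U \<and>
     (subtopology zariski X) closure_of U = X \<and> regular_on f U)"

text \<open>The value is meaningful at points of \<open>rat_dom X f\<close>, where it does not depend on the
  representative \<open>(p, q)\<close> chosen.\<close>

definition rat_eval :: "('a::field, 'i::finite) rational_function \<Rightarrow> 'a ^ 'i \<Rightarrow> 'a" where
  "rat_eval f x = (THE v. \<exists>(p, q)\<in>f. q x \<noteq> 0 \<and> v = p x / q x)"

text \<open>In an ordered field with \<^class>\<open>linorder_topology\<close>, the library topology on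
  \<open>'a ^ 'i\<close> is the product of the order topologies, that is, the euclidean topology.
  The library predicate for bounded sets needs a real-valued metric and is not applicable here.\<close>

definition order_bounded :: "'a::linordered_field set \<Rightarrow> bool" where
  "order_bounded S \<longleftrightarrow> bdd_below S \<and> bdd_above S"

definition locally_bounded_functions ::
    "('a::{linordered_field,linorder_topology} ^ 'i::finite) set \<Rightarrow> ('a, 'i) rational_function set"
  where
  "locally_bounded_functions X = {f \<in> rational_functions X.
     \<forall>x\<in>X. \<exists>V. open V \<and> x \<in> V \<and> order_bounded (rat_eval f ` (V \<inter> rat_dom X f))}"

subsection \<open>Semi-algebraic arcs\<close>

inductive semialgebraic :: "('a::linordered_field ^ 'i::finite) set \<Rightarrow> bool" where
  positive: "semialgebraic {x. 0 < mp_eval p x}"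
| union: "semialgebraic S \<Longrightarrow> semialgebraic T \<Longrightarrow> semialgebraic (S \<union> T)"
| inter: "semialgebraic S \<Longrightarrow> semialgebraic T \<Longrightarrow> semialgebraic (S \<inter> T)"
| complement: "semialgebraic S \<Longrightarrow> semialgebraic (- S)"

text \<open>The product of the line with affine \<open>n\<close>-space is indexed by \<open>'i option\<close>: coordinate
  \<^const>\<open>None\<close> is the parameter and \<open>Some i\<close> is the \<open>i\<close>-th coordinate of the value.\<close>

definition arc_graph :: "('a::linordered_field \<Rightarrow> 'a ^ 'i::finite) \<Rightarrow> ('a ^ 'i option) set" where
  "arc_graph \<gamma> = {z. z $ None \<in> {0..1} \<and> (\<forall>i. z $ Some i = \<gamma> (z $ None) $ i)}"

definition semialgebraic_arc ::
    "('a::{linordered_field,linorder_topology} ^ 'i::finite) set \<Rightarrow> ('a \<Rightarrow> 'a ^ 'i) \<Rightarrow> bool" where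
  "semialgebraic_arc X \<gamma> \<longleftrightarrow>
     \<gamma> \<in> {0..1} \<rightarrow> X \<and> continuous_on {0..1} \<gamma> \<and> semialgebraic (arc_graph \<gamma>)"

end

theory Submission
  imports Defs "HOL-Algebra.Algebraic_Closure_Type"
begin

text \<open>
  Write \<open>f = P / Q\<close> with polynomials such that the domain of \<open>f\<close> is the set of points of \<open>X\<close> with \<open>Q \<noteq> 0\<close>.
  Such a global fraction exists by Hilbert's basis theorem and because, over an ordered field, finitely
  many denominators can be combined into a sum of squares (\<open>rational_function_global_fraction\<close>).

  Suppose that \<open>f\<close> is locally bounded and consider an arc \<open>\<gamma>\<close>. The set of all \<open>t\<close> such that \<open>f \<circ> \<gamma>\<close> is bounded
  up to \<open>t\<close> is an initial segment, and it is semi-algebraic. Semi-algebraic initial segments have end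
  points, even if the field is not complete (\<open>definable_cut\<close>). Local boundedness of \<open>f\<close> at \<open>\<gamma> c\<close> and
  continuity of \<open>\<gamma>\<close> at \<open>c\<close> prevent such an end \<open>c\<close> within the unit interval.

  Conversely, suppose that \<open>f\<close> is unbounded in each neighbourhood of a point \<open>a\<close>. For \<open>t > 0\<close> there is a point
  of the domain that is within \<open>t\<close> of \<open>a\<close> and at which the absolute value of \<open>f\<close> exceeds \<open>1 / t\<close>. By curve
  selection such points can be chosen along an arc that starts at \<open>a\<close> (\<open>curve_selection\<close>), and along it \<open>f\<close> is
  unbounded. The choice itself is semi-algebraic by \<open>definable_choice_vec\<close>, and any semi-algebraic
  function of one variable is continuous at all sufficiently small positive arguments, by
  \<open>definable_eventually_continuous\<close>.

  Both directions rest on the Tarski--Seidenberg theorem \<open>definable_Ex\<close>: predicates stay semi-algebraic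
  when they are quantified over the field. Its proof compares the sign diagrams of the same polynomials
  at two values of the parameters. If finitely many polynomials in the parameters have the same signs at
  both, then there is an increasing bijection of the line that identifies the two sign diagrams
  (\<open>sign_determined_upolys\<close>). The passage from a family of polynomials to one more polynomial
  uses intermediate values, Rolle's theorem and remainders (\<open>sign_iso_extend\<close>, \<open>sign_determined_step\<close>).

  The intermediate value theorem itself must be derived from the axioms on square roots and on
  polynomials of odd degree. Laplace's argument (\<open>monic_has_root_in_complex_part\<close>) shows
  that every polynomial is a product of linear and definite factors, and a change of sign can only
  come from a linear factor.
\<close>

hide_const (open) Polynomials.lead_coeff Polynomials.degree UnivPoly.coeff UnivPoly.monom Module.smult
no_notation var (\<open>X\<index>\<close>)
no_notation fps_nth (infixl \<open>$\<close> 75)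

section \<open>Splitting polynomials over a real closed field\<close>

lemma to_ac_poly: "to_ac (poly p x) = poly (map_poly to_ac p) (to_ac x)"
  by (induction p) (simp_all add: map_poly_pCons)

lemma map_poly_to_ac_mult: "map_poly to_ac (p * q) = map_poly to_ac p * map_poly to_ac q"
  by (rule poly_eqI) (simp add: coeff_map_poly coeff_mult to_ac_sum)

lemma map_poly_to_ac_add: "map_poly to_ac (p + q) = map_poly to_ac p + map_poly to_ac q"
  by (rule poly_eqI) (simp add: coeff_map_poly)

lemma degree_map_poly_to_ac [simp]: "degree (map_poly to_ac p) = degree p"
  by (rule degree_map_poly) simp

lemma range_to_ac_closed:
  assumes "x \<in> range to_ac" "y \<in> range to_ac"
  shows "x + y \<in> range to_ac" "x - y \<in> range to_ac" "x * y \<in> range to_ac" "x / y \<in> range to_ac"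
  using assms by (auto simp flip: to_ac_add to_ac_diff to_ac_mult to_ac_divide)

lemma range_to_ac_closed_unary:
  assumes "x \<in> range to_ac"
  shows "- x \<in> range to_ac" "x ^ n \<in> range to_ac"
  using assms by (auto simp flip: to_ac_minus to_ac_power)

lemma range_to_ac_const: "0 \<in> range to_ac" "1 \<in> range to_ac" "numeral n \<in> range to_ac"
  "to_ac a \<in> range to_ac"
  by (auto simp flip: to_ac_0 to_ac_1 to_ac_numeral)

lemma range_to_ac_sum: "(\<And>i. i \<in> A \<Longrightarrow> f i \<in> range to_ac) \<Longrightarrow> sum f A \<in> range to_ac"
  by (induction A rule: infinite_finite_induct) (auto intro: range_to_ac_closed range_to_ac_const)

lemma coeffs_in_range_imp_map_poly:
  assumes "\<And>k. coeff f k \<in> range to_ac"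
  shows "\<exists>g. f = map_poly to_ac g"
proof
  show "f = map_poly to_ac (map_poly of_ac f)"
    by (rule poly_eqI) (use assms in \<open>simp add: coeff_map_poly to_ac_of_ac\<close>)
qed

text \<open>
  Newton interpolation: splitting off the linear factor at one of the points lowers the degree.
\<close>

lemma interpolated_coeffs_in_range:
  fixes f :: "'a::field_char_0 alg_closure poly"
  assumes "infinite T" and "\<And>t. t \<in> T \<Longrightarrow> poly f (to_ac t) \<in> range to_ac"
  shows "coeff f k \<in> range to_ac"
  using assms
proof (induction "degree f" arbitrary: f T k rule: less_induct)
  case less
  obtain t0 where t0: "t0 \<in> T"
    using less.prems(1) by (metis finite.emptyI ex_in_conv)
  define h where "h = synthetic_div f (to_ac t0)"
  have f: "f = [:- to_ac t0, 1:] * h + [:poly f (to_ac t0):]"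
    using synthetic_div_correct'[of "to_ac t0" f] by (simp add: h_def)
  show ?case
  proof (cases "degree f = 0")
    case True
    then obtain c where "f = [:c:]"
      by (metis degree_eq_zeroE)
    with less.prems(2)[OF t0] show ?thesis
      by (cases k) (auto simp: coeff_pCons intro: range_to_ac_const)
  next
    case False
    have hk: "coeff h k \<in> range to_ac" for k
    proof (rule less.hyps[of h "T - {t0}"])
      show "degree h < degree f"
        using False by (simp add: h_def degree_synthetic_div)
      show "infinite (T - {t0})"
        using less.prems(1) by simp
      fix t assume t: "t \<in> T - {t0}"
      have "poly f (to_ac t) = (to_ac t - to_ac t0) * poly h (to_ac t) + poly f (to_ac t0)"
        by (subst f) (simp add: algebra_simps)
      moreover have "to_ac t - to_ac t0 \<noteq> 0"
        using t by simp
      ultimately have "poly h (to_ac t) = (poly f (to_ac t) - poly f (to_ac t0)) / (to_ac t - to_ac t0)"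
        by (simp add: field_simps)
      then show "poly h (to_ac t) \<in> range to_ac"
        using t t0 less.prems(2) by (auto intro!: range_to_ac_closed range_to_ac_const)
    qed
    have "coeff f k = coeff (pCons 0 h) k - to_ac t0 * coeff h k + coeff [:poly f (to_ac t0):] k"
      by (subst f) (simp add: coeff_pCons algebra_simps split: nat.split)
    also have "\<dots> \<in> range to_ac"
      using hk less.prems(2)[OF t0]
      by (cases k) (auto simp: coeff_pCons intro!: range_to_ac_closed range_to_ac_const split: nat.split)
    finally show ?thesis .
  qed
qed

lemma prod_mset_differences_swap:
  fixes A B :: "'a::comm_ring_1 multiset"
  shows "(\<Prod>a\<in>#A. \<Prod>b\<in>#B. a - b) = (- 1) ^ (size A * size B) * (\<Prod>b\<in>#B. \<Prod>a\<in>#A. b - a)"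
proof (induction A)
  case empty
  then show ?case by simp
next
  case (add x A)
  have "(\<Prod>b\<in>#B. x - b) = (- 1) ^ size B * (\<Prod>b\<in>#B. b - x)"
    by (induction B) (simp_all add: algebra_simps)
  then show ?case
    by (simp add: add prod_mset.distrib power_add mult_ac)
qed

lemma poly_prod_mset_linear: "poly (\<Prod>a\<in>#A. [:- a, 1:]) x = (\<Prod>a\<in>#A. x - a :: 'a::comm_ring_1)"
  by (induction A) (simp_all add: algebra_simps)

lemma degree_prod_mset_linear: "degree (\<Prod>a\<in>#A. [:- a, 1:] :: 'a::idom poly) = size A"
  and lead_coeff_prod_mset_linear: "lead_coeff (\<Prod>a\<in>#A. [:- a, 1:] :: 'a::idom poly) = 1"
proof -
  have nz: "(\<Prod>a\<in>#A. [:- a, 1:] :: 'a::idom poly) \<noteq> 0" for A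
    by (induction A) (auto simp del: mult_pCons_left)
  show "degree (\<Prod>a\<in>#A. [:- a, 1:] :: 'a::idom poly) = size A"
  proof (induction A)
    case (add a A)
    then show ?case using nz[of A] by (simp add: degree_mult_eq del: mult_pCons_left)
  qed simp
  show "lead_coeff (\<Prod>a\<in>#A. [:- a, 1:] :: 'a::idom poly) = 1"
    by (induction A) (simp_all add: lead_coeff_mult del: mult_pCons_left)
qed

text \<open>
  The product is the resultant of \<open>p\<close> and \<open>g\<close>. The Euclidean algorithm shows that it lies in the base
  field, without any use of symmetric functions: reducing \<open>g\<close> modulo \<open>p\<close> does not change the product,
  and then exchanging the roles of the two sets of roots lowers the degree.
\<close>

lemma prod_over_roots_in_range:
  fixes p g :: "'a::field poly"
  assumes "map_poly to_ac p = (\<Prod>a\<in>#A. [:- a, 1:])"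
  shows "(\<Prod>a\<in>#A. poly (map_poly to_ac g) a) \<in> range to_ac"
  using assms
proof (induction "size A" arbitrary: p g A rule: less_induct)
  case less
  define h where "h = g mod p"
  have p0: "p \<noteq> 0"
    using lead_coeff_prod_mset_linear[of A] less.prems by auto
  have degp: "degree p = size A"
    by (metis degree_map_poly_to_ac degree_prod_mset_linear less.prems)
  have root: "poly (map_poly to_ac p) a = 0" if "a \<in># A" for a
    unfolding less.prems using that by (auto simp: poly_prod_mset_linear)
  have red: "poly (map_poly to_ac g) a = poly (map_poly to_ac h) a" if "a \<in># A" for a
  proof -
    have "g = p * (g div p) + h"
      by (simp add: h_def)
    then have "map_poly to_ac g = map_poly to_ac p * map_poly to_ac (g div p) + map_poly to_ac h"
      by (metis map_poly_to_ac_add map_poly_to_ac_mult)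
    then show ?thesis
      using root[OF that] by simp
  qed
  have eq: "(\<Prod>a\<in>#A. poly (map_poly to_ac g) a) = (\<Prod>a\<in>#A. poly (map_poly to_ac h) a)"
    by (rule arg_cong[of _ _ prod_mset], rule image_mset_cong) (rule red)
  show ?case
  proof (cases "h = 0")
    case True
    then show ?thesis
      unfolding eq by (cases A) (auto intro: range_to_ac_const)
  next
    case False
    define c where "c = lead_coeff h"
    have c: "c \<noteq> 0"
      using False by (simp add: c_def)
    define h' where "h' = smult (inverse c) h"
    have h: "h = smult c h'"
      using c by (simp add: h'_def)
    have lc: "lead_coeff h' = 1"
      using c by (simp add: h'_def c_def)
    have "map_poly to_ac h' \<noteq> 0"
      using lc by (metis coeff_0 coeff_map_poly to_ac_0 to_ac_eq_0_iff zero_neq_one)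
    then obtain B where B: "size B = degree h'" "map_poly to_ac h' = (\<Prod>x\<in>#B. [:-x, 1:])"
      using alg_closed_imp_factorization[of "map_poly to_ac h'"] lc
      by (auto simp: coeff_map_poly)
    have "size B < size A"
    proof (cases "degree p = 0")
      case True
      then have "is_unit p"
        using p0 by (simp add: is_unit_iff_degree)
      then have "h = 0"
        by (simp add: h_def unit_imp_mod_eq_0)
      with False show ?thesis by simp
    next
      case nz: False
      have "degree h < degree p"
        using degree_mod_less'[of p g] p0 False by (simp add: h_def)
      then show ?thesis
        using B(1) c by (simp add: degp h)
    qed
    from less.hyps[OF this B(2), of p]
    have IH: "(\<Prod>b\<in>#B. \<Prod>a\<in>#A. b - a) \<in> range to_ac"
      unfolding less.prems ext[OF poly_prod_mset_linear] .
    have "(\<Prod>a\<in>#A. poly (map_poly to_ac h) a) = (\<Prod>a\<in>#A. to_ac c * (\<Prod>b\<in>#B. a - b))"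
      by (simp add: h map_poly_smult B(2) ext[OF poly_prod_mset_linear])
    also have "\<dots> = to_ac c ^ size A * (\<Prod>a\<in>#A. \<Prod>b\<in>#B. a - b)"
      by (simp add: prod_mset.distrib)
    also have "\<dots> = to_ac c ^ size A * ((- 1) ^ (size A * size B) * (\<Prod>b\<in>#B. \<Prod>a\<in>#A. b - a))"
      by (subst prod_mset_differences_swap) (rule refl)
    also have "\<dots> \<in> range to_ac"
      by (intro range_to_ac_closed range_to_ac_closed_unary range_to_ac_const IH)
    finally show ?thesis
      by (simp add: eq)
  qed
qed

text \<open>
  The right-hand side is the homogenization, at \<open>(u, v)\<close>, of the monic polynomial with the roots \<open>A\<close>.
  Unlike \<open>v ^ size A\<close> times its value at \<open>u / v\<close>, it makes sense for \<open>v = 0\<close>.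
\<close>

lemma homogenized_prod_linear:
  fixes u v :: "'a::idom"
  shows "(\<Prod>a\<in>#A. u - a * v) =
    (\<Sum>k\<le>size A. coeff (\<Prod>a\<in>#A. [:- a, 1:]) k * u ^ k * v ^ (size A - k))"
proof (induction A)
  case empty
  then show ?case by simp
next
  case (add a A)
  let ?h = "\<Prod>a\<in>#A. [:- a, 1:]" and ?n = "size A"
  have top: "coeff ?h (Suc ?n) = 0"
    by (rule coeff_eq_0) (simp add: degree_prod_mset_linear)
  have "(\<Sum>k\<le>Suc ?n. coeff (\<Prod>a\<in>#add_mset a A. [:- a, 1:]) k * u ^ k * v ^ (Suc ?n - k))
    = (\<Sum>k\<le>Suc ?n. coeff (pCons 0 ?h) k * u ^ k * v ^ (Suc ?n - k)) -
      (\<Sum>k\<le>Suc ?n. a * coeff ?h k * u ^ k * v ^ (Suc ?n - k))"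
    unfolding sum_subtractf[symmetric]
    by (rule sum.cong) (simp_all add: left_diff_distrib)
  also have "(\<Sum>k\<le>Suc ?n. coeff (pCons 0 ?h) k * u ^ k * v ^ (Suc ?n - k)) =
      u * (\<Sum>k\<le>?n. coeff ?h k * u ^ k * v ^ (?n - k))"
    by (subst sum.atMost_Suc_shift) (simp add: sum_distrib_left algebra_simps)
  also have "(\<Sum>k\<le>Suc ?n. a * coeff ?h k * u ^ k * v ^ (Suc ?n - k)) =
      a * v * (\<Sum>k\<le>?n. coeff ?h k * u ^ k * v ^ (?n - k))"
    by (simp add: top sum_distrib_left Suc_diff_le algebra_simps)
  finally show ?case
    by (simp only: size_add_mset add[symmetric]) (simp add: algebra_simps)
qed


text \<open>
  The coefficients of a monic square root are found from the top downwards, each from the previous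
  ones by a division by \<open>2\<close>.
\<close>

lemma square_coeffs_in_range_imp:
  fixes f :: "'a::field_char_0 alg_closure poly"
  assumes monic: "lead_coeff f = 1" and sq: "\<And>k. coeff (f * f) k \<in> range to_ac"
  shows "coeff f k \<in> range to_ac"
proof -
  define N where "N = degree f"
  have "coeff f (N - j) \<in> range to_ac" if "j \<le> N" for j
    using that
  proof (induction j rule: less_induct)
    case (less j)
    show ?case
    proof (cases "j = 0")
      case True
      then show ?thesis
        using monic by (simp add: N_def range_to_ac_const)
    next
      case False
      define t where "t i = coeff f i * coeff f (2 * N - j - i)" for i
      have "coeff (f * f) (2 * N - j) = (\<Sum>i\<le>2 * N - j. t i)"
        by (simp add: coeff_mult t_def)
      also have "\<dots> = (\<Sum>i\<in>{N - j..N}. t i)"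
      proof (rule sum.mono_neutral_right)
        show "\<forall>i\<in>{..2 * N - j} - {N - j..N}. t i = 0"
        proof
          fix i assume "i \<in> {..2 * N - j} - {N - j..N}"
          then have "i > degree f \<or> 2 * N - j - i > degree f"
            using less.prems by (auto simp: N_def)
          then show "t i = 0"
            by (auto simp: t_def coeff_eq_0)
        qed
      qed (use less.prems in auto)
      also have "{N - j..N} = insert N (insert (N - j) {N - j<..<N})"
        using False less.prems by auto
      also have "sum t \<dots> = t N + (t (N - j) + sum t {N - j<..<N})"
        using False less.prems by (subst sum.insert) auto
      also have "t N = coeff f (N - j)"
        using monic less.prems by (simp add: t_def N_def)
      also have "t (N - j) = coeff f (N - j)"
        using monic less.prems by (simp add: t_def N_def)
      finally have eq: "coeff f (N - j) = (coeff (f * f) (2 * N - j) - sum t {N - j<..<N}) / 2"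
        by simp
      have "sum t {N - j<..<N} \<in> range to_ac"
      proof (rule range_to_ac_sum)
        fix i assume i: "i \<in> {N - j<..<N}"
        have "coeff f (N - (N - i)) \<in> range to_ac"
          using i less.prems by (intro less.IH) auto
        moreover have "coeff f (N - (j + i - N)) \<in> range to_ac"
          using i less.prems by (intro less.IH) auto
        moreover have "N - (N - i) = i" "N - (j + i - N) = 2 * N - j - i"
          using i less.prems by auto
        ultimately show "t i \<in> range to_ac"
          by (auto simp: t_def intro: range_to_ac_closed)
      qed
      then show ?thesis
        unfolding eq by (intro range_to_ac_closed range_to_ac_const sq)
    qed
  qed
  from this[of "N - k"] show ?thesis
    by (cases "k \<le> N") (auto simp: N_def coeff_eq_0 range_to_ac_const)
qed

definition index_pairs :: "nat \<Rightarrow> (nat \<times> nat) set" where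
  "index_pairs n = {(i, j). i < j \<and> j < n}"

lemma finite_index_pairs [simp]: "finite (index_pairs n)"
  by (rule finite_subset[of _ "{..<n} \<times> {..<n}"]) (auto simp: index_pairs_def)

lemma square_partition:
  "{..<n} \<times> {..<n} = index_pairs n \<union> prod.swap ` index_pairs n \<union> (\<lambda>i. (i, i)) ` {..<n}"
  by (force simp: index_pairs_def image_iff)

lemma prod_square_symmetric:
  fixes F :: "nat \<Rightarrow> nat \<Rightarrow> 'a::comm_monoid_mult"
  assumes sym: "\<And>i j. F i j = F j i"
  shows "(\<Prod>i<n. \<Prod>j<n. F i j) =
    (\<Prod>(i, j)\<in>index_pairs n. F i j) ^ 2 * (\<Prod>i<n. F i i)"
proof -
  have "(\<Prod>i<n. \<Prod>j<n. F i j) = (\<Prod>(i, j)\<in>{..<n} \<times> {..<n}. F i j)"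
    by (simp add: prod.cartesian_product)
  also have "\<dots> = (\<Prod>(i, j)\<in>index_pairs n \<union> prod.swap ` index_pairs n. F i j) *
      (\<Prod>(i, j)\<in>(\<lambda>i. (i, i)) ` {..<n}. F i j)"
    unfolding square_partition by (rule prod.union_disjoint) (simp, simp, auto simp: index_pairs_def)
  also have "(\<Prod>(i, j)\<in>(\<lambda>i. (i, i)) ` {..<n}. F i j) = (\<Prod>i<n. F i i)"
    by (subst prod.reindex) (auto simp: inj_on_def)
  also have "(\<Prod>(i, j)\<in>index_pairs n \<union> prod.swap ` index_pairs n. F i j) =
      (\<Prod>(i, j)\<in>index_pairs n. F i j) * (\<Prod>(i, j)\<in>prod.swap ` index_pairs n. F i j)"
    by (rule prod.union_disjoint) (simp, simp, auto simp: index_pairs_def)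
  also have "(\<Prod>(i, j)\<in>prod.swap ` index_pairs n. F i j) = (\<Prod>(i, j)\<in>index_pairs n. F i j)"
    by (subst prod.reindex) (auto simp: inj_on_def sym intro!: prod.cong)
  finally show ?thesis
    by (simp add: power2_eq_square)
qed

lemma card_index_pairs: "2 * card (index_pairs n) + n = n * n"
proof -
  have "card ({..<n} \<times> {..<n}) = card (index_pairs n \<union> prod.swap ` index_pairs n) + card ((\<lambda>i. (i, i)) ` {..<n})"
    unfolding square_partition by (rule card_Un_disjoint) (simp, simp, auto simp: index_pairs_def)
  also have "card (index_pairs n \<union> prod.swap ` index_pairs n) = card (index_pairs n) + card (prod.swap ` index_pairs n)"
    by (rule card_Un_disjoint) (simp, simp, auto simp: index_pairs_def)
  also have "card (prod.swap ` index_pairs n) = card (index_pairs n)"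
    by (rule card_image) (auto simp: inj_on_def)
  also have "card ((\<lambda>i. (i, i)) ` {..<n}) = n"
    by (subst card_image) (auto simp: inj_on_def)
  finally show ?thesis by simp
qed

text \<open>
  This is Laplace's auxiliary polynomial, with one root for each unordered pair of roots of \<open>p\<close>. Its
  square, times the factors for the pairs \<open>(i, i)\<close>, is the product over all ordered pairs. For an
  argument in the base field, this product and the diagonal factors are products over the roots of \<open>p\<close>
  of values of a polynomial with coefficients in the base field. Hence the square takes values in the
  base field at all but finitely many points of it.
\<close>

lemma pair_polynomial_coeffs_in_range:
  fixes p :: "'a::field_char_0 poly" and as :: "'a alg_closure list" and r :: 'a
  assumes p: "map_poly to_ac p = (\<Prod>a\<in>#mset as. [:- a, 1:])"
  defines "n \<equiv> length as"
  defines "F \<equiv> \<lambda>i j. as ! i + as ! j + to_ac r * (as ! i * as ! j)"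
  shows "coeff (\<Prod>(i, j)\<in>index_pairs n. [:- F i j, 1:]) k \<in> range to_ac"
proof -
  define L where "L = (\<Prod>(i, j)\<in>index_pairs n. [:- F i j, 1:])"
  have lc: "lead_coeff L = 1"
    by (simp add: L_def lead_coeff_prod case_prod_beta)
  have prod_as: "(\<Prod>a\<in>#mset as. h a) = (\<Prod>i<n. h (as ! i))" for h :: "'a alg_closure \<Rightarrow> 'a alg_closure"
  proof -
    have "(\<Prod>a\<in>#mset as. h a) = prod_list (map h as)"
      by (simp flip: mset_map add: prod_mset_prod_list)
    then show ?thesis
      by (simp add: prod.list_conv_set_nth n_def atLeast0LessThan)
  qed
  have coeffs: "coeff (\<Prod>a\<in>#mset as. [:- a, 1:]) k = to_ac (coeff p k)" for k
    by (simp flip: p add: coeff_map_poly)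
  have full: "(\<Prod>i<n. \<Prod>j<n. to_ac x - F i j) \<in> range to_ac" for x
  proof -
    (* the inner product over j is g at the root with index i *)
    define g where "g = (\<Sum>k\<le>n. smult (coeff p k) ([:x, -1:] ^ k * [:1, r:] ^ (n - k)))"
    have g: "poly (map_poly to_ac g) y = (\<Prod>j<n. (to_ac x - y) - as ! j * (1 + to_ac r * y))" for y
    proof -
      have hom: "map_poly to_ac (sum f A) = (\<Sum>k\<in>A. map_poly to_ac (f k))" for f :: "nat \<Rightarrow> 'a poly" and A
        by (rule poly_eqI) (simp add: coeff_map_poly coeff_sum to_ac_sum)
      have pow: "map_poly to_ac (f ^ k) = map_poly to_ac f ^ k" for f :: "'a poly" and k
        by (induction k) (simp_all add: map_poly_to_ac_mult)
      have "poly (map_poly to_ac g) y =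
          (\<Sum>k\<le>n. to_ac (coeff p k) * (to_ac x - y) ^ k * (1 + to_ac r * y) ^ (n - k))"
        by (simp add: g_def hom pow map_poly_smult map_poly_to_ac_mult poly_sum map_poly_pCons mult_ac)
      also have "\<dots> = (\<Prod>a\<in>#mset as. (to_ac x - y) - a * (1 + to_ac r * y))"
        by (subst homogenized_prod_linear) (simp add: n_def coeffs)
      finally show ?thesis
        by (simp only: prod_as)
    qed
    have "(\<Prod>a\<in>#mset as. poly (map_poly to_ac g) a) \<in> range to_ac"
      by (rule prod_over_roots_in_range[OF p])
    also have "(\<Prod>a\<in>#mset as. poly (map_poly to_ac g) a) = (\<Prod>i<n. \<Prod>j<n. to_ac x - F i j)"
      unfolding prod_as g by (intro prod.cong refl) (simp add: F_def algebra_simps)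
    finally show ?thesis .
  qed
  have diag: "(\<Prod>i<n. to_ac x - F i i) \<in> range to_ac" for x
  proof -
    have "(\<Prod>a\<in>#mset as. poly (map_poly to_ac [:x, -2, - r:]) a) \<in> range to_ac"
      by (rule prod_over_roots_in_range[OF p])
    also have "(\<Prod>a\<in>#mset as. poly (map_poly to_ac [:x, -2, - r:]) a) = (\<Prod>i<n. to_ac x - F i i)"
      unfolding prod_as by (intro prod.cong refl) (simp add: F_def map_poly_pCons algebra_simps)
    finally show ?thesis .
  qed
  have polyL: "poly L y = (\<Prod>(i, j)\<in>index_pairs n. y - F i j)" for y
    by (simp add: L_def poly_prod case_prod_beta)
  (* at these points the diagonal factors can be divided out *)
  define T where "T = {x. (\<Prod>i<n. to_ac x - F i i) \<noteq> 0}"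
  have "finite (- T)"
  proof -
    have "- T \<subseteq> of_ac ` (\<lambda>i. F i i) ` {..<n}"
    proof
      fix x assume "x \<in> - T"
      then have "\<exists>i\<in>{..<n}. to_ac x - F i i = 0"
        unfolding T_def by (subst (asm) Compl_iff) (simp only: mem_Collect_eq not_not prod_zero_iff finite_lessThan)
      then obtain i where i: "i \<in> {..<n}" "to_ac x - F i i = 0"
        by blast
      have "of_ac (F i i) = x"
        by (rule of_ac_eqI) (use i(2) in \<open>simp only: right_minus_eq\<close>)
      then show "x \<in> of_ac ` (\<lambda>i. F i i) ` {..<n}"
        using i(1) by blast
    qed
    then show ?thesis
      by (rule finite_subset) auto
  qed
  then have T: "infinite T"
    using infinite_UNIV_char_0[where 'a = 'a] by (auto simp: finite_compl)
  have LL: "coeff (L * L) k \<in> range to_ac" for k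
  proof (rule interpolated_coeffs_in_range[OF T])
    fix x assume x: "x \<in> T"
    have "(\<Prod>i<n. \<Prod>j<n. to_ac x - F i j) = poly (L * L) (to_ac x) * (\<Prod>i<n. to_ac x - F i i)"
      by (subst prod_square_symmetric) (simp_all add: F_def algebra_simps polyL power2_eq_square)
    then have "poly (L * L) (to_ac x) = (\<Prod>i<n. \<Prod>j<n. to_ac x - F i j) / (\<Prod>i<n. to_ac x - F i i)"
      using x by (simp add: T_def)
    then show "poly (L * L) (to_ac x) \<in> range to_ac"
      using full diag by (auto intro: range_to_ac_closed)
  qed
  show ?thesis
    using square_coeffs_in_range_imp[OF lc LL] by (simp add: L_def)
qed

text \<open>
  For a square root \<open>\<iota>\<close> of \<open>- 1\<close>, this is the field obtained by adjoining \<open>\<iota>\<close>, as a subset of the algebraic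
  closure.
\<close>

definition complex_part :: "'a::real_closed_field alg_closure \<Rightarrow> 'a alg_closure set" where
  "complex_part \<iota> = {to_ac a + \<iota> * to_ac b |a b. True}"

lemma nonneg_sqrt:
  fixes x :: "'a::real_closed_field"
  assumes "0 \<le> x"
  shows "\<exists>s\<ge>0. s * s = x"
proof (cases "x = 0")
  case False
  then obtain s where "s * s = x"
    using assms pos_square[of x] by auto
  then show ?thesis
    by (intro exI[of _ "\<bar>s\<bar>"]) simp
qed auto

lemma complex_partI: "to_ac a + \<iota> * to_ac b \<in> complex_part \<iota>"
  by (auto simp: complex_part_def)

lemma to_ac_in_complex_part: "to_ac a \<in> complex_part \<iota>"
  using complex_partI[of a \<iota> 0] by simp

lemma complex_part_add:
  "x \<in> complex_part \<iota> \<Longrightarrow> y \<in> complex_part \<iota> \<Longrightarrow> x + y \<in> complex_part \<iota>"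
proof -
  assume "x \<in> complex_part \<iota>" "y \<in> complex_part \<iota>"
  then obtain a b c d where "x = to_ac a + \<iota> * to_ac b" "y = to_ac c + \<iota> * to_ac d"
    by (auto simp: complex_part_def)
  then have "x + y = to_ac (a + c) + \<iota> * to_ac (b + d)"
    by (simp add: algebra_simps)
  then show ?thesis
    by (simp only: complex_partI)
qed

lemma complex_part_mult:
  assumes "\<iota> * \<iota> = - 1" "x \<in> complex_part \<iota>" "y \<in> complex_part \<iota>"
  shows "x * y \<in> complex_part \<iota>"
proof -
  obtain a b c d where xy: "x = to_ac a + \<iota> * to_ac b" "y = to_ac c + \<iota> * to_ac d"
    using assms(2,3) by (auto simp: complex_part_def)
  have "x * y = to_ac a * to_ac c + (\<iota> * \<iota>) * (to_ac b * to_ac d) + \<iota> * (to_ac a * to_ac d + to_ac b * to_ac c)"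
    by (simp add: xy algebra_simps)
  also have "\<dots> = to_ac (a * c - b * d) + \<iota> * to_ac (a * d + b * c)"
    by (simp add: assms(1))
  finally show ?thesis
    by (simp only: complex_partI)
qed

lemma complex_part_diff:
  assumes "\<iota> * \<iota> = - 1" "x \<in> complex_part \<iota>" "y \<in> complex_part \<iota>"
  shows "x - y \<in> complex_part \<iota>"
proof -
  have "x + to_ac (-1) * y \<in> complex_part \<iota>"
    by (intro complex_part_add complex_part_mult to_ac_in_complex_part assms)
  then show ?thesis by simp
qed

text \<open>
  With \<open>r\<close> the absolute value of \<open>z = a + \<iota> b\<close>, the real and imaginary parts of a root have the squares
  \<open>(r + a) / 2\<close> and \<open>(r - a) / 2\<close>; the sign of \<open>b\<close> decides on their relative sign.
\<close>

lemma complex_part_sqrt: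
  assumes i: "\<iota> * \<iota> = - 1" and "z \<in> complex_part \<iota>"
  shows "\<exists>w\<in>complex_part \<iota>. w * w = z"
proof -
  obtain a b where z: "z = to_ac a + \<iota> * to_ac b"
    using assms(2) by (auto simp: complex_part_def)
  obtain r where r: "r \<ge> 0" "r * r = a * a + b * b"
    using nonneg_sqrt[of "a * a + b * b"] by auto
  have "\<bar>a\<bar> \<le> r"
  proof (rule power2_le_imp_le)
    show "\<bar>a\<bar>\<^sup>2 \<le> r\<^sup>2"
      using r(2) by (simp add: power2_eq_square)
  qed (rule r(1))
  then have "0 \<le> (r + a) / 2" "0 \<le> (r - a) / 2"
    by auto
  then obtain u v where uv: "u \<ge> 0" "u * u = (r + a) / 2" "v \<ge> 0" "v * v = (r - a) / 2"
    using nonneg_sqrt by metis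
  define v' where "v' = (if b \<ge> 0 then v else - v)"
  have d: "u * u - v' * v' = a"
    using uv by (simp add: v'_def field_simps)
  have "(2 * u * v)\<^sup>2 = 4 * (u * u) * (v * v)"
    by (simp add: power2_eq_square)
  also have "\<dots> = \<bar>b\<bar>\<^sup>2"
    unfolding uv(2,4) using r(2) by (simp add: power2_eq_square field_simps)
  finally have sq: "(2 * u * v)\<^sup>2 = \<bar>b\<bar>\<^sup>2" .
  have "0 \<le> 2 * u * v"
    using uv(1,3) by simp
  then have "2 * u * v = \<bar>b\<bar>"
    using power2_eq_imp_eq[OF sq] by simp
  then have m: "2 * u * v' = b"
    by (auto simp: v'_def)
  define w where "w = to_ac u + \<iota> * to_ac v'"
  have "w * w = to_ac u * to_ac u + (\<iota> * \<iota>) * (to_ac v' * to_ac v') + \<iota> * (2 * to_ac u * to_ac v')"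
    by (simp add: w_def algebra_simps)
  also have "\<dots> = to_ac (u * u - v' * v') + \<iota> * to_ac (2 * u * v')"
    by (simp add: i)
  finally have "w * w = z"
    by (simp add: d m z)
  then show ?thesis
    using complex_partI by (auto simp: w_def)
qed

lemma complex_part_of_sum_and_product:
  assumes i: "\<iota> * \<iota> = - 1" and s: "\<alpha> + \<beta> \<in> complex_part \<iota>" and p: "\<alpha> * \<beta> \<in> complex_part \<iota>"
  shows "\<alpha> \<in> complex_part \<iota>"
proof -
  have "(\<alpha> + \<beta>) * (\<alpha> + \<beta>) - to_ac 4 * (\<alpha> * \<beta>) \<in> complex_part \<iota>"
    by (intro complex_part_diff complex_part_mult to_ac_in_complex_part i s p)
  also have "(\<alpha> + \<beta>) * (\<alpha> + \<beta>) - to_ac 4 * (\<alpha> * \<beta>) = (\<alpha> - \<beta>) * (\<alpha> - \<beta>)"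
    by (simp add: algebra_simps)
  finally obtain w where w: "w \<in> complex_part \<iota>" "w * w = (\<alpha> - \<beta>) * (\<alpha> - \<beta>)"
    using complex_part_sqrt[OF i] by blast
  have "to_ac (-1) * w \<in> complex_part \<iota>"
    by (intro complex_part_mult i w to_ac_in_complex_part)
  moreover have "\<alpha> - \<beta> = w \<or> \<alpha> - \<beta> = - w"
    using w(2) by (metis square_eq_iff)
  ultimately have d: "\<alpha> - \<beta> \<in> complex_part \<iota>"
    using w(1) by auto
  have "to_ac (1 / 2) * ((\<alpha> + \<beta>) + (\<alpha> - \<beta>)) \<in> complex_part \<iota>"
    by (intro complex_part_mult complex_part_add i s d to_ac_in_complex_part)
  then show ?thesis
    by simp
qed

text \<open>
  Laplace's proof of the fundamental theorem of algebra, by induction on the exponent of \<open>2\<close> in the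
  degree. This exponent is smaller by one for the auxiliary polynomial, so that for each \<open>r\<close> some number
  \<open>\<alpha> + \<beta> + r \<alpha> \<beta>\<close>, with \<open>\<alpha>\<close> and \<open>\<beta>\<close> two roots of \<open>p\<close>, lies in the quadratic extension. Two values of \<open>r\<close> share
  the pair of roots, which puts the sum and the product of this pair, and therefore \<open>\<alpha>\<close>, into the
  extension.
\<close>

lemma monic_has_root_in_complex_part:
  fixes p :: "'a::real_closed_field poly"
  assumes i: "\<iota> * \<iota> = - 1"
  shows "lead_coeff p = 1 \<Longrightarrow> degree p = 2 ^ k * m \<Longrightarrow> odd m \<Longrightarrow>
    \<exists>z\<in>complex_part \<iota>. poly (map_poly to_ac p) z = 0"
proof (induction k arbitrary: p m)
  case 0
  have "\<exists>x. (\<Sum>k\<le>degree p. coeff p k * x ^ k) = 0"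
    by (rule odd_degree_root) (use 0 in auto)
  then obtain x where "poly p x = 0"
    by (auto simp: poly_altdef)
  then have "poly (map_poly to_ac p) (to_ac x) = 0"
    by (simp flip: to_ac_poly)
  then show ?case
    using to_ac_in_complex_part by blast
next
  case (Suc k)
  define n where "n = degree p"
  have "map_poly to_ac p \<noteq> 0"
    using Suc.prems(1) by (metis coeff_0 coeff_map_poly to_ac_0 to_ac_eq_0_iff zero_neq_one)
  then obtain A where A: "size A = n" "map_poly to_ac p = (\<Prod>x\<in>#A. [:- x, 1:])"
    using alg_closed_imp_factorization[of "map_poly to_ac p"] Suc.prems(1)
    by (auto simp: coeff_map_poly n_def)
  obtain as where as: "mset as = A"
    using ex_mset by blast
  have len: "length as = n"
    using A(1) as by auto
  have p: "map_poly to_ac p = (\<Prod>x\<in>#mset as. [:- x, 1:])"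
    using A(2) as by simp
  define F where "F r i j = as ! i + as ! j + to_ac r * (as ! i * as ! j)" for r i j
  have hit: "\<exists>ij\<in>index_pairs n. F r (fst ij) (snd ij) \<in> complex_part \<iota>" for r
  proof -
    define L where "L = (\<Prod>(i, j)\<in>index_pairs n. [:- F r i j, 1:])"
    have "coeff L k \<in> range to_ac" for k
      unfolding L_def F_def len[symmetric] by (rule pair_polynomial_coeffs_in_range[OF p])
    then obtain l where l: "L = map_poly to_ac l"
      using coeffs_in_range_imp_map_poly by blast
    have "lead_coeff L = 1"
      by (simp add: L_def lead_coeff_prod case_prod_beta)
    then have lc: "lead_coeff l = 1"
      by (simp add: l coeff_map_poly flip: to_ac_1)
    have "degree L = card (index_pairs n)"
      unfolding L_def by (subst degree_prod_eq_sum_degree) (auto simp: case_prod_beta)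
    moreover have "card (index_pairs n) = 2 ^ k * (m * (2 ^ Suc k * m - 1))"
    proof -
      have n: "n = 2 * (2 ^ k * m)"
        using Suc.prems(2) by (simp add: n_def)
      have "2 * card (index_pairs n) = n * n - n"
        using card_index_pairs[of n] by simp
      also have "\<dots> = n * (n - 1)"
        by (simp add: diff_mult_distrib2)
      finally show ?thesis
        by (simp add: n mult_ac)
    qed
    ultimately have deg: "degree l = 2 ^ k * (m * (2 ^ Suc k * m - 1))"
      by (simp add: l)
    have "odd (m * (2 ^ Suc k * m - 1))"
      using Suc.prems(3) by (auto elim: oddE)
    from Suc.IH[OF lc deg this] obtain z where z: "z \<in> complex_part \<iota>" "poly L z = 0"
      by (auto simp: l)
    have "\<exists>ij\<in>index_pairs n. poly (case ij of (i, j) \<Rightarrow> [:- F r i j, 1:]) z = 0"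
      using z(2) unfolding L_def poly_prod by (subst (asm) prod_zero_iff) (rule finite_index_pairs)
    then obtain ij where ij: "ij \<in> index_pairs n" "poly (case ij of (i, j) \<Rightarrow> [:- F r i j, 1:]) z = 0"
      by blast
    then have "z - F r (fst ij) (snd ij) = 0"
      by (simp add: case_prod_beta)
    then have "F r (fst ij) (snd ij) = z"
      by (simp only: right_minus_eq)
    with ij(1) z(1) show ?thesis
      by blast
  qed
  then obtain h where h: "\<And>r. h r \<in> index_pairs n" "\<And>r. F r (fst (h r)) (snd (h r)) \<in> complex_part \<iota>"
    by metis
  have "\<not> inj h"
  proof
    assume "inj h"
    moreover have "range h \<subseteq> index_pairs n"
      using h(1) by blast
    ultimately have "finite (UNIV :: 'a set)"
      using finite_index_pairs inj_on_finite by blast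
    then show False
      using infinite_UNIV_char_0 by blast
  qed
  (* there are infinitely many values of r, but only finitely many pairs of roots *)
  then obtain r r' where r: "r \<noteq> r'" "h r = h r'"
    by (auto simp: inj_def)
  define x y where "x = as ! fst (h r)" and "y = as ! snd (h r)"
  have Fr: "x + y + to_ac r * (x * y) \<in> complex_part \<iota>" and Fr': "x + y + to_ac r' * (x * y) \<in> complex_part \<iota>"
    using h(2)[of r] h(2)[of r'] r(2) by (simp_all only: F_def x_def y_def)
  have "to_ac (inverse (r - r')) * ((x + y + to_ac r * (x * y)) - (x + y + to_ac r' * (x * y))) \<in> complex_part \<iota>"
    by (intro complex_part_mult complex_part_diff i Fr Fr' to_ac_in_complex_part)
  also have "(x + y + to_ac r * (x * y)) - (x + y + to_ac r' * (x * y)) = to_ac (r - r') * (x * y)"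
    by (simp add: algebra_simps)
  also have "to_ac (inverse (r - r')) * (to_ac (r - r') * (x * y)) = to_ac (inverse (r - r') * (r - r')) * (x * y)"
    by (simp only: to_ac_mult mult.assoc)
  also have "\<dots> = x * y"
    using r(1) by (simp del: to_ac_mult to_ac_inverse to_ac_diff)
  finally have xy: "x * y \<in> complex_part \<iota>" .
  have "x + y + to_ac r * (x * y) - to_ac r * (x * y) \<in> complex_part \<iota>"
    by (intro complex_part_mult complex_part_diff i Fr xy to_ac_in_complex_part)
  then have "x + y \<in> complex_part \<iota>"
    by simp
  then have "x \<in> complex_part \<iota>"
    using xy complex_part_of_sum_and_product[OF i] by blast
  moreover have "fst (h r) < length as"
    using h(1)[of r] by (auto simp: index_pairs_def len)
  then have "poly (map_poly to_ac p) x = 0"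
    unfolding p poly_prod_mset_linear by (auto simp: x_def)
  ultimately show ?case
    by blast
qed

lemma power_2_times_odd: "0 < n \<Longrightarrow> \<exists>k m. n = 2 ^ k * m \<and> odd (m :: nat)"
proof (induction n rule: less_induct)
  case (less n)
  show ?case
  proof (cases "odd n")
    case True
    then show ?thesis
      by (intro exI[of _ 0] exI[of _ n]) simp
  next
    case False
    then obtain l where l: "n = 2 * l"
      by (auto elim: evenE)
    then obtain k m where "l = 2 ^ k * m" "odd m"
      using less.IH[of l] less.prems by auto
    then show ?thesis
      by (intro exI[of _ "Suc k"] exI[of _ m]) (simp add: l)
  qed
qed

text \<open>
  A root \<open>a + \<iota> b\<close> with \<open>b \<noteq> 0\<close> yields the factor \<open>(x - a)\<^sup>2 + b\<^sup>2\<close>.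
\<close>

lemma linear_or_definite_factor:
  fixes p :: "'a::real_closed_field poly"
  assumes "degree p > 0"
  shows "\<exists>q r. p = q * r \<and> ((\<exists>c. q = [:- c, 1:]) \<or> (degree q = 2 \<and> (\<forall>x. poly q x > 0)))"
proof -
  obtain \<iota> :: "'a alg_closure" where i: "\<iota> * \<iota> = - 1"
    using nth_root_exists[of 2 "- 1 :: 'a alg_closure"] by (auto simp: power2_eq_square)
  define p' where "p' = smult (inverse (lead_coeff p)) p"
  have p0: "p \<noteq> 0"
    using assms by auto
  obtain k m where km: "degree p = 2 ^ k * m" "odd m"
    using power_2_times_odd assms by blast
  have "\<exists>z\<in>complex_part \<iota>. poly (map_poly to_ac p') z = 0"
  proof (rule monic_has_root_in_complex_part[OF i])
    show "lead_coeff p' = 1"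
      using p0 by (simp add: p'_def)
    show "degree p' = 2 ^ k * m"
      using p0 by (simp add: p'_def flip: km(1))
  qed (rule km(2))
  then obtain a b where ab: "poly (map_poly to_ac p') (to_ac a + \<iota> * to_ac b) = 0"
    by (auto simp: complex_part_def)
  define z where "z = to_ac a + \<iota> * to_ac b"
  have z: "poly (map_poly to_ac p) z = 0"
    using ab p0 by (simp add: p'_def map_poly_smult z_def)
  show ?thesis
  proof (cases "b = 0")
    case True
    then have "to_ac (poly p a) = 0"
      using z by (simp add: to_ac_poly z_def)
    then have "poly p a = 0"
      by simp
    then show ?thesis
      by (metis dvdE poly_eq_0_iff_dvd)
  next
    case False
    define q where "q = [:a * a + b * b, - 2 * a, 1:]"
    have qpos: "poly q x > 0" for x
    proof -
      have "poly q x = (x - a) * (x - a) + b * b"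
        by (simp add: q_def algebra_simps)
      moreover have "b * b > 0"
        using False by (metis mult_neg_neg mult_pos_pos neqE)
      ultimately show ?thesis
        by (simp add: add_nonneg_pos)
    qed
    have degq: "degree q = 2"
      by (simp add: q_def)
    have "poly (map_poly to_ac q) z = (\<iota> * \<iota> + 1) * (to_ac b * to_ac b)"
      by (simp add: q_def z_def map_poly_pCons algebra_simps)
    then have qz: "poly (map_poly to_ac q) z = 0"
      by (simp add: i)
    define s where "s = p mod q"
    have "degree s < 2"
      using degree_mod_less[of q p] degq by (auto simp: s_def q_def)
    then obtain u v where s: "s = [:u, v:]"
    proof -
      obtain u s' where s': "s = pCons u s'"
        by (cases s)
      with \<open>degree s < 2\<close> have "degree s' = 0"
        by (cases "s' = 0") auto
      then obtain v where "s' = [:v:]"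
        by (rule degree_eq_zeroE)
      with s' that show ?thesis by simp
    qed
    have "p = q * (p div q) + s"
      by (simp add: s_def)
    then have "map_poly to_ac p = map_poly to_ac q * map_poly to_ac (p div q) + map_poly to_ac s"
      by (metis map_poly_to_ac_add map_poly_to_ac_mult)
    then have "poly (map_poly to_ac s) z = 0"
      using z qz by simp
    then have "to_ac (u + v * a) = - (\<iota> * to_ac (v * b))"
      by (simp add: s map_poly_pCons z_def algebra_simps eq_neg_iff_add_eq_0)
    then have "to_ac (u + v * a) * to_ac (u + v * a) = (\<iota> * \<iota>) * (to_ac (v * b) * to_ac (v * b))"
      by (simp add: mult_ac del: to_ac_mult to_ac_add)
    then have "to_ac ((u + v * a) * (u + v * a) + (v * b) * (v * b)) = 0"
      by (simp add: i)
    then have "(u + v * a) * (u + v * a) + (v * b) * (v * b) = 0"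
      by (simp only: to_ac_eq_0_iff)
    then have "u + v * a = 0 \<and> v * b = 0"
      by (simp only: sum_squares_eq_zero_iff)
    then have "v = 0" "u = 0"
      using False by auto
    then have "s = 0"
      by (simp add: s)
    then have "p = q * (p div q)"
      by (simp add: s_def mod_eq_0_iff_dvd)
    then show ?thesis
      using degq qpos by blast
  qed
qed


section \<open>Intermediate values and monotonicity\<close>

text \<open>
  A definite factor has no influence on the sign, so a change of sign comes from a linear factor whose
  root lies in the interval.
\<close>

lemma rcf_IVT_pos:
  fixes p :: "'a::real_closed_field poly"
  assumes "a < b" "poly p a < 0" "0 < poly p b"
  shows "\<exists>x. a < x \<and> x < b \<and> poly p x = 0"
  using assms
proof (induction "degree p" arbitrary: p rule: less_induct)
  case less
  have "degree p > 0"
  proof (rule ccontr)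
    assume "\<not> degree p > 0"
    then obtain c where "p = [:c:]"
      by (auto elim: degree_eq_zeroE)
    then show False
      using less.prems by simp
  qed
  then obtain q r where p: "p = q * r" and q: "(\<exists>c. q = [:- c, 1:]) \<or> (degree q = 2 \<and> (\<forall>x. poly q x > 0))"
    using linear_or_definite_factor by blast
  have "p \<noteq> 0"
    using less.prems by auto
  then have nz: "q \<noteq> 0" "r \<noteq> 0"
    by (auto simp: p)
  have "degree q > 0"
    using q by auto
  then have deg: "degree r < degree p"
    using nz by (simp add: p degree_mult_eq)
  consider (inside) c where "a < c" "c < b" "q = [:- c, 1:]"
    | (pos) "poly q a > 0" "poly q b > 0" | (neg) "poly q a < 0" "poly q b < 0"
  proof (cases "\<exists>c. q = [:- c, 1:]")
    case True
    then obtain c where c: "q = [:- c, 1:]"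
      by blast
    have "c \<noteq> a" "c \<noteq> b"
      using less.prems by (auto simp: p c)
    then consider "c < a" | "a < c \<and> c < b" | "b < c"
      by fastforce
    then show ?thesis
      using that c less.prems(1) by cases auto
  next
    case False
    then show ?thesis
      using q that by blast
  qed
  then show ?case
  proof cases
    case inside
    then show ?thesis
      by (intro exI[of _ c]) (simp add: p)
  next
    case pos
    then have "poly r a < 0" "0 < poly r b"
      using less.prems by (auto simp: p mult_less_0_iff zero_less_mult_iff)
    then show ?thesis
      using less.hyps[OF deg less.prems(1)] by (auto simp: p)
  next
    case neg
    then have "poly (- r) a < 0" "0 < poly (- r) b"
      using less.prems by (auto simp: p mult_less_0_iff zero_less_mult_iff)
    then show ?thesis
      using less.hyps[of "- r"] deg less.prems(1) by (auto simp: p)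
  qed
qed

lemma rcf_IVT:
  fixes p :: "'a::real_closed_field poly"
  assumes "a < b" "poly p a * poly p b < 0"
  shows "\<exists>x. a < x \<and> x < b \<and> poly p x = 0"
  using assms(2) rcf_IVT_pos[OF assms(1), of p] rcf_IVT_pos[OF assms(1), of "- p"]
  by (auto simp: mult_less_0_iff)

abbreviation segment :: "'a::linorder \<Rightarrow> 'a \<Rightarrow> 'a set" where
  "segment x y \<equiv> {min x y..max x y}"

lemma rcf_sgn_eq_if_no_root:
  fixes p :: "'a::real_closed_field poly"
  assumes "\<And>z. z \<in> segment x y \<Longrightarrow> poly p z \<noteq> 0"
  shows "sgn (poly p x) = sgn (poly p y)"
proof -
  have *: "sgn (poly p x) = sgn (poly p y)" if "x < y" "\<And>z. z \<in> segment x y \<Longrightarrow> poly p z \<noteq> 0" for x y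
  proof (rule ccontr)
    assume "sgn (poly p x) \<noteq> sgn (poly p y)"
    moreover have "poly p x \<noteq> 0" "poly p y \<noteq> 0"
      using that by auto
    ultimately have "poly p x * poly p y < 0"
      by (auto simp: sgn_if mult_less_0_iff split: if_splits)
    from rcf_IVT[OF that(1) this] that(2) show False
      by (force simp: min_def max_def)
  qed
  consider "x < y" | "x = y" | "y < x"
    by fastforce
  then show ?thesis
    using *[of x y] *[of y x] assms by cases (auto simp: min.commute max.commute)
qed

text \<open>
  The analytic proof needs a maximum, hence completeness. Here, for consecutive roots \<open>a < d\<close>, write
  \<open>p = (x - a) ^ Suc m * (x - d) ^ Suc n * q\<close> with \<open>q\<close> of constant sign on the interval from \<open>a\<close> to \<open>d\<close>. The
  derivative is \<open>(x - a) ^ m * (x - d) ^ n * r\<close> with \<open>r\<close> of opposite signs at \<open>a\<close> and \<open>d\<close>.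
\<close>

lemma rcf_rolle:
  fixes p :: "'a::real_closed_field poly"
  assumes "a < b" "poly p a = 0" "poly p b = 0"
  shows "\<exists>c. a < c \<and> c < b \<and> poly (pderiv p) c = 0"
proof (cases "p = 0")
  case True
  then show ?thesis
    using dense[OF assms(1)] by auto
next
  case False
  define Z where "Z = {x. poly p x = 0} \<inter> {a<..b}"
  have Z: "finite Z" "b \<in> Z"
    using poly_roots_finite[OF False] assms by (auto simp: Z_def)
  define d where "d = Min Z"
  have "d \<in> Z"
    unfolding d_def by (rule Min_in) (use Z in auto)
  then have d: "a < d" "d \<le> b" "poly p d = 0"
    by (auto simp: Z_def)
  have no: "poly p x \<noteq> 0" if "a < x" "x < d" for x
  proof
    assume "poly p x = 0"
    then have "x \<in> Z"
      using that d by (auto simp: Z_def)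
    then show False
      using Min_le[OF Z(1), of x] that unfolding d_def by force
  qed
  obtain p1 where p1: "p = [:- a, 1:] ^ Polynomial.order a p * p1" "\<not> [:- a, 1:] dvd p1"
    using order_decomp[OF False] by blast
  have "p1 \<noteq> 0"
    using p1(2) by auto
  then obtain q where q: "p1 = [:- d, 1:] ^ Polynomial.order d p1 * q" "\<not> [:- d, 1:] dvd q"
    using order_decomp by blast
  have p1a: "poly p1 a \<noteq> 0"
    using p1(2) by (simp add: poly_eq_0_iff_dvd)
  have "Polynomial.order a p \<noteq> 0"
    using assms(2) False by (simp add: order_root)
  then obtain m where m: "Polynomial.order a p = Suc m"
    using not0_implies_Suc by blast
  have "poly p1 d = 0"
    using d(1,3) by (subst (asm) p1(1)) (simp add: poly_power)
  then have "Polynomial.order d p1 \<noteq> 0"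
    using \<open>p1 \<noteq> 0\<close> by (simp add: order_root)
  then obtain n where n: "Polynomial.order d p1 = Suc n"
    using not0_implies_Suc by blast
  have p: "p = [:- a, 1:] ^ Suc m * ([:- d, 1:] ^ Suc n * q)"
    using p1(1) q(1) by (simp only: m n)
  have qa: "poly q a \<noteq> 0"
    using p1a by (subst (asm) q(1)) auto
  have qd: "poly q d \<noteq> 0"
    using q(2) by (simp add: poly_eq_0_iff_dvd)
  have "sgn (poly q a) = sgn (poly q d)"
  proof (rule rcf_sgn_eq_if_no_root)
    fix z assume "z \<in> segment a d"
    then consider "z = a" | "z = d" | "a < z" "z < d"
      using d(1) by fastforce
    then show "poly q z \<noteq> 0"
    proof cases
      case 3
      then show ?thesis
        using no[of z] by (auto simp: p)
    qed (use qa qd in auto)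
  qed
  then have sq: "poly q a * poly q d > 0"
    using qa qd by (auto simp: sgn_if zero_less_mult_iff split: if_splits)
  define r where "r = smult (of_nat (Suc m)) ([:- d, 1:] * q) + smult (of_nat (Suc n)) ([:- a, 1:] * q)
      + [:- a, 1:] * [:- d, 1:] * pderiv q"
  have pd: "poly (pderiv p) x = (x - a) ^ m * (x - d) ^ n * poly r x" for x
    unfolding p pderiv_mult pderiv_power_Suc r_def
    by (simp add: pderiv_pCons algebra_simps)
  have r: "poly r a = of_nat (Suc m) * (a - d) * poly q a" "poly r d = of_nat (Suc n) * (d - a) * poly q d"
    by (simp_all add: r_def algebra_simps)
  have "poly r a * poly r d = - (of_nat (Suc m) * of_nat (Suc n) * ((d - a) * (d - a)) * (poly q a * poly q d))"
    unfolding r by (simp add: algebra_simps del: of_nat_Suc)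
  also have "\<dots> < 0"
  proof -
    have "0 < (of_nat (Suc m) * of_nat (Suc n) :: 'a)" "0 < (d - a) * (d - a)"
      using d(1) by (auto simp del: of_nat_Suc)
    then show ?thesis
      using sq by (simp only: neg_less_0_iff_less mult_pos_pos)
  qed
  finally obtain c where "a < c" "c < d" "poly r c = 0"
    using rcf_IVT[OF d(1)] by blast
  then show ?thesis
    using d(2) pd by (intro exI[of _ c]) auto
qed

lemma rcf_MVT:
  fixes p :: "'a::real_closed_field poly"
  assumes "a < b"
  shows "\<exists>c. a < c \<and> c < b \<and> poly p b - poly p a = (b - a) * poly (pderiv p) c"
proof -
  define s where "s = (poly p b - poly p a) / (b - a)"
  have s: "s * (b - a) = poly p b - poly p a"
    using assms by (simp add: s_def)
  define h where "h = p - [:poly p a:] - smult s [:- a, 1:]"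
  have "poly h a = 0" "poly h b = 0"
    using s by (simp_all add: h_def algebra_simps)
  then obtain c where "a < c" "c < b" "poly (pderiv h) c = 0"
    using rcf_rolle[OF assms] by blast
  moreover have "pderiv h = pderiv p - [:s:]"
    by (simp add: h_def pderiv_diff pderiv_smult pderiv_pCons)
  ultimately show ?thesis
    using s by (intro exI[of _ c]) (auto simp: mult.commute)
qed

lemma rcf_strict_increasing:
  fixes p :: "'a::real_closed_field poly"
  assumes "a < b" "\<And>x. a < x \<Longrightarrow> x < b \<Longrightarrow> poly (pderiv p) x > 0"
  shows "poly p a < poly p b"
proof -
  obtain c where c: "a < c" "c < b" "poly p b - poly p a = (b - a) * poly (pderiv p) c"
    using rcf_MVT[OF assms(1)] by blast
  then have "poly p b - poly p a > 0"
    using assms by simp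
  then show ?thesis by simp
qed

lemma poly_unbounded:
  fixes p :: "'a::linordered_field poly"
  assumes "degree p > 0"
  shows "\<exists>N. \<forall>x. N \<le> \<bar>x\<bar> \<longrightarrow> M \<le> \<bar>poly p x\<bar>"
  using assms
proof (induction p arbitrary: M)
  case 0
  then show ?case by simp
next
  case (pCons a p)
  have "p \<noteq> 0"
    using pCons.prems by auto
  have "\<exists>N c. 0 < c \<and> (\<forall>x. N \<le> \<bar>x\<bar> \<longrightarrow> c \<le> \<bar>poly p x\<bar>)"
  proof (cases "degree p = 0")
    case True
    then obtain c where "p = [:c:]"
      by (auto elim: degree_eq_zeroE)
    then show ?thesis
      using \<open>p \<noteq> 0\<close> by (intro exI[of _ 0] exI[of _ "\<bar>c\<bar>"]) auto
  next
    case False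
    then show ?thesis
      using pCons.IH[of 1] zero_less_one by blast
  qed
  then obtain N c where N: "0 < c" "\<And>x. N \<le> \<bar>x\<bar> \<Longrightarrow> c \<le> \<bar>poly p x\<bar>"
    by blast
  show ?case
  proof (intro exI allI impI)
    fix x assume x: "max N ((\<bar>M\<bar> + \<bar>a\<bar>) / c) \<le> \<bar>x\<bar>"
    have "\<bar>M\<bar> + \<bar>a\<bar> \<le> \<bar>x\<bar> * c"
      using x N(1) by (simp add: divide_le_eq)
    also have "\<dots> \<le> \<bar>x\<bar> * \<bar>poly p x\<bar>"
      using N(2)[of x] x by (intro mult_left_mono) auto
    also have "\<dots> = \<bar>poly (pCons a p) x - a\<bar>"
      by (simp add: abs_mult)
    also have "\<dots> \<le> \<bar>poly (pCons a p) x\<bar> + \<bar>a\<bar>"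
      by (rule abs_triangle_ineq4)
    finally show "M \<le> \<bar>poly (pCons a p) x\<bar>"
      using abs_ge_self[of M] by linarith
  qed
qed

section \<open>Sign diagrams of families of polynomials\<close>

lemma finite_free_left:
  fixes m :: "'a::linordered_field"
  assumes "finite Z"
  shows "\<exists>l<m. {l<..<m} \<inter> Z = {}"
  using assms
proof (induction Z)
  case empty
  show ?case by (intro exI[of _ "m - 1"]) auto
next
  case (insert z Z)
  then obtain l where l: "l < m" "{l<..<m} \<inter> Z = {}"
    by blast
  show ?case
  proof (cases "z < m")
    case True
    then show ?thesis
      using l by (intro exI[of _ "max l z"]) auto
  next
    case False
    then show ?thesis
      using l by (intro exI[of _ l]) auto
  qed
qed

lemma finite_free_right:
  fixes m :: "'a::linordered_field"
  assumes "finite Z"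
  shows "\<exists>u>m. {m<..<u} \<inter> Z = {}"
  using assms
proof (induction Z)
  case empty
  show ?case by (intro exI[of _ "m + 1"]) auto
next
  case (insert z Z)
  then obtain u where u: "m < u" "{m<..<u} \<inter> Z = {}"
    by blast
  show ?case
  proof (cases "m < z")
    case True
    then show ?thesis
      using u by (intro exI[of _ "min u z"]) auto
  next
    case False
    then show ?thesis
      using u by (intro exI[of _ u]) auto
  qed
qed

text \<open>
  The bijection is piecewise linear with the nodes \<open>l\<close>, \<open>c\<close>, \<open>u\<close>.
\<close>

lemma ex_local_rescaling:
  fixes l u c c' :: "'a::linordered_field"
  assumes "l < c" "c < u" "l < c'" "c' < u"
  shows "\<exists>\<theta>. strict_mono \<theta> \<and> surj \<theta> \<and> \<theta> c = c' \<and> (\<forall>y. y \<le> l \<or> u \<le> y \<longrightarrow> \<theta> y = y)"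
proof -
  define k1 k2 where "k1 = (c' - l) / (c - l)" and "k2 = (u - c') / (u - c)"
  have k: "0 < k1" "0 < k2" "(c - l) * k1 = c' - l" "(u - c) * k2 = u - c'"
    using assms by (auto simp: k1_def k2_def)
  define \<theta> where "\<theta> y = (if y \<le> l \<or> u \<le> y then y else if y \<le> c then l + (y - l) * k1 else u - (u - y) * k2)" for y
  have r1: "\<theta> y = y" if "y \<le> l \<or> u \<le> y" for y
    using that by (simp add: \<theta>_def)
  have r2: "\<theta> y = l + (y - l) * k1" if "l \<le> y" "y \<le> c" for y
    using that assms by (auto simp: \<theta>_def)
  have r3: "\<theta> y = u - (u - y) * k2" if "c \<le> y" "y \<le> u" for y
  proof (cases "y = c")
    case True
    have "l + (c - l) * k1 = u - (u - c) * k2"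
      by (simp only: k(3,4))
    then show ?thesis
      using True assms by (simp add: \<theta>_def)
  qed (use that assms in \<open>auto simp: \<theta>_def\<close>)
  have \<theta>c: "\<theta> c = c'"
    using r2[of c] assms k(3) by simp
  have m1: "\<theta> x < \<theta> y" if "x < y" "y \<le> l" for x y
    using that r1[of x] r1[of y] by auto
  have m2: "\<theta> x < \<theta> y" if "x < y" "l \<le> x" "y \<le> c" for x y
    using that r2[of x] r2[of y] k by auto
  have m3: "\<theta> x < \<theta> y" if "x < y" "c \<le> x" "y \<le> u" for x y
    using that r3[of x] r3[of y] k by auto
  have m4: "\<theta> x < \<theta> y" if "x < y" "u \<le> x" for x y
    using that r1[of x] r1[of y] by auto
  have m34: "\<theta> x < \<theta> y" if "x < y" "c \<le> x" for x y
  proof -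
    consider "y \<le> u" | "u \<le> x" | "x < u" "u < y"
      by fastforce
    then show ?thesis
      using m3[of x y] m4[of x y] m3[of x u] m4[of u y] that by cases (auto dest: less_trans)
  qed
  have m234: "\<theta> x < \<theta> y" if "x < y" "l \<le> x" for x y
  proof -
    consider "y \<le> c" | "c \<le> x" | "x < c" "c < y"
      by fastforce
    then show ?thesis
      using m2[of x y] m34[of x y] m2[of x c] m34[of c y] that by cases (auto dest: less_trans)
  qed
  have mono: "strict_mono \<theta>"
  proof (rule strict_monoI)
    fix x y :: 'a assume xy: "x < y"
    consider "y \<le> l" | "l \<le> x" | "x < l" "l < y"
      by fastforce
    then show "\<theta> x < \<theta> y"
      using m1[of x y] m234[of x y] m1[of x l] m234[of l y] xy by cases (auto dest: less_trans)
  qed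
  have "surj \<theta>"
    unfolding surj_def
  proof
    fix y :: 'a
    consider "y \<le> l \<or> u \<le> y" | "l \<le> y" "y \<le> c'" | "c' \<le> y" "y \<le> u"
      by fastforce
    then show "\<exists>x. y = \<theta> x"
    proof cases
      case 1
      then show ?thesis using r1 by metis
    next
      case 2
      have "(y - l) / k1 \<le> (c' - l) / k1"
        using 2 k by (intro divide_right_mono) auto
      also have "(c' - l) / k1 = c - l"
        using k by (simp add: field_simps)
      finally have "l + (y - l) / k1 \<le> c"
        by simp
      moreover have "l \<le> l + (y - l) / k1"
        using 2 k by simp
      ultimately have "\<theta> (l + (y - l) / k1) = y"
        using r2 k by simp
      then show ?thesis by metis
    next
      case 3
      have "(u - y) / k2 \<le> (u - c') / k2"
        using 3 k by (intro divide_right_mono) auto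
      also have "(u - c') / k2 = u - c"
        using k by (simp add: field_simps)
      finally have "c \<le> u - (u - y) / k2"
        by simp
      moreover have "u - (u - y) / k2 \<le> u"
        using 3 k by simp
      ultimately have "\<theta> (u - (u - y) / k2) = y"
        using r3 k by simp
      then show ?thesis by metis
    qed
  qed
  with mono \<theta>c r1 show ?thesis
    by blast
qed

lemma rcf_strict_increasing_segment:
  fixes p :: "'a::real_closed_field poly"
  assumes "x < y" "poly (pderiv p) c > 0" "{x<..<y} \<subseteq> C" "\<And>z. z \<in> C \<Longrightarrow> segment c z \<subseteq> C"
    "\<And>z. z \<in> C \<Longrightarrow> poly (pderiv p) z \<noteq> 0"
  shows "poly p x < poly p y"
proof (rule rcf_strict_increasing[OF assms(1)])
  fix z assume "x < z" "z < y"
  then have "z \<in> C"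
    using assms(3) by auto
  then have "sgn (poly (pderiv p) c) = sgn (poly (pderiv p) z)"
    using assms(4,5) by (intro rcf_sgn_eq_if_no_root) blast
  then show "poly (pderiv p) z > 0"
    using assms(2) by (simp add: sgn_if split: if_splits)
qed

lemma sgn_beside_root:
  fixes p :: "'a::real_closed_field poly"
  assumes "poly p w = 0" "y \<noteq> w" "\<And>z. z \<in> segment y w \<Longrightarrow> poly (pderiv p) z \<noteq> 0"
  shows "sgn (poly p y) = (if y < w then - sgn (poly (pderiv p) y) else sgn (poly (pderiv p) y))"
proof -
  have *: "sgn (poly p y) = (if y < w then - 1 else 1)"
    if "poly p w = 0" "\<And>z. z \<in> segment y w \<Longrightarrow> poly (pderiv p) z \<noteq> 0" "poly (pderiv p) y > 0" for p
  proof (cases "y < w")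
    case True
    have "poly p y < poly p w"
      by (rule rcf_strict_increasing_segment[OF True that(3), of "segment y w"]) (use that True in auto)
    then show ?thesis
      using that True by simp
  next
    case False
    then have less: "w < y"
      using assms(2) by simp
    have "poly p w < poly p y"
      by (rule rcf_strict_increasing_segment[OF less that(3), of "segment y w"]) (use that less in auto)
    then show ?thesis
      using that False by simp
  qed
  have "poly (pderiv p) y \<noteq> 0"
    by (rule assms(3)) auto
  then consider "poly (pderiv p) y > 0" | "poly (pderiv (- p)) y > 0"
    by (fastforce simp: pderiv_minus)
  then show ?thesis
  proof cases
    case 1
    then show ?thesis
      using *[OF assms(1) assms(3)] by simp
  next
    case 2
    have "sgn (poly (- p) y) = (if y < w then - 1 else 1)"
      by (rule *) (use assms 2 in \<open>auto simp: pderiv_minus\<close>)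
    then show ?thesis
      using 2 by (simp add: pderiv_minus sgn_minus split: if_splits)
  qed
qed

definition root_in_gap :: "'a::linordered_field set \<Rightarrow> 'a poly \<Rightarrow> 'a \<Rightarrow> bool" where
  "root_in_gap Z p y \<longleftrightarrow> (\<exists>w. poly p w = 0 \<and> segment y w \<inter> Z = {})"

definition left_neighbour :: "'a::linorder set \<Rightarrow> 'a \<Rightarrow> 'a \<Rightarrow> bool" where
  "left_neighbour Z a y \<longleftrightarrow> a \<in> Z \<and> a < y \<and> {a<..<y} \<inter> Z = {}"

definition right_neighbour :: "'a::linorder set \<Rightarrow> 'a \<Rightarrow> 'a \<Rightarrow> bool" where
  "right_neighbour Z b y \<longleftrightarrow> b \<in> Z \<and> y < b \<and> {y<..<b} \<inter> Z = {}"

lemma ex_left_neighbour: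
  assumes "finite Z" "z \<in> Z" "z < (y :: 'a::linorder)"
  shows "\<exists>a. left_neighbour Z a y"
proof -
  have "Max (Z \<inter> {..<y}) \<in> Z \<inter> {..<y}"
    using assms by (intro Max_in) auto
  moreover have "x \<le> Max (Z \<inter> {..<y})" if "x \<in> Z" "x < y" for x
    using assms that by (intro Max_ge) auto
  ultimately show ?thesis
    unfolding left_neighbour_def by (intro exI[of _ "Max (Z \<inter> {..<y})"]) force
qed

lemma ex_right_neighbour:
  assumes "finite Z" "z \<in> Z" "(y :: 'a::linorder) < z"
  shows "\<exists>b. right_neighbour Z b y"
proof -
  have "Min (Z \<inter> {y<..}) \<in> Z \<inter> {y<..}"
    using assms by (intro Min_in) auto
  moreover have "Min (Z \<inter> {y<..}) \<le> x" if "x \<in> Z" "y < x" for x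
    using assms that by (intro Min_le) auto
  ultimately show ?thesis
    unfolding right_neighbour_def by (intro exI[of _ "Min (Z \<inter> {y<..})"]) force
qed

text \<open>
  On the gap of \<open>Z\<close> that contains \<open>y\<close>, the polynomial is strictly increasing. So the only obstacle to a
  root is a wrong sign at an end of the gap; at an infinite end there is none, because \<open>p\<close> is unbounded.
\<close>

lemma root_in_gap_criterion:
  fixes p :: "'a::real_closed_field poly"
  assumes Z: "finite Z" "\<And>z. poly (pderiv p) z = 0 \<Longrightarrow> z \<in> Z" and y: "y \<notin> Z"
    and pos: "poly (pderiv p) y > 0"
  shows "root_in_gap Z p y \<longleftrightarrow>
    (\<forall>a. left_neighbour Z a y \<longrightarrow> poly p a < 0) \<and> (\<forall>b. right_neighbour Z b y \<longrightarrow> 0 < poly p b)"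
    (is "?lhs \<longleftrightarrow> ?rhs")
    and "left_neighbour Z a y \<Longrightarrow> 0 \<le> poly p a \<Longrightarrow> 0 < poly p y"
    and "right_neighbour Z b y \<Longrightarrow> poly p b \<le> 0 \<Longrightarrow> poly p y < 0"
proof -
  have incr: "poly p s < poly p t" if "s < t" "{s<..<t} \<subseteq> C" "C \<inter> Z = {}" "\<And>z. z \<in> C \<Longrightarrow> segment y z \<subseteq> C" for s t C
    by (rule rcf_strict_increasing_segment[OF that(1) pos that(2) that(4)]) (use that(3) Z(2) in blast)+
  have left: "poly p a < poly p t" if a: "left_neighbour Z a y" and t: "a < t" "segment y t \<inter> Z = {}" for a t
  proof (rule incr[OF t(1), of "{a<..max y t}"])
    show "{a<..max y t} \<inter> Z = {}"
    proof -
      have "z \<notin> Z" if "a < z" "z \<le> max y t" for z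
      proof (cases "z < y")
        case True
        then show ?thesis using a that(1) by (auto simp: left_neighbour_def)
      next
        case False
        then have "z \<in> segment y t" using that by auto
        then show ?thesis using t by blast
      qed
      then show ?thesis by auto
    qed
  qed (use a t in \<open>auto simp: left_neighbour_def\<close>)
  have right: "poly p t < poly p b" if b: "right_neighbour Z b y" and t: "t < b" "segment y t \<inter> Z = {}" for b t
  proof (rule incr[OF t(1), of "{min y t..<b}"])
    show "{min y t..<b} \<inter> Z = {}"
    proof -
      have "z \<notin> Z" if "z < b" "min y t \<le> z" for z
      proof (cases "y < z")
        case True
        then show ?thesis using b that(1) by (auto simp: right_neighbour_def)
      next
        case False
        then have "z \<in> segment y t" using that by auto
        then show ?thesis using t by blast
      qed
      then show ?thesis by auto
    qed
  qed (use b t in \<open>auto simp: right_neighbour_def\<close>)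
  have yy: "segment y y \<inter> Z = {}"
    using y by simp
  show "left_neighbour Z a y \<Longrightarrow> 0 \<le> poly p a \<Longrightarrow> 0 < poly p y"
    using left[OF _ _ yy, of a] by (auto simp: left_neighbour_def)
  show "right_neighbour Z b y \<Longrightarrow> poly p b \<le> 0 \<Longrightarrow> poly p y < 0"
    using right[OF _ _ yy, of b] by (auto simp: right_neighbour_def)
  have deg: "degree p > 0"
    using pos by (metis poly_0 pderiv_eq_0_iff gr0I less_irrefl)
  obtain N where N: "\<And>x. N \<le> \<bar>x\<bar> \<Longrightarrow> \<bar>poly p y\<bar> + 1 \<le> \<bar>poly p x\<bar>"
    using poly_unbounded[OF deg] by blast
  show "?lhs \<longleftrightarrow> ?rhs"
  proof
    assume ?lhs
    then obtain w where w: "poly p w = 0" "segment y w \<inter> Z = {}"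
      by (auto simp: root_in_gap_def)
    show ?rhs
    proof (intro conjI allI impI)
      fix a assume a: "left_neighbour Z a y"
      have "a < w"
      proof (rule ccontr)
        assume "\<not> a < w"
        then have "a \<in> segment y w" using a by (auto simp: left_neighbour_def min_le_iff_disj)
        then show False using w(2) a unfolding left_neighbour_def by blast
      qed
      from left[OF a this w(2)] show "poly p a < 0" by (simp add: w)
    next
      fix b assume b: "right_neighbour Z b y"
      have "w < b"
      proof (rule ccontr)
        assume "\<not> w < b"
        then have "b \<in> segment y w" using b by (auto simp: right_neighbour_def le_max_iff_disj)
        then show False using w(2) b unfolding right_neighbour_def by blast
      qed
      from right[OF b this w(2)] show "0 < poly p b" by (simp add: w)
    qed
  next
    assume R: ?rhs
    consider "poly p y = 0" | "poly p y > 0" | "poly p y < 0"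
      by fastforce
    then show ?lhs
    proof cases
      case 1
      then show ?thesis using yy by (auto simp: root_in_gap_def)
    next
      case 2
      have "\<exists>l<y. poly p l < 0 \<and> {l<..y} \<inter> Z = {}"
      proof (cases "\<exists>z\<in>Z. z < y")
        case True
        then obtain a where "left_neighbour Z a y"
          using ex_left_neighbour Z(1) by blast
        then show ?thesis
          using R y by (intro exI[of _ a]) (auto simp: left_neighbour_def order.order_iff_strict)
      next
        case False
        define l where "l = - \<bar>N\<bar> - \<bar>y\<bar> - 1"
        have "l < y" "N \<le> \<bar>l\<bar>"
          by (auto simp: l_def)
        have free: "{..y} \<inter> Z = {}"
          using False y by (auto simp: order.order_iff_strict)
        have "poly p l < poly p y"
          by (rule incr[OF \<open>l < y\<close>, of "{..y}"]) (use free in auto)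
        then have "poly p l < 0"
          using N[OF \<open>N \<le> \<bar>l\<bar>\<close>] 2 by (auto simp: abs_if split: if_splits)
        then show ?thesis
          using \<open>l < y\<close> free by (intro exI[of _ l]) auto
      qed
      then obtain l where l: "l < y" "poly p l < 0" "{l<..y} \<inter> Z = {}"
        by blast
      then obtain w where w: "l < w" "w < y" "poly p w = 0"
        using rcf_IVT_pos[OF l(1,2) 2] by blast
      then have "segment y w \<subseteq> {l<..y}"
        by auto
      then show ?thesis
        using w l(3) unfolding root_in_gap_def by blast
    next
      case 3
      have "\<exists>u>y. poly p u > 0 \<and> {y..<u} \<inter> Z = {}"
      proof (cases "\<exists>z\<in>Z. y < z")
        case True
        then obtain b where "right_neighbour Z b y"
          using ex_right_neighbour Z(1) by blast
        then show ?thesis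
          using R y by (intro exI[of _ b]) (auto simp: right_neighbour_def order.order_iff_strict)
      next
        case False
        define u where "u = \<bar>N\<bar> + \<bar>y\<bar> + 1"
        have "y < u" "N \<le> \<bar>u\<bar>"
          by (auto simp: u_def)
        have free: "{y..} \<inter> Z = {}"
          using False y by (auto simp: order.order_iff_strict)
        have "poly p y < poly p u"
          by (rule incr[OF \<open>y < u\<close>, of "{y..}"]) (use free in auto)
        then have "poly p u > 0"
          using N[OF \<open>N \<le> \<bar>u\<bar>\<close>] 3 by (auto simp: abs_if split: if_splits)
        then show ?thesis
          using \<open>y < u\<close> free by (intro exI[of _ u]) auto
      qed
      then obtain u where u: "y < u" "poly p u > 0" "{y..<u} \<inter> Z = {}"
        by blast
      then obtain w where w: "y < w" "w < u" "poly p w = 0"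
        using rcf_IVT_pos[OF u(1) 3 u(2)] by blast
      then have "segment y w \<subseteq> {y..<u}"
        by auto
      then show ?thesis
        using w u(3) unfolding root_in_gap_def by blast
    qed
  qed
qed


definition family_roots :: "'j set \<Rightarrow> ('j \<Rightarrow> 'a::idom poly) \<Rightarrow> 'a set" where
  "family_roots J f = {y. \<exists>j\<in>J. f j \<noteq> 0 \<and> poly (f j) y = 0}"

lemma finite_family_roots:
  assumes "finite J"
  shows "finite (family_roots J f)"
proof -
  have "family_roots J f = (\<Union>j\<in>{j \<in> J. f j \<noteq> 0}. {y. poly (f j) y = 0})"
    by (auto simp: family_roots_def)
  then show ?thesis
    using assms poly_roots_finite by auto
qed

text \<open>
  Two families have the same sign diagram if they have the same number of roots, and the same signs at
  corresponding roots and on corresponding intervals between them. An increasing bijection of the line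
  expresses this without an enumeration of roots and intervals.
\<close>

definition sign_iso :: "'j set \<Rightarrow> ('j \<Rightarrow> 'a::linordered_field poly) \<Rightarrow> ('j \<Rightarrow> 'a poly) \<Rightarrow> ('a \<Rightarrow> 'a) \<Rightarrow> bool" where
  "sign_iso J f g \<phi> \<longleftrightarrow> strict_mono \<phi> \<and> surj \<phi> \<and>
     (\<forall>j\<in>J. \<forall>y. sgn (poly (f j) y) = sgn (poly (g j) (\<phi> y)))"

lemma sign_iso_zero_iff:
  assumes "sign_iso J f g \<phi>" "j \<in> J"
  shows "f j = 0 \<longleftrightarrow> g j = 0" "poly (f j) y = 0 \<longleftrightarrow> poly (g j) (\<phi> y) = 0"
proof -
  show *: "poly (f j) y = 0 \<longleftrightarrow> poly (g j) (\<phi> y) = 0" for y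
  proof -
    have "sgn (poly (f j) y) = sgn (poly (g j) (\<phi> y))"
      using assms by (simp add: sign_iso_def)
    then show ?thesis
      by (metis sgn_0_0)
  qed
  have "surj \<phi>"
    using assms(1) by (simp add: sign_iso_def)
  then have "(\<forall>y. poly (f j) y = 0) \<longleftrightarrow> (\<forall>y. poly (g j) y = 0)"
    using * by (metis surjD)
  then show "f j = 0 \<longleftrightarrow> g j = 0"
    by (simp only: poly_all_0_iff_0)
qed

lemma sign_iso_family_roots:
  assumes "sign_iso J f g \<phi>"
  shows "\<phi> y \<in> family_roots J g \<longleftrightarrow> y \<in> family_roots J f"
  using sign_iso_zero_iff[OF assms] by (auto simp: family_roots_def)

lemma strict_mono_surj_segment:
  assumes "strict_mono \<phi>" "surj \<phi>" "\<And>y. \<phi> y \<in> Z' \<longleftrightarrow> y \<in> Z"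
  shows "segment (\<phi> x) (\<phi> y) \<inter> Z' = {} \<longleftrightarrow> segment x y \<inter> Z = {}"
    "left_neighbour Z' (\<phi> x) (\<phi> y) \<longleftrightarrow> left_neighbour Z x y"
    "right_neighbour Z' (\<phi> x) (\<phi> y) \<longleftrightarrow> right_neighbour Z x y"
proof -
  have le: "\<phi> a \<le> \<phi> b \<longleftrightarrow> a \<le> b" and less: "\<phi> a < \<phi> b \<longleftrightarrow> a < b" for a b
    using assms(1) by (simp_all add: strict_mono_less strict_mono_less_eq)
  have all: "(\<forall>t. P t) \<longleftrightarrow> (\<forall>s. P (\<phi> s))" for P
    using assms(2) by (metis surjD)
  show "segment (\<phi> x) (\<phi> y) \<inter> Z' = {} \<longleftrightarrow> segment x y \<inter> Z = {}"
    unfolding disjoint_iff by (subst all) (auto simp: min_def max_def le assms(3))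
  show "left_neighbour Z' (\<phi> x) (\<phi> y) \<longleftrightarrow> left_neighbour Z x y"
    unfolding left_neighbour_def disjoint_iff by (subst all) (auto simp: less assms(3))
  show "right_neighbour Z' (\<phi> x) (\<phi> y) \<longleftrightarrow> right_neighbour Z x y"
    unfolding right_neighbour_def disjoint_iff by (subst all) (auto simp: less assms(3))
qed

lemma root_in_gap_uminus [simp]: "root_in_gap Z (- p) y \<longleftrightarrow> root_in_gap Z p y"
  by (simp add: root_in_gap_def)

text \<open>
  The criterion for a root in the gap of \<open>y\<close> depends only on the sign of the derivative at \<open>y\<close> and on the
  signs of the polynomial at the neighbours of \<open>y\<close> in \<open>Z\<close>.
\<close>

lemma root_in_gap_transfer:
  fixes p q :: "'a::real_closed_field poly"
  assumes iso: "strict_mono \<phi>" "surj \<phi>" "\<And>y. \<phi> y \<in> Z' \<longleftrightarrow> y \<in> Z"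
    and Z: "finite Z" "\<And>z. poly (pderiv p) z = 0 \<Longrightarrow> z \<in> Z" 
    and Z': "finite Z'" "\<And>z. poly (pderiv q) z = 0 \<Longrightarrow> z \<in> Z'"
    and y: "y \<notin> Z"
    and d: "sgn (poly (pderiv p) y) = sgn (poly (pderiv q) (\<phi> y))"
    and r: "\<And>a. a \<in> Z \<Longrightarrow> sgn (poly p a) = sgn (poly q (\<phi> a))"
  shows "root_in_gap Z p y \<longleftrightarrow> root_in_gap Z' q (\<phi> y)"
    and "\<not> root_in_gap Z p y \<Longrightarrow> sgn (poly p y) = sgn (poly q (\<phi> y))"
proof -
  have surj: "(\<forall>t. P t) \<longleftrightarrow> (\<forall>s. P (\<phi> s))" for P
    using iso(2) by (metis surjD)
  have *: "(root_in_gap Z p y \<longleftrightarrow> root_in_gap Z' q (\<phi> y)) \<and>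
      (\<not> root_in_gap Z p y \<longrightarrow> sgn (poly p y) = sgn (poly q (\<phi> y)))"
    if Z: "\<And>z. poly (pderiv p) z = 0 \<Longrightarrow> z \<in> Z" and Z': "\<And>z. poly (pderiv q) z = 0 \<Longrightarrow> z \<in> Z'"
      and pos: "poly (pderiv p) y > 0" "poly (pderiv q) (\<phi> y) > 0"
      and r: "\<And>a. a \<in> Z \<Longrightarrow> sgn (poly p a) = sgn (poly q (\<phi> a))" for p q
  proof -
    have y': "\<phi> y \<notin> Z'"
      using y iso(3) by simp
    note c = root_in_gap_criterion[OF \<open>finite Z\<close> Z y pos(1)]
    note c' = root_in_gap_criterion[OF \<open>finite Z'\<close> Z' y' pos(2)]
    note nb = strict_mono_surj_segment[OF iso]
    have rl: "(poly p a < 0 \<longleftrightarrow> poly q (\<phi> a) < 0) \<and> (0 < poly p a \<longleftrightarrow> 0 < poly q (\<phi> a))"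
      if "a \<in> Z" for a
      using r[OF that] by (auto simp: sgn_if split: if_splits)
    have L: "(\<forall>a. left_neighbour Z' a (\<phi> y) \<longrightarrow> poly q a < 0) \<longleftrightarrow> (\<forall>a. left_neighbour Z a y \<longrightarrow> poly p a < 0)"
      by (subst surj, simp only: nb(2)) (use rl in \<open>auto simp: left_neighbour_def\<close>)
    have R: "(\<forall>a. right_neighbour Z' a (\<phi> y) \<longrightarrow> 0 < poly q a) \<longleftrightarrow> (\<forall>a. right_neighbour Z a y \<longrightarrow> 0 < poly p a)"
      by (subst surj, simp only: nb(3)) (use rl in \<open>auto simp: right_neighbour_def\<close>)
    have eq: "root_in_gap Z p y \<longleftrightarrow> root_in_gap Z' q (\<phi> y)"
      using c(1) c'(1) L R by simp
    have "sgn (poly p y) = sgn (poly q (\<phi> y))" if no: "\<not> root_in_gap Z p y"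
    proof -
      consider a where "left_neighbour Z a y" "0 \<le> poly p a" | b where "right_neighbour Z b y" "poly p b \<le> 0"
        using no c(1) not_less by blast
      then show ?thesis
      proof cases
        case 1
        then have "left_neighbour Z' (\<phi> a) (\<phi> y)" "0 \<le> poly q (\<phi> a)"
          using nb(2) rl[of a] by (simp_all add: not_less[symmetric]) (simp_all add: left_neighbour_def)
        then show ?thesis
          using c(2)[OF _ 1] c'(2) by simp
      next
        case 2
        then have "right_neighbour Z' (\<phi> b) (\<phi> y)" "poly q (\<phi> b) \<le> 0"
          using nb(3) rl[of b] by (simp_all add: not_less[symmetric]) (simp_all add: right_neighbour_def)
        then show ?thesis
          using c(3)[OF _ 2] c'(3) by simp
      qed
    qed
    with eq show ?thesis by blast
  qed
  have "poly (pderiv p) y \<noteq> 0"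
    using Z(2) y by blast
  then consider "poly (pderiv p) y > 0" "poly (pderiv q) (\<phi> y) > 0"
    | "poly (pderiv (- p)) y > 0" "poly (pderiv (- q)) (\<phi> y) > 0"
    using d by (auto simp: sgn_if pderiv_minus split: if_splits)
  then have "(root_in_gap Z p y \<longleftrightarrow> root_in_gap Z' q (\<phi> y)) \<and>
      (\<not> root_in_gap Z p y \<longrightarrow> sgn (poly p y) = sgn (poly q (\<phi> y)))"
  proof cases
    case 1
    then show ?thesis
      using *[OF Z(2) Z'(2)] r by blast
  next
    case 2
    have "(root_in_gap Z (- p) y \<longleftrightarrow> root_in_gap Z' (- q) (\<phi> y)) \<and>
      (\<not> root_in_gap Z (- p) y \<longrightarrow> sgn (poly (- p) y) = sgn (poly (- q) (\<phi> y)))"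
      by (rule *) (use 2 Z(2) Z'(2) r in \<open>auto simp: pderiv_minus sgn_minus\<close>)
    then show ?thesis
      by (simp add: sgn_minus)
  qed
  then show "root_in_gap Z p y \<longleftrightarrow> root_in_gap Z' q (\<phi> y)"
    and "\<not> root_in_gap Z p y \<Longrightarrow> sgn (poly p y) = sgn (poly q (\<phi> y))"
    by blast+
qed

lemma segment_subset_open_interval:
  "x \<in> {l<..<u} \<Longrightarrow> y \<in> {l<..<u} \<Longrightarrow> segment x y \<subseteq> {l<..<u :: 'a::linorder}"
  by (auto simp: min_le_iff_disj le_max_iff_disj)

lemma one_root_per_gap:
  fixes p :: "'a::real_closed_field poly"
  assumes "poly p v = 0" "poly p w = 0" "segment v w \<inter> Z = {}" "\<And>z. poly (pderiv p) z = 0 \<Longrightarrow> z \<in> Z"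
  shows "v = w"
proof (rule ccontr)
  assume "v \<noteq> w"
  then consider "v < w" | "w < v"
    by fastforce
  then have "\<exists>c. c \<in> segment v w \<and> poly (pderiv p) c = 0"
  proof cases
    case 1
    then obtain c where "v < c" "c < w" "poly (pderiv p) c = 0"
      using rcf_rolle assms(1,2) by blast
    then show ?thesis
      by (intro exI[of _ c]) (auto simp: min_le_iff_disj le_max_iff_disj)
  next
    case 2
    then obtain c where "w < c" "c < v" "poly (pderiv p) c = 0"
      using rcf_rolle assms(1,2) by blast
    then show ?thesis
      by (intro exI[of _ c]) (auto simp: min_le_iff_disj le_max_iff_disj)
  qed
  then show False
    using assms(3,4) by blast
qed

text \<open>
  A polynomial \<open>p\<close> can be added to a family that contains its derivative as soon as its signs at the
  roots of the family are right: each gap between these roots contains at most one root of \<open>p\<close>, and it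
  does so precisely if the image of the gap contains a root of \<open>q\<close>. The bijection is corrected at one
  root of \<open>p\<close> at a time, by a map supported in the gap; the family has no roots there, so that its signs
  are unaffected.
\<close>

lemma sign_iso_extend:
  fixes p q :: "'a::real_closed_field poly"
  assumes J: "finite J" and iso: "sign_iso J f g \<phi>"
    and d: "d \<in> J" "f d = pderiv p" "g d = pderiv q" "pderiv p \<noteq> 0"
    and r: "\<And>a. a \<in> family_roots J f \<Longrightarrow> sgn (poly p a) = sgn (poly q (\<phi> a))"
  shows "\<exists>\<psi>. sign_iso J f g \<psi> \<and> (\<forall>y. sgn (poly p y) = sgn (poly q (\<psi> y)))"
proof -
  define Z Z' where "Z = family_roots J f" and "Z' = family_roots J g"
  have fin: "finite Z" "finite Z'"
    using finite_family_roots[OF J] by (auto simp: Z_def Z'_def)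
  have q0: "pderiv q \<noteq> 0"
    using sign_iso_zero_iff(1)[OF iso d(1)] d by auto
  have ZP: "poly (pderiv p) z = 0 \<Longrightarrow> z \<in> Z" and ZQ: "poly (pderiv q) z = 0 \<Longrightarrow> z \<in> Z'" for z
    using d q0 by (auto simp: Z_def Z'_def family_roots_def intro!: bexI[of _ d])
  define good where "good \<psi> \<longleftrightarrow> sign_iso J f g \<psi> \<and> (\<forall>a\<in>Z. sgn (poly p a) = sgn (poly q (\<psi> a)))" for \<psi>
  have goodD: "strict_mono \<psi>" "surj \<psi>" "\<psi> y \<in> Z' \<longleftrightarrow> y \<in> Z"
    "sgn (poly (pderiv p) y) = sgn (poly (pderiv q) (\<psi> y))" if "good \<psi>" for \<psi> y
    using that d sign_iso_family_roots[of J f g \<psi>] by (auto simp: good_def sign_iso_def Z_def Z'_def)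
  have transfer: "root_in_gap Z p y \<longleftrightarrow> root_in_gap Z' q (\<psi> y)"
    "\<not> root_in_gap Z p y \<Longrightarrow> sgn (poly p y) = sgn (poly q (\<psi> y))" if "good \<psi>" "y \<notin> Z" for \<psi> y
    using root_in_gap_transfer[OF goodD(1-3)[OF that(1)] fin(1) ZP fin(2) ZQ that(2) goodD(4)[OF that(1)]] that(1)
    by (auto simp: good_def)
  (* at the roots of p that lie in Z, the assumption r gives the sign of q *)
  have main: "\<exists>\<psi>. good \<psi> \<and> (\<forall>w\<in>B. poly q (\<psi> w) = 0)" if "finite B" "B \<subseteq> {w. poly p w = 0} - Z" for B
    using that
  proof (induction B)
    case empty
    show ?case
      using iso r by (intro exI[of _ \<phi>]) (auto simp: good_def Z_def)
  next
    case (insert w B)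
    then obtain \<psi> where \<psi>: "good \<psi>" "\<forall>w\<in>B. poly q (\<psi> w) = 0"
      by auto
    have w: "poly p w = 0" "w \<notin> Z"
      using insert.prems by auto
    have "segment w w \<inter> Z = {}"
      using w(2) by simp
    then have "root_in_gap Z p w"
      using w(1) by (auto simp: root_in_gap_def)
    then have "root_in_gap Z' q (\<psi> w)"
      using transfer[OF \<psi>(1) w(2)] by simp
    then obtain w' where w': "poly q w' = 0" "segment (\<psi> w) w' \<inter> Z' = {}"
      by (auto simp: root_in_gap_def)
    define c where "c = \<psi> w"
    obtain l where l: "l < min c w'" "{l<..<min c w'} \<inter> Z' = {}"
      using finite_free_left[OF fin(2)] by blast
    obtain u where u: "max c w' < u" "{max c w'<..<u} \<inter> Z' = {}"
      using finite_free_right[OF fin(2)] by blast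
    have free: "{l<..<u} \<inter> Z' = {}"
    proof -
      have "z \<notin> Z'" if "l < z" "z < u" for z
      proof -
        have "z \<in> {l<..<min c w'} \<or> z \<in> segment c w' \<or> z \<in> {max c w'<..<u}"
          using that by (simp only: atLeastAtMost_iff greaterThanLessThan_iff) (metis not_less)
        then consider "z \<in> {l<..<min c w'}" | "z \<in> segment c w'" | "z \<in> {max c w'<..<u}"
          by blast
        then show ?thesis
          using l(2) u(2) w'(2) by cases (auto simp: c_def)
      qed
      then show ?thesis by auto
    qed
    obtain \<theta> where \<theta>: "strict_mono \<theta>" "surj \<theta>" "\<theta> c = w'" "\<And>y. y \<le> l \<or> u \<le> y \<Longrightarrow> \<theta> y = y"
      using ex_local_rescaling[of l c u w'] l(1) u(1) by auto
    have in_lu: "\<theta> y \<in> {l<..<u}" if "y \<in> {l<..<u}" for y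
      using that strict_monoD[OF \<theta>(1), of l y] strict_monoD[OF \<theta>(1), of y u] \<theta>(4)[of l] \<theta>(4)[of u] by auto
    have out: "\<theta> y = y" if "y \<notin> {l<..<u}" for y
      using that \<theta>(4) by auto
    have sgn_eq: "sgn (poly (g j) (\<theta> y)) = sgn (poly (g j) y)" if "j \<in> J" for j y
    proof (cases "y \<in> {l<..<u} \<and> g j \<noteq> 0")
      case True
      then have "segment (\<theta> y) y \<subseteq> {l<..<u}"
        using in_lu by (intro segment_subset_open_interval) auto
      then have "segment (\<theta> y) y \<inter> Z' = {}"
        using free by blast
      then show ?thesis
        using True that by (intro rcf_sgn_eq_if_no_root) (auto simp: Z'_def family_roots_def)
    qed (use out in auto)
    have "strict_mono (\<theta> \<circ> \<psi>)" "surj (\<theta> \<circ> \<psi>)"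
      by (rule strict_mono_o[OF \<theta>(1) goodD(1)[OF \<psi>(1)]], rule comp_surj[OF goodD(2)[OF \<psi>(1)] \<theta>(2)])
    then have "sign_iso J f g (\<theta> \<circ> \<psi>)"
      using \<psi>(1) sgn_eq by (auto simp: good_def sign_iso_def)
    moreover have "sgn (poly p a) = sgn (poly q (\<theta> (\<psi> a)))" if "a \<in> Z" for a
    proof -
      have "\<psi> a \<in> Z'"
        using that goodD(3)[OF \<psi>(1)] by simp
      then have "\<theta> (\<psi> a) = \<psi> a"
        using free out by blast
      then show ?thesis
        using \<psi>(1) that by (simp add: good_def)
    qed
    ultimately have "good (\<theta> \<circ> \<psi>)"
      by (simp add: good_def)
    moreover have "poly q (\<theta> (\<psi> v)) = 0" if "v \<in> B" for v
    proof -
      have v: "poly p v = 0" "v \<noteq> w"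
        using insert that by auto
      have "\<psi> v \<notin> {l<..<u}"
      proof
        assume "\<psi> v \<in> {l<..<u}"
        then have "segment (\<psi> v) (\<psi> w) \<subseteq> {l<..<u}"
          using l(1) u(1) by (intro segment_subset_open_interval) (auto simp: c_def)
        then have "segment (\<psi> v) (\<psi> w) \<inter> Z' = {}"
          using free by blast
        then have "segment v w \<inter> Z = {}"
          using strict_mono_surj_segment(1)[OF goodD(1-3)[OF \<psi>(1)]] by simp
        then show False
          using one_root_per_gap[OF v(1) w(1) _ ZP] v(2) by blast
      qed
      then show ?thesis
        using out \<psi>(2) that by simp
    qed
    ultimately show ?case
      using \<theta>(3) w'(1) unfolding c_def by (metis comp_apply insert_iff)
  qed
  have "p \<noteq> 0"
    using d(4) by auto
  then obtain \<psi> where \<psi>: "good \<psi>" "\<And>w. poly p w = 0 \<Longrightarrow> w \<notin> Z \<Longrightarrow> poly q (\<psi> w) = 0"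
    using main[of "{w. poly p w = 0} - Z"] poly_roots_finite[of p] by auto
  have "sgn (poly p y) = sgn (poly q (\<psi> y))" for y
  proof (cases "y \<in> Z \<or> \<not> root_in_gap Z p y")
    case True
    then show ?thesis
      using \<psi>(1) transfer(2)[OF \<psi>(1)] by (auto simp: good_def)
  next
    case False
    then obtain w where w: "poly p w = 0" "segment y w \<inter> Z = {}"
      by (auto simp: root_in_gap_def)
    moreover have "w \<in> segment y w"
      by simp
    ultimately have "w \<notin> Z"
      by blast
    then have w': "poly q (\<psi> w) = 0"
      using \<psi>(2) w(1) by blast
    have seg': "segment (\<psi> y) (\<psi> w) \<inter> Z' = {}"
      using strict_mono_surj_segment(1)[OF goodD(1-3)[OF \<psi>(1)]] w(2) by simp
    show ?thesis
    proof (cases "y = w")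
      case True
      then show ?thesis using w w' by simp
    next
      case False
      have "\<psi> y < \<psi> w \<longleftrightarrow> y < w" "\<psi> y \<noteq> \<psi> w"
        using goodD(1)[OF \<psi>(1)] False by (auto simp: strict_mono_less strict_mono_eq)
      moreover have "sgn (poly p y) = (if y < w then - sgn (poly (pderiv p) y) else sgn (poly (pderiv p) y))"
        by (rule sgn_beside_root) (use w False ZP in blast)+
      moreover have "sgn (poly q (\<psi> y)) = (if \<psi> y < \<psi> w then - sgn (poly (pderiv q) (\<psi> y)) else sgn (poly (pderiv q) (\<psi> y)))"
        by (rule sgn_beside_root) (use w' seg' calculation(2) ZQ in blast)+
      ultimately show ?thesis
        using goodD(4)[OF \<psi>(1)] by simp
    qed
  qed
  with \<psi>(1) show ?thesis
    by (auto simp: good_def)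
qed

section \<open>The Tarski--Seidenberg theorem\<close>

text \<open>
  The ring of functions generated by \<open>S\<close> and the constants. The functions live on an arbitrary type of
  parameters, so that a further variable is a further factor of this type, and the elimination of one
  variable can be proved once for all numbers of variables.
\<close>

inductive_set pfuns :: "('e \<Rightarrow> 'a::comm_ring_1) set \<Rightarrow> ('e \<Rightarrow> 'a) set" for S where
  pfuns_const: "(\<lambda>_. c) \<in> pfuns S"
| pfuns_base: "s \<in> S \<Longrightarrow> s \<in> pfuns S"
| pfuns_add: "f \<in> pfuns S \<Longrightarrow> g \<in> pfuns S \<Longrightarrow> (\<lambda>e. f e + g e) \<in> pfuns S"
| pfuns_mult: "f \<in> pfuns S \<Longrightarrow> g \<in> pfuns S \<Longrightarrow> (\<lambda>e. f e * g e) \<in> pfuns S"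

text \<open>
  These are the quantifier-free formulas in the functions of \<open>S\<close>, as predicates on the parameters.
\<close>

inductive definable :: "('e \<Rightarrow> 'a::linordered_field) set \<Rightarrow> ('e \<Rightarrow> bool) \<Rightarrow> bool" for S where
  definable_pos: "f \<in> pfuns S \<Longrightarrow> definable S (\<lambda>e. 0 < f e)"
| definable_not: "definable S P \<Longrightarrow> definable S (\<lambda>e. \<not> P e)"
| definable_conj: "definable S P \<Longrightarrow> definable S Q \<Longrightarrow> definable S (\<lambda>e. P e \<and> Q e)"

lemma pfuns_uminus: "f \<in> pfuns S \<Longrightarrow> (\<lambda>e. - f e) \<in> pfuns S"
  using pfuns_mult[OF pfuns_const[of "- 1"], of f S] by simp

lemma pfuns_diff: "f \<in> pfuns S \<Longrightarrow> g \<in> pfuns S \<Longrightarrow> (\<lambda>e. f e - g e) \<in> pfuns S"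
  using pfuns_add[OF _ pfuns_uminus, of f S g] by simp

lemma pfuns_power: "f \<in> pfuns S \<Longrightarrow> (\<lambda>e. f e ^ n) \<in> pfuns S"
  by (induction n) (auto intro: pfuns_const pfuns_mult)

lemma pfuns_sum: "(\<And>i. i \<in> A \<Longrightarrow> (\<lambda>e. f i e) \<in> pfuns S) \<Longrightarrow> (\<lambda>e. \<Sum>i\<in>A. f i e) \<in> pfuns S"
  by (induction A rule: infinite_finite_induct) (auto intro: pfuns_const pfuns_add)

lemma pfuns_prod: "(\<And>i. i \<in> A \<Longrightarrow> (\<lambda>e. f i e) \<in> pfuns S) \<Longrightarrow> (\<lambda>e. \<Prod>i\<in>A. f i e) \<in> pfuns S"
  by (induction A rule: infinite_finite_induct) (auto intro: pfuns_const pfuns_mult)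

lemma pfuns_if: "f \<in> pfuns S \<Longrightarrow> g \<in> pfuns S \<Longrightarrow> (\<lambda>e. if b then f e else g e) \<in> pfuns S"
  by (cases b) simp_all

lemmas pfuns_intros = pfuns_const pfuns_add pfuns_mult pfuns_uminus pfuns_diff pfuns_power pfuns_sum pfuns_prod

lemma pfuns_subst:
  assumes "f \<in> pfuns S" "\<And>s. s \<in> S \<Longrightarrow> (\<lambda>e. s (h e)) \<in> pfuns T"
  shows "(\<lambda>e. f (h e)) \<in> pfuns T"
  using assms by (induction rule: pfuns.induct) (auto intro: pfuns_intros)

lemma definable_subst:
  assumes "definable S P" "\<And>s. s \<in> S \<Longrightarrow> (\<lambda>e. s (h e)) \<in> pfuns T"
  shows "definable T (\<lambda>e. P (h e))"
  using assms(1)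
proof (induction rule: definable.induct)
  case (definable_pos f)
  show ?case
    by (rule definable.definable_pos) (rule pfuns_subst[OF definable_pos assms(2)])
qed (auto intro: definable.intros)

lemma definable_less:
  assumes "f \<in> pfuns S" "g \<in> pfuns S"
  shows "definable S (\<lambda>e. f e < g e)"
  using definable_pos[OF pfuns_diff[OF assms(2,1)]] by simp

lemma definable_le:
  assumes "f \<in> pfuns S" "g \<in> pfuns S"
  shows "definable S (\<lambda>e. f e \<le> g e)"
  using definable_not[OF definable_less[OF assms(2,1)]] by (simp add: not_less)

lemma definable_disj: "definable S P \<Longrightarrow> definable S Q \<Longrightarrow> definable S (\<lambda>e. P e \<or> Q e)"
  using definable_not[OF definable_conj[OF definable_not definable_not, of S P Q]] by simp

lemma definable_imp:
  assumes "definable S P" "definable S Q"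
  shows "definable S (\<lambda>e. P e \<longrightarrow> Q e)"
  using definable_disj[OF definable_not[OF assms(1)] assms(2)] by simp

lemma definable_eq:
  assumes "f \<in> pfuns S" "g \<in> pfuns S"
  shows "definable S (\<lambda>e. f e = g e)"
  using definable_conj[OF definable_le[OF assms] definable_le[OF assms(2,1)]]
  by (simp add: eq_iff)

lemma definable_const: "definable S (\<lambda>_. b)"
proof -
  have "definable S (\<lambda>_. 0 < (1 :: 'b))" "definable S (\<lambda>_. 0 < (0 :: 'b))"
    by (intro definable_pos pfuns_const)+
  then show ?thesis
    by (cases b) simp_all
qed

lemma definable_Ball_finite:
  "finite A \<Longrightarrow> (\<And>i. i \<in> A \<Longrightarrow> definable S (\<lambda>e. P i e)) \<Longrightarrow> definable S (\<lambda>e. \<forall>i\<in>A. P i e)"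
  by (induction A rule: finite_induct) (auto intro: definable_const definable_conj)

lemma definable_Bex_finite:
  "finite A \<Longrightarrow> (\<And>i. i \<in> A \<Longrightarrow> definable S (\<lambda>e. P i e)) \<Longrightarrow> definable S (\<lambda>e. \<exists>i\<in>A. P i e)"
  by (induction A rule: finite_induct) (auto intro: definable_const definable_disj)

lemmas definable_intros = definable_not definable_conj definable_disj definable_imp definable_const
  definable_less definable_le definable_eq definable_Ball_finite definable_Bex_finite

text \<open>
  Generators for the ring in which one scalar variable is added to the parameters.
\<close>

definition scalar_ext :: "('e \<Rightarrow> 'a) set \<Rightarrow> ('e \<times> 'a \<Rightarrow> 'a) set" where
  "scalar_ext S = (\<lambda>s p. s (fst p)) ` S \<union> {snd}"

text \<open>
  Polynomials in one variable, of formal degree \<open>n\<close>, over the ring of functions of the parameters. The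
  degree at a particular parameter may be smaller.
\<close>

definition upolys :: "('e \<Rightarrow> 'a::comm_ring_1) set \<Rightarrow> nat \<Rightarrow> ('e \<Rightarrow> 'a poly) set" where
  "upolys S n = {P. (\<forall>k. (\<lambda>e. coeff (P e) k) \<in> pfuns S) \<and> (\<forall>e. degree (P e) \<le> n)}"

lemma upolys_coeff: "P \<in> upolys S n \<Longrightarrow> (\<lambda>e. coeff (P e) k) \<in> pfuns S"
  by (simp add: upolys_def)

lemma upolys_degree: "P \<in> upolys S n \<Longrightarrow> degree (P e) \<le> n"
  by (simp add: upolys_def)

lemma upolys_mono: "P \<in> upolys S m \<Longrightarrow> m \<le> n \<Longrightarrow> P \<in> upolys S n"
  by (auto simp: upolys_def intro: le_trans)

lemma upolys_const: "a \<in> pfuns S \<Longrightarrow> (\<lambda>e. [:a e:]) \<in> upolys S 0"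
proof -
  assume "a \<in> pfuns S"
  then have "(\<lambda>e. coeff [:a e:] k) \<in> pfuns S" for k
    by (cases k) (auto simp: coeff_pCons intro: pfuns_intros)
  then show ?thesis by (simp add: upolys_def)
qed

lemma upolys_add: "P \<in> upolys S m \<Longrightarrow> Q \<in> upolys S n \<Longrightarrow> (\<lambda>e. P e + Q e) \<in> upolys S (max m n)"
  unfolding upolys_def
  by (auto intro!: pfuns_add order_trans[OF degree_add_le_max] max.mono simp del: max.bounded_iff)

lemma upolys_mult: "P \<in> upolys S m \<Longrightarrow> Q \<in> upolys S n \<Longrightarrow> (\<lambda>e. P e * Q e) \<in> upolys S (m + n)"
  unfolding upolys_def
  by (auto simp: coeff_mult intro!: pfuns_sum pfuns_mult order_trans[OF degree_mult_le] add_mono)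

lemma upolys_pderiv: "P \<in> upolys S n \<Longrightarrow> (\<lambda>e. pderiv (P e)) \<in> upolys S (n - 1)"
  for S :: "('e \<Rightarrow> 'a::{comm_ring_1,semiring_no_zero_divisors,semiring_char_0}) set"
  unfolding upolys_def
  by (auto simp: coeff_pderiv degree_pderiv simp del: of_nat_Suc intro!: pfuns_mult pfuns_const diff_le_mono)

lemma upolys_cutoff: "P \<in> upolys S n \<Longrightarrow> (\<lambda>e. poly_cutoff (Suc k) (P e)) \<in> upolys S k"
  by (auto simp: upolys_def coeff_poly_cutoff intro!: pfuns_if pfuns_const degree_le)

lemma pfuns_ext_upoly:
  assumes "f \<in> pfuns (scalar_ext S)"
  shows "\<exists>n. \<exists>P\<in>upolys S n. \<forall>e y. f (e, y) = poly (P e) y"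
  using assms
proof (induction rule: pfuns.induct)
  case (pfuns_const c)
  show ?case
    using upolys_const[OF pfuns.pfuns_const, of c S] by force
next
  case (pfuns_base s)
  then consider t where "t \<in> S" "s = (\<lambda>p. t (fst p))" | "s = snd"
    by (auto simp: scalar_ext_def)
  then show ?case
  proof cases
    case 1
    then show ?thesis
      using upolys_const[OF pfuns.pfuns_base, of t S] by force
  next
    case 2
    have "(\<lambda>e. coeff [:0, 1:] k) \<in> pfuns S" for k
      by (rule pfuns_intros)
    then have "(\<lambda>e. [:0, 1:]) \<in> upolys S 1"
      by (simp add: upolys_def)
    then show ?thesis
      using 2 by force
  qed
next
  case (pfuns_add f g)
  then obtain m n P Q where "P \<in> upolys S m" "Q \<in> upolys S n"
    "\<forall>e y. f (e, y) = poly (P e) y" "\<forall>e y. g (e, y) = poly (Q e) y"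
    by blast
  then show ?case
    using upolys_add[of P S m Q n] by force
next
  case (pfuns_mult f g)
  then obtain m n P Q where "P \<in> upolys S m" "Q \<in> upolys S n"
    "\<forall>e y. f (e, y) = poly (P e) y" "\<forall>e y. g (e, y) = poly (Q e) y"
    by blast
  then show ?case
    using upolys_mult[of P S m Q n] by force
qed

text \<open>
  The exponent \<open>N\<close> does not depend on \<open>e\<close>: it makes the signs of \<open>P\<close> at the roots of \<open>Q\<close> comparable for
  different parameters, although a power of a negative leading coefficient may occur.
\<close>

lemma upolys_pseudo_remainder:
  fixes S :: "('e \<Rightarrow> 'a::idom) set"
  assumes Q: "Q \<in> upolys S (Suc k)" and P: "P \<in> upolys S n"
  shows "\<exists>N. \<exists>R\<in>upolys S k. \<forall>e. \<exists>T. smult (coeff (Q e) (Suc k) ^ N) (P e) = Q e * T + R e"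
  using P
proof (induction n arbitrary: P)
  case 0
  then have "P \<in> upolys S k"
    by (rule upolys_mono) simp
  then show ?case
    by (intro exI[of _ 0] bexI[of _ P] allI exI[of _ 0]) simp_all
next
  case (Suc n)
  show ?case
  proof (cases "Suc n \<le> k")
    case True
    then have "P \<in> upolys S k"
      using Suc.prems upolys_mono by blast
    then show ?thesis
      by (intro exI[of _ 0] bexI[of _ P] allI exI[of _ 0]) simp_all
  next
    case False
    define a where "a e = coeff (Q e) (Suc k)" for e
    define M where "M e = monom (coeff (P e) (Suc n)) (n - k)" for e
    define P1 where "P1 e = smult (a e) (P e) - M e * Q e" for e
    have c: "coeff (P1 e) i = a e * coeff (P e) i - (if n - k \<le> i then coeff (P e) (Suc n) * coeff (Q e) (i - (n - k)) else 0)" for e i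
      by (simp add: P1_def M_def coeff_monom_mult)
    have "(\<lambda>e. coeff (P1 e) i) \<in> pfuns S" for i
      unfolding c a_def using upolys_coeff[OF Q] upolys_coeff[OF Suc.prems]
      by (cases "n - k \<le> i") (auto intro!: pfuns_diff pfuns_mult pfuns_const)
    moreover have "degree (P1 e) \<le> n" for e
    proof (rule degree_le, intro allI impI)
      fix i assume "n < i"
      then consider "i = Suc n" | "i > Suc n"
        by linarith
      then show "coeff (P1 e) i = 0"
      proof cases
        case 1
        then have "i - (n - k) = Suc k" "n - k \<le> i"
          using False by auto
        then show ?thesis
          by (simp add: c a_def 1)
      next
        case 2
        then have "coeff (P e) i = 0" "coeff (Q e) (i - (n - k)) = 0"
          using upolys_degree[OF Q, of e] upolys_degree[OF Suc.prems, of e] False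
          by (auto intro!: coeff_eq_0)
        then show ?thesis
          by (simp add: c)
      qed
    qed
    ultimately have "P1 \<in> upolys S n"
      by (simp add: upolys_def)
    from Suc.IH[OF this] obtain N R where R: "R \<in> upolys S k"
      "\<And>e. \<exists>T. smult (a e ^ N) (P1 e) = Q e * T + R e"
      by (auto simp: a_def)
    have "\<exists>T. smult (a e ^ Suc N) (P e) = Q e * T + R e" for e
    proof -
      obtain T where "smult (a e ^ N) (P1 e) = Q e * T + R e"
        using R(2) by blast
      then have "smult (a e ^ Suc N) (P e) = Q e * (T + smult (a e ^ N) (M e)) + R e"
        by (simp add: P1_def algebra_simps smult_diff_right)
      then show ?thesis by blast
    qed
    with R(1) show ?thesis
      unfolding a_def by blast
  qed
qed

definition agree :: "('e \<Rightarrow> 'a::linordered_field) set \<Rightarrow> 'e \<Rightarrow> 'e \<Rightarrow> bool" where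
  "agree C e e' \<longleftrightarrow> (\<forall>c\<in>C. sgn (c e) = sgn (c e'))"

definition sign_determined :: "('e \<Rightarrow> 'a::linordered_field) set \<Rightarrow> ('e \<Rightarrow> 'a poly) set \<Rightarrow> bool" where
  "sign_determined S F \<longleftrightarrow> (\<exists>C\<subseteq>pfuns S. finite C \<and>
     (\<forall>e e'. agree C e e' \<longrightarrow> (\<exists>\<phi>. sign_iso F (\<lambda>P. P e) (\<lambda>P. P e') \<phi>)))"

text \<open>
  To determine the signs of \<open>P\<close> at the roots of \<open>Q\<close>, it suffices to know those of the remainder of \<open>P\<close> by \<open>Q\<close>,
  which has a smaller degree. So \<open>L\<close> consists of the derivative \<open>D\<close> of \<open>P\<close> and the remainders of \<open>P\<close> by the
  members of \<open>F\<close> and by \<open>D\<close>. As the degree of \<open>Q\<close> depends on the parameter, remainders by all truncations of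
  \<open>Q\<close> are taken.
\<close>

lemma sign_determined_step:
  fixes S :: "('e \<Rightarrow> 'a::real_closed_field) set"
  assumes F: "finite F" "F \<subseteq> upolys S (Suc n)" and P: "P \<in> upolys S (Suc n)"
  shows "\<exists>L. finite L \<and> L \<subseteq> upolys S n \<and> (sign_determined S (F \<union> L) \<longrightarrow> sign_determined S (insert P F))"
proof -
  define D where "D e = pderiv (P e)" for e
  have D: "D \<in> upolys S n"
    using upolys_pderiv[OF P] by (simp add: D_def[abs_def])
  define G where "G = insert D F"
  have G: "finite G" "G \<subseteq> upolys S (Suc n)"
    using F upolys_mono[OF D] by (auto simp: G_def)
  define cut where "cut Q k e = poly_cutoff (Suc (Suc k)) (Q e)" for Q :: "'e \<Rightarrow> 'a poly" and k e
  define rem where "rem Q k R \<longleftrightarrow> R \<in> upolys S k \<and>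
      (\<exists>N. \<forall>e. \<exists>T. smult (coeff (cut Q k e) (Suc k) ^ N) (P e) = cut Q k e * T + R e)" for Q k R
  have ex: "\<exists>R. rem Q k R" if "Q \<in> G" for Q k
  proof -
    have "cut Q k \<in> upolys S (Suc k)"
      unfolding cut_def[abs_def] using G(2) that by (intro upolys_cutoff) auto
    from upolys_pseudo_remainder[OF this P] show ?thesis
      unfolding rem_def by blast
  qed
  define R where "R Q k = (SOME R. rem Q k R)" for Q k
  have R: "R Q k \<in> upolys S k"
    "\<exists>N. \<forall>e. \<exists>T. smult (coeff (cut Q k e) (Suc k) ^ N) (P e) = cut Q k e * T + R Q k e"
    if "Q \<in> G" for Q k
    using someI_ex[OF ex[OF that, of k]] by (auto simp: rem_def R_def)
  define L where "L = insert D ((\<lambda>(Q, k). R Q k) ` (G \<times> {..n}))"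
  have L: "finite L" "L \<subseteq> upolys S n"
    using G D upolys_mono[OF R(1)] by (auto simp: L_def)
  have "sign_determined S (insert P F)" if sd: "sign_determined S (F \<union> L)"
  proof -
    obtain C where C: "C \<subseteq> pfuns S" "finite C"
      "\<And>e e'. agree C e e' \<Longrightarrow> \<exists>\<phi>. sign_iso (F \<union> L) (\<lambda>P. P e) (\<lambda>P. P e') \<phi>"
      using sd by (auto simp: sign_determined_def)
    (* agreement on all coefficients ensures that degrees agree, too *)
    define C' where "C' = C \<union> (\<lambda>(Q, k) e. coeff (Q e) k) ` (insert P G \<times> {..Suc n})"
    have "C' \<subseteq> pfuns S"
      using C(1) G(2) P by (auto simp: C'_def intro!: upolys_coeff[of _ S "Suc n"])
    moreover have "finite C'"
      using C(2) G(1) by (simp add: C'_def)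
    moreover have "\<exists>\<psi>. sign_iso (insert P F) (\<lambda>P. P e) (\<lambda>P. P e') \<psi>" if ag: "agree C' e e'" for e e'
    proof -
      have "agree C e e'"
        using ag by (auto simp: agree_def C'_def)
      then obtain \<phi> where \<phi>: "sign_iso (F \<union> L) (\<lambda>P. P e) (\<lambda>P. P e') \<phi>"
        using C(3) by blast
      have isoG: "sign_iso G (\<lambda>P. P e) (\<lambda>P. P e') \<phi>"
        using \<phi> by (auto simp: sign_iso_def G_def L_def)
      have sc: "sgn (coeff (Q e) k) = sgn (coeff (Q e') k)" if "Q \<in> insert P G" for Q k
      proof (cases "k \<le> Suc n")
        case True
        then have "(\<lambda>e. coeff (Q e) k) \<in> C'"
          using that by (force simp: C'_def)
        then show ?thesis
          using ag by (auto simp: agree_def)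
      next
        case False
        have "Q \<in> upolys S (Suc n)"
          using that G(2) P by auto
        then have "degree (Q e) < k" "degree (Q e') < k"
          using False upolys_degree by (meson le_less_trans not_le)+
        then show ?thesis
          by (simp add: coeff_eq_0)
      qed
      have cz: "coeff (Q e) k = 0 \<longleftrightarrow> coeff (Q e') k = 0" if "Q \<in> insert P G" for Q k
        using sc[OF that, of k] by (metis sgn_0_0)
      show ?thesis
      proof (cases "pderiv (P e) = 0")
        case True
        then have d: "degree (P e) = 0"
          by (simp add: pderiv_eq_0_iff)
        then have "coeff (P e') k = 0" if "k > 0" for k
          using cz[of P k] that by (simp add: coeff_eq_0)
        then have d': "degree (P e') = 0"
          by (metis degree_0 leading_coeff_0_iff neq0_conv)
        obtain a b where ab: "P e = [:a:]" "P e' = [:b:]"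
          using d d' by (metis degree_eq_zeroE)
        have "sgn a = sgn b"
          using sc[of P 0] by (simp add: ab)
        then have "sign_iso (insert P F) (\<lambda>P. P e) (\<lambda>P. P e') \<phi>"
          using \<phi> by (auto simp: sign_iso_def ab)
        then show ?thesis by blast
      next
        case False
        have "\<exists>\<psi>. sign_iso G (\<lambda>P. P e) (\<lambda>P. P e') \<psi> \<and> (\<forall>y. sgn (poly (P e) y) = sgn (poly (P e') (\<psi> y)))"
        proof (rule sign_iso_extend[OF G(1) isoG, of D])
          show "D \<in> G" "D e = pderiv (P e)" "D e' = pderiv (P e')" "pderiv (P e) \<noteq> 0"
            using False by (auto simp: G_def D_def)
          fix a assume "a \<in> family_roots G (\<lambda>P. P e)"
          then obtain Q where Q: "Q \<in> G" "Q e \<noteq> 0" "poly (Q e) a = 0"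
            by (auto simp: family_roots_def)
          have "degree (Q e) \<noteq> 0"
            using Q(2,3) by (metis degree_eq_zeroE mult_zero_right pCons_0_0 poly_0 poly_pCons add.right_neutral)
          then obtain k where k: "degree (Q e) = Suc k"
            using not0_implies_Suc by blast
          have kn: "k \<le> n"
            using upolys_degree[of Q S "Suc n" e] Q(1) G(2) k by auto
          have cute: "cut Q k e = Q e"
            by (rule poly_eqI) (simp add: cut_def coeff_poly_cutoff coeff_eq_0 k)
          have above: "coeff (Q e') i = 0" if "i > Suc k" for i
            using cz[of Q i] Q(1) that k by (simp add: coeff_eq_0)
          have cute': "cut Q k e' = Q e'"
            by (rule poly_eqI) (use above in \<open>auto simp: cut_def coeff_poly_cutoff\<close>)
          define c c' where "c = coeff (Q e) (Suc k)" and "c' = coeff (Q e') (Suc k)"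
          have c: "c \<noteq> 0" "sgn c = sgn c'"
            using Q(1,2) k sc[of Q "Suc k"] by (auto simp: c_def c'_def) (metis leading_coeff_0_iff)
          obtain N where N: "\<And>e. \<exists>T. smult (coeff (cut Q k e) (Suc k) ^ N) (P e) = cut Q k e * T + R Q k e"
            using R(2)[OF Q(1)] by blast
          obtain T where T: "smult (c ^ N) (P e) = Q e * T + R Q k e"
            using N[of e] by (auto simp: cute c_def)
          have "c ^ N * poly (P e) a = poly (smult (c ^ N) (P e)) a"
            by simp
          also have "\<dots> = poly (R Q k e) a"
            unfolding T using Q(3) by simp
          finally have 1: "c ^ N * poly (P e) a = poly (R Q k e) a" .
          have Q': "poly (Q e') (\<phi> a) = 0"
            using sign_iso_zero_iff(2)[OF isoG Q(1), of a] Q(3) by simp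
          obtain T' where T': "smult (c' ^ N) (P e') = Q e' * T' + R Q k e'"
            using N[of e'] by (auto simp: cute' c'_def)
          have "c' ^ N * poly (P e') (\<phi> a) = poly (smult (c' ^ N) (P e')) (\<phi> a)"
            by simp
          also have "\<dots> = poly (R Q k e') (\<phi> a)"
            unfolding T' using Q' by simp
          finally have 2: "c' ^ N * poly (P e') (\<phi> a) = poly (R Q k e') (\<phi> a)" .
          have "R Q k \<in> L"
            using Q(1) kn by (force simp: L_def)
          then have "sgn (poly (R Q k e) a) = sgn (poly (R Q k e') (\<phi> a))"
            using \<phi> by (auto simp: sign_iso_def)
          then have "sgn (c ^ N) * sgn (poly (P e) a) = sgn (c' ^ N) * sgn (poly (P e') (\<phi> a))"
            by (simp add: sgn_mult flip: 1 2)
          moreover have "sgn (c ^ N) = sgn (c' ^ N)"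
            by (induction N) (simp_all add: sgn_mult c(2))
          moreover have "sgn (c ^ N) \<noteq> 0"
            using c(1) by (simp add: sgn_0_0)
          ultimately show "sgn (poly (P e) a) = sgn (poly (P e') (\<phi> a))"
            by (metis mult_left_cancel)
        qed
        then show ?thesis
          by (auto simp: sign_iso_def G_def)
      qed
    qed
    ultimately show ?thesis
      unfolding sign_determined_def by blast
  qed
  then show ?thesis
    using L by blast
qed

text \<open>
  Induction on the degree and, for a given degree, on the number of polynomials that attain it: each of
  them is replaced by finitely many polynomials of smaller degree.
\<close>

theorem sign_determined_upolys:
  fixes S :: "('e \<Rightarrow> 'a::real_closed_field) set"
  assumes "finite F" "F \<subseteq> upolys S n"
  shows "sign_determined S F"
  using assms
proof (induction n arbitrary: F)
  case 0
  define C where "C = (\<lambda>P e. coeff (P e) 0) ` F"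
  have "C \<subseteq> pfuns S" "finite C"
    using 0 by (auto simp: C_def intro!: upolys_coeff[of _ S 0])
  moreover have "sign_iso F (\<lambda>P. P e) (\<lambda>P. P e') (\<lambda>y. y)" if "agree C e e'" for e e'
  proof -
    have "sgn (poly (P e) y) = sgn (poly (P e') y)" if P: "P \<in> F" for P y
    proof -
      have "degree (P e) = 0" "degree (P e') = 0"
        using upolys_degree[of P S 0] 0(2) P by auto
      then obtain a b where "P e = [:a:]" "P e' = [:b:]"
        by (metis degree_eq_zeroE)
      then show ?thesis
        using \<open>agree C e e'\<close> P by (auto simp: agree_def C_def)
    qed
    then show ?thesis
      by (auto simp: sign_iso_def strict_mono_def)
  qed
  ultimately show ?case
    unfolding sign_determined_def by blast
next
  case (Suc n)
  have "sign_determined S (Top \<union> Low)"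
    if "finite Top" "Top \<subseteq> upolys S (Suc n)" "finite Low" "Low \<subseteq> upolys S n" for Top Low
    using that
  proof (induction Top arbitrary: Low)
    case empty
    then show ?case using Suc.IH by simp
  next
    case (insert P Top)
    have "Low \<subseteq> upolys S (Suc n)"
      using insert.prems(3) upolys_mono[of _ S n "Suc n"] by auto
    then have F: "finite (Top \<union> Low)" "Top \<union> Low \<subseteq> upolys S (Suc n)" "P \<in> upolys S (Suc n)"
      using insert.hyps(1) insert.prems by auto
    obtain L where L: "finite L" "L \<subseteq> upolys S n"
      "sign_determined S (Top \<union> Low \<union> L) \<longrightarrow> sign_determined S (insert P (Top \<union> Low))"
      using sign_determined_step[OF F] by blast
    have "sign_determined S (Top \<union> (Low \<union> L))"
      using insert.prems L by (intro insert.IH) auto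
    then show ?case
      using L(3) by (simp add: Un_assoc)
  qed
  from this[OF Suc.prems, of "{}"] show ?case by simp
qed

text \<open>
  Such a predicate is a finite union of sign conditions on the members of \<open>C\<close>.
\<close>

lemma definable_if_agree:
  fixes S :: "('e \<Rightarrow> 'a::linordered_field) set"
  assumes "finite C" "C \<subseteq> pfuns S" "\<And>e e'. agree C e e' \<Longrightarrow> P e \<Longrightarrow> P e'"
  shows "definable S P"
  using assms
proof (induction C arbitrary: P)
  case empty
  then have "P = (\<lambda>_. P e0)" for e0
    by (auto simp: agree_def)
  then show ?case
    using definable_const by metis
next
  case (insert c C)
  define Q where "Q s e \<longleftrightarrow> (\<exists>e'. agree C e' e \<and> sgn (c e') = s \<and> P e')" for s e
  have Q: "definable S (Q s)" for s
  proof (rule insert.IH)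
    show "C \<subseteq> pfuns S" using insert.prems by simp
    show "Q s e'" if "agree C e e'" "Q s e" for e e'
      using that by (auto simp: Q_def agree_def)
  qed
  have P: "P e \<longleftrightarrow> Q (sgn (c e)) e" for e
  proof
    assume "P e"
    then show "Q (sgn (c e)) e"
      by (auto simp: Q_def agree_def)
  next
    assume "Q (sgn (c e)) e"
    then obtain e' where "agree C e' e" "sgn (c e') = sgn (c e)" "P e'"
      by (auto simp: Q_def)
    then show "P e"
      using insert.prems(2)[of e' e] by (auto simp: agree_def)
  qed
  have c: "c \<in> pfuns S"
    using insert.prems by simp
  have "definable S (\<lambda>e. (0 < c e \<and> Q 1 e) \<or> (c e < 0 \<and> Q (- 1) e) \<or> (c e = 0 \<and> Q 0 e))"
    by (intro definable_intros Q c pfuns_intros)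
  also have "(\<lambda>e. (0 < c e \<and> Q 1 e) \<or> (c e < 0 \<and> Q (- 1) e) \<or> (c e = 0 \<and> Q 0 e)) = P"
    by (rule ext) (auto simp: P sgn_if)
  finally show ?case .
qed

lemma definable_ext_signs:
  assumes "definable (scalar_ext S) P"
  shows "\<exists>n. \<exists>F\<subseteq>upolys S n. finite F \<and>
    (\<forall>e y e' y'. (\<forall>Q\<in>F. sgn (poly (Q e) y) = sgn (poly (Q e') y')) \<longrightarrow> P (e, y) = P (e', y'))"
  using assms
proof (induction rule: definable.induct)
  case (definable_pos f)
  then obtain n Q where "Q \<in> upolys S n" "\<forall>e y. f (e, y) = poly (Q e) y"
    using pfuns_ext_upoly by blast
  then show ?case
    by (intro exI[of _ n] exI[of _ "{Q}"]) (auto simp: sgn_if split: if_splits)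
next
  case (definable_not P)
  then show ?case by blast
next
  case (definable_conj P Q)
  obtain m F where F: "F \<subseteq> upolys S m" "finite F"
    "\<And>e y e' y'. (\<forall>p\<in>F. sgn (poly (p e) y) = sgn (poly (p e') y')) \<Longrightarrow> P (e, y) = P (e', y')"
    using definable_conj.IH(1) by blast
  obtain n G where G: "G \<subseteq> upolys S n" "finite G"
    "\<And>e y e' y'. (\<forall>p\<in>G. sgn (poly (p e) y) = sgn (poly (p e') y')) \<Longrightarrow> Q (e, y) = Q (e', y')"
    using definable_conj.IH(2) by blast
  have "F \<union> G \<subseteq> upolys S (max m n)"
    using F(1) G(1) upolys_mono[of _ S m "max m n"] upolys_mono[of _ S n "max m n"] by auto
  moreover have "finite (F \<union> G)"
    using F(2) G(2) by simp
  moreover have "(P (e, y) \<and> Q (e, y)) = (P (e', y') \<and> Q (e', y'))"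
    if "\<forall>p\<in>F \<union> G. sgn (poly (p e) y) = sgn (poly (p e') y')" for e y e' y'
    using F(3)[of e y e' y'] G(3)[of e y e' y'] that by simp
  ultimately show ?case by blast
qed

text \<open>
  This is the Tarski--Seidenberg theorem. Finitely many functions of the parameter determine the sign
  diagram of the polynomials that occur in \<open>P\<close>, and with it whether some \<open>y\<close> satisfies \<open>P e\<close>.
\<close>

theorem definable_Ex:
  fixes S :: "('e \<Rightarrow> 'a::real_closed_field) set"
  assumes "definable (scalar_ext S) (\<lambda>p. P (fst p) (snd p))"
  shows "definable S (\<lambda>e. \<exists>y. P e y)"
proof -
  obtain n F where F: "F \<subseteq> upolys S n" "finite F"
    "\<And>e y e' y'. (\<forall>Q\<in>F. sgn (poly (Q e) y) = sgn (poly (Q e') y')) \<Longrightarrow> P e y = P e' y'"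
    using definable_ext_signs[OF assms] by auto
  obtain C where C: "C \<subseteq> pfuns S" "finite C"
    "\<And>e e'. agree C e e' \<Longrightarrow> \<exists>\<phi>. sign_iso F (\<lambda>P. P e) (\<lambda>P. P e') \<phi>"
    using sign_determined_upolys[OF F(2,1)] by (auto simp: sign_determined_def)
  show ?thesis
  proof (rule definable_if_agree[OF C(2,1)])
    fix e e' assume ag: "agree C e e'" and "\<exists>y. P e y"
    then obtain y where y: "P e y" by blast
    obtain \<phi> where "sign_iso F (\<lambda>P. P e) (\<lambda>P. P e') \<phi>"
      using C(3)[OF ag] by blast
    then have "P e y = P e' (\<phi> y)"
      by (intro F(3)) (simp add: sign_iso_def)
    with y show "\<exists>y. P e' y" by blast
  qed
qed

lemma definable_All:
  fixes S :: "('e \<Rightarrow> 'a::real_closed_field) set"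
  assumes "definable (scalar_ext S) (\<lambda>p. P (fst p) (snd p))"
  shows "definable S (\<lambda>e. \<forall>y. P e y)"
proof -
  have "definable S (\<lambda>e. \<not> (\<exists>y. \<not> P e y))"
    by (rule definable_not, rule definable_Ex, rule definable_not, rule assms)
  then show ?thesis by simp
qed

text \<open>
  Generators for the ring in which a vector variable is added to the parameters.
\<close>

definition vector_ext :: "('e \<Rightarrow> 'a) set \<Rightarrow> ('e \<times> ('a ^ 'n) \<Rightarrow> 'a) set" where
  "vector_ext S = (\<lambda>s p. s (fst p)) ` S \<union> range (\<lambda>i p. snd p $ i)"

lemma pfuns_ext_fst: "f \<in> pfuns S \<Longrightarrow> (\<lambda>p. f (fst p)) \<in> pfuns (scalar_ext S)"
  by (erule pfuns_subst) (auto simp: scalar_ext_def intro: pfuns_base)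

lemma pfuns_ext_snd: "snd \<in> pfuns (scalar_ext S)"
  by (auto simp: scalar_ext_def intro: pfuns_base)

lemma pfuns_vext_fst: "f \<in> pfuns S \<Longrightarrow> (\<lambda>p. f (fst p)) \<in> pfuns (vector_ext S)"
  by (erule pfuns_subst) (auto simp: vector_ext_def intro: pfuns_base)

lemma pfuns_vext_nth: "(\<lambda>p. snd p $ i) \<in> pfuns (vector_ext S)"
  by (auto simp: vector_ext_def intro: pfuns_base)

lemma definable_ext_subst:
  assumes "definable (scalar_ext S) (\<lambda>p. P (fst p) (snd p))"
    and "\<And>s. s \<in> S \<Longrightarrow> (\<lambda>e. s (a e)) \<in> pfuns T" and "b \<in> pfuns T"
  shows "definable T (\<lambda>e. P (a e) (b e))"
proof -
  have "definable T (\<lambda>e. (\<lambda>p. P (fst p) (snd p)) (a e, b e))"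
    by (rule definable_subst[OF assms(1)]) (use assms(2,3) in \<open>auto simp: scalar_ext_def\<close>)
  then show ?thesis by simp
qed

lemma definable_vext_subst:
  assumes "definable (vector_ext S) (\<lambda>p. P (fst p) (snd p))"
    and "\<And>s. s \<in> S \<Longrightarrow> (\<lambda>e. s (a e)) \<in> pfuns T" and "\<And>i. (\<lambda>e. b e $ i) \<in> pfuns T"
  shows "definable T (\<lambda>e. P (a e) (b e))"
proof -
  have "definable T (\<lambda>e. (\<lambda>p. P (fst p) (snd p)) (a e, b e))"
    by (rule definable_subst[OF assms(1)]) (use assms(2,3) in \<open>auto simp: vector_ext_def\<close>)
  then show ?thesis by simp
qed

text \<open>
  The coordinates are eliminated one by one; \<open>A I\<close> is the predicate in which those in \<open>I\<close> are quantified.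
\<close>

lemma definable_Ex_vec:
  fixes S :: "('e \<Rightarrow> 'a::real_closed_field) set" and P :: "'e \<Rightarrow> 'a ^ 'n::finite \<Rightarrow> bool"
  assumes "definable (vector_ext S) (\<lambda>p. P (fst p) (snd p))"
  shows "definable S (\<lambda>e. \<exists>x. P e x)"
proof -
  define A where "A I e x \<longleftrightarrow> (\<exists>x'. (\<forall>i. i \<notin> I \<longrightarrow> x' $ i = x $ i) \<and> P e x')" for I e x
  have "definable (vector_ext S) (\<lambda>p. A I (fst p) (snd p))" if "finite I" for I
    using that
  proof (induction I)
    case empty
    have "A {} e x \<longleftrightarrow> P e x" for e x
      by (auto simp: A_def vec_eq_iff[symmetric])
    then show ?case using assms by simp
  next
    case (insert i I)
    have eq: "A (insert i I) e x \<longleftrightarrow> (\<exists>y. A I e (\<chi> j. if j = i then y else x $ j))" for e x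
    proof
      assume "A (insert i I) e x"
      then obtain x' where x': "\<And>j. j \<notin> insert i I \<Longrightarrow> x' $ j = x $ j" "P e x'"
        by (auto simp: A_def)
      then have "A I e (\<chi> j. if j = i then x' $ i else x $ j)"
        unfolding A_def by (intro exI[of _ x']) auto
      then show "\<exists>y. A I e (\<chi> j. if j = i then y else x $ j)" by blast
    next
      assume "\<exists>y. A I e (\<chi> j. if j = i then y else x $ j)"
      then obtain y x' where x': "\<And>j. j \<notin> I \<Longrightarrow> x' $ j = (\<chi> j. if j = i then y else x $ j) $ j" "P e x'"
        unfolding A_def by blast
      then show "A (insert i I) e x"
        unfolding A_def by (intro exI[of _ x']) auto
    qed
    have "definable (scalar_ext (vector_ext S)) (\<lambda>q. A I (fst (fst q)) (\<chi> j. if j = i then snd q else snd (fst q) $ j))"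
    proof (rule definable_vext_subst[OF insert.IH])
      show "(\<lambda>q. s (fst (fst q))) \<in> pfuns (scalar_ext (vector_ext S))" if "s \<in> S" for s
        using pfuns_ext_fst[OF pfuns_vext_fst[OF pfuns_base[OF that]]] .
      show "(\<lambda>q. (\<chi> j. if j = i then snd q else snd (fst q) $ j) $ k) \<in> pfuns (scalar_ext (vector_ext S))" for k
        using pfuns_ext_snd[of "vector_ext S"] pfuns_ext_fst[OF pfuns_vext_nth[of k S]]
        by (cases "k = i") simp_all
    qed
    then show ?case
      unfolding eq by (rule definable_Ex)
  qed
  from this[OF finite[of UNIV]] have "definable S (\<lambda>e. A UNIV e 0)"
    by (rule definable_vext_subst) (auto intro: pfuns_base pfuns_const)
  then show ?thesis
    by (simp add: A_def)
qed

section \<open>Critical values of a definable family\<close>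

lemma poly_eq_sum_le:
  fixes p :: "'a::comm_ring_1 poly"
  assumes "degree p \<le> n"
  shows "poly p x = (\<Sum>i\<le>n. coeff p i * x ^ i)"
proof -
  have "(\<Sum>i\<le>degree p. coeff p i * x ^ i) = (\<Sum>i\<le>n. coeff p i * x ^ i)"
    by (rule sum.mono_neutral_left) (use assms in \<open>auto simp: coeff_eq_0\<close>)
  then show ?thesis
    by (simp add: poly_altdef)
qed

lemma pfuns_poly:
  assumes Q: "Q \<in> upolys S n" and f: "(\<And>s. s \<in> S \<Longrightarrow> (\<lambda>e. s (a e)) \<in> pfuns T)" and b: "b \<in> pfuns T"
  shows "(\<lambda>e. poly (Q (a e)) (b e)) \<in> pfuns T"
proof -
  have "(\<lambda>e. \<Sum>i\<le>n. coeff (Q (a e)) i * b e ^ i) \<in> pfuns T"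
    by (intro pfuns_sum pfuns_mult pfuns_power b) (rule pfuns_subst[OF upolys_coeff[OF Q] f])
  then show ?thesis
    by (simp add: poly_eq_sum_le[OF upolys_degree[OF Q]])
qed

lemma simple_root_sign_change:
  fixes h :: "'a::real_closed_field poly"
  assumes "poly h z = 0" "poly (pderiv h) z \<noteq> 0" "0 < \<delta>"
  shows "\<exists>y1 y2. z - \<delta> < y1 \<and> y1 < z \<and> z < y2 \<and> y2 < z + \<delta> \<and> poly h y1 * poly h y2 < 0"
proof -
  define Z where "Z = {y. poly (pderiv h) y = 0}"
  have "pderiv h \<noteq> 0"
    using assms(2) by auto
  then have Z: "finite Z"
    unfolding Z_def by (rule poly_roots_finite)
  obtain l where l: "l < z" "{l<..<z} \<inter> Z = {}"
    using finite_free_left[OF Z] by blast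
  obtain u where u: "z < u" "{z<..<u} \<inter> Z = {}"
    using finite_free_right[OF Z] by blast
  obtain y1 where y1: "max l (z - \<delta>) < y1" "y1 < z"
    using dense[of "max l (z - \<delta>)" z] l(1) assms(3) by auto
  obtain y2 where y2: "z < y2" "y2 < min u (z + \<delta>)"
    using dense[of z "min u (z + \<delta>)"] u(1) assms(3) by auto
  have free: "poly (pderiv h) y \<noteq> 0" if "l < y" "y < u" for y
  proof -
    have "y \<in> {l<..<z} \<or> y = z \<or> y \<in> {z<..<u}"
      using that by auto
    then show ?thesis
      using l(2) u(2) assms(2) by (auto simp: Z_def)
  qed
  have s1: "sgn (poly h y1) = - sgn (poly (pderiv h) y1)"
    using sgn_beside_root[OF assms(1), of y1] y1 y2 free by auto
  have s2: "sgn (poly h y2) = sgn (poly (pderiv h) y2)"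
    using sgn_beside_root[OF assms(1), of y2] y1 y2 free by auto
  have s3: "sgn (poly (pderiv h) y1) = sgn (poly (pderiv h) y2)"
    by (rule rcf_sgn_eq_if_no_root, rule free) (use y1 y2 in auto)
  have s4: "poly (pderiv h) y2 \<noteq> 0"
    by (rule free) (use y1 y2 in auto)
  have "poly h y1 * poly h y2 < 0"
    using s1 s2 s3 s4 by (auto simp: sgn_if mult_less_0_iff split: if_splits)
  then show ?thesis
    using y1 y2 by auto
qed

definition iter_pderiv :: "nat \<Rightarrow> 'a::idom poly \<Rightarrow> 'a poly" where
  "iter_pderiv k p = (pderiv ^^ k) p"

lemma iter_pderiv_0 [simp]: "iter_pderiv 0 p = p"
  and iter_pderiv_Suc: "iter_pderiv (Suc k) p = pderiv (iter_pderiv k p)"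
  by (simp_all add: iter_pderiv_def)

lemma degree_iter_pderiv: "degree (iter_pderiv k p) = degree p - k"
  for p :: "'a::{idom,semiring_char_0} poly"
  by (induction k) (simp_all add: iter_pderiv_Suc degree_pderiv)

lemma upolys_iter_pderiv:
  fixes S :: "('e \<Rightarrow> 'a::{idom,semiring_char_0}) set"
  shows "Q \<in> upolys S n \<Longrightarrow> (\<lambda>e. iter_pderiv k (Q e)) \<in> upolys S n"
  by (induction k) (auto simp: iter_pderiv_Suc intro: upolys_mono[OF upolys_pderiv])

text \<open>
  A multiple root may disappear under a small change of the coefficients, but a simple one does not.
  Every root is a simple root of some derivative, namely of the last one that vanishes there.
\<close>

lemma ex_simple_root_derivative:
  fixes p :: "'a::real_closed_field poly"
  assumes "iter_pderiv k p \<noteq> 0" "poly (iter_pderiv k p) z = 0" "degree p \<le> n"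
  shows "\<exists>j\<le>n. poly (iter_pderiv j p) z = 0 \<and> poly (pderiv (iter_pderiv j p)) z \<noteq> 0"
proof -
  define A where "A = {j. iter_pderiv j p \<noteq> 0 \<and> poly (iter_pderiv j p) z = 0}"
  have deg: "j < degree p" if "j \<in> A" for j
  proof -
    have "degree (iter_pderiv j p) \<noteq> 0"
    proof
      assume "degree (iter_pderiv j p) = 0"
      then obtain c where "iter_pderiv j p = [:c:]"
        by (rule degree_eq_zeroE)
      then show False
        using that by (simp add: A_def)
    qed
    then show ?thesis
      by (simp add: degree_iter_pderiv)
  qed
  then have "A \<subseteq> {..<degree p}"
    by auto
  then have fin: "finite A"
    by (rule finite_subset) simp
  have "k \<in> A"
    using assms by (simp add: A_def)
  define j where "j = Max A"
  have j: "j \<in> A"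
    unfolding j_def by (rule Max_in) (use fin \<open>k \<in> A\<close> in auto)
  have "pderiv (iter_pderiv j p) \<noteq> 0"
    using deg[OF j] by (simp add: pderiv_eq_0_iff degree_iter_pderiv)
  moreover have "Suc j \<notin> A"
    using Max_ge[OF fin, of "Suc j"] by (auto simp: j_def)
  ultimately have "poly (pderiv (iter_pderiv j p)) z \<noteq> 0"
    by (simp add: A_def iter_pderiv_Suc)
  moreover have "j \<le> n"
    using deg[OF j] assms(3) by simp
  ultimately show ?thesis
    using j by (auto simp: A_def)
qed

text \<open>
  Convergence of \<open>F\<close> to \<open>e\<close>, as far as it is visible in strict inequalities between functions of \<open>S\<close>. In
  this form it needs no topology on the parameters.
\<close>

definition tends_to :: "('e \<Rightarrow> 'a::linordered_field) set \<Rightarrow> 'e filter \<Rightarrow> 'e \<Rightarrow> bool" where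
  "tends_to S F e \<longleftrightarrow> (\<forall>f\<in>pfuns S. 0 < f e \<longrightarrow> eventually (\<lambda>e'. 0 < f e') F)"

text \<open>
  \<open>Z e\<close> is a finite set of uniformly bounded size such that \<open>P e\<close> is constant on each interval that avoids
  it. By the last condition \<open>Z\<close> is lower semicontinuous: a critical value persists nearby when the
  parameter changes slightly. It is this condition that yields continuity of definable functions.
\<close>

definition critical :: "('e \<Rightarrow> 'a::linordered_field) set \<Rightarrow> ('e \<Rightarrow> 'a \<Rightarrow> bool) \<Rightarrow> nat \<Rightarrow> ('e \<Rightarrow> 'a set) \<Rightarrow> bool" where
  "critical S P K Z \<longleftrightarrow>
     definable (scalar_ext S) (\<lambda>p. snd p \<in> Z (fst p)) \<and>
     (\<forall>e. finite (Z e) \<and> card (Z e) \<le> K) \<and>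
     (\<forall>e y1 y2. segment y1 y2 \<inter> Z e = {} \<longrightarrow> P e y1 = P e y2) \<and>
     (\<forall>e z \<delta> F. z \<in> Z e \<longrightarrow> 0 < \<delta> \<longrightarrow> tends_to S F e \<longrightarrow>
        eventually (\<lambda>e'. \<exists>z'\<in>Z e'. \<bar>z' - z\<bar> < \<delta>) F)"

text \<open>
  The critical values are the roots of \<open>Q e\<close> and of all its derivatives. The derivatives serve lower
  semicontinuity, since each critical value is then a simple root of one of the polynomials.
\<close>

lemma ex_critical_poly:
  fixes S :: "('e \<Rightarrow> 'a::real_closed_field) set"
  assumes Q: "Q \<in> upolys S n"
  shows "\<exists>K Z. critical S (\<lambda>e y. 0 < poly (Q e) y) K Z"
proof -
  define D where "D k e = iter_pderiv k (Q e)" for k e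
  have D: "D k \<in> upolys S n" for k
    using upolys_iter_pderiv[OF Q] by (simp add: D_def[abs_def])
  define R where "R k e = {z. D k e \<noteq> 0 \<and> poly (D k e) z = 0}" for k e
  define Z where "Z e = (\<Union>k\<le>n. R k e)" for e
  have R: "finite (R k e)" "card (R k e) \<le> n" for k e
  proof -
    show "finite (R k e)"
      using poly_roots_finite[of "D k e"] by (cases "D k e = 0") (auto simp: R_def)
    show "card (R k e) \<le> n"
    proof (cases "D k e = 0")
      case False
      then have "card (R k e) \<le> degree (D k e)"
        using card_poly_roots_bound[OF False] by (simp add: R_def)
      then show ?thesis
        using upolys_degree[OF D, of k e] by simp
    qed (simp add: R_def)
  qed
  have nz: "D k e \<noteq> 0 \<longleftrightarrow> (\<exists>i\<in>{..n}. coeff (D k e) i \<noteq> 0)" for k e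
  proof
    assume "D k e \<noteq> 0"
    then show "\<exists>i\<in>{..n}. coeff (D k e) i \<noteq> 0"
      using upolys_degree[OF D, of k e] by (intro bexI[of _ "degree (D k e)"]) auto
  qed auto
  have "definable (scalar_ext S) (\<lambda>p. \<exists>k\<in>{..n}. (\<exists>i\<in>{..n}. \<not> coeff (D k (fst p)) i = 0) \<and> poly (D k (fst p)) (snd p) = 0)"
    by (intro definable_Bex_finite definable_conj definable_not definable_eq pfuns_const finite_atMost
        pfuns_ext_fst[OF upolys_coeff[OF D]] pfuns_poly[OF D] pfuns_ext_fst pfuns_base pfuns_ext_snd)
  moreover have "snd p \<in> Z (fst p) \<longleftrightarrow>
      (\<exists>k\<in>{..n}. (\<exists>i\<in>{..n}. \<not> coeff (D k (fst p)) i = 0) \<and> poly (D k (fst p)) (snd p) = 0)" for p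
    by (simp add: Z_def R_def nz)
  ultimately have def: "definable (scalar_ext S) (\<lambda>p. snd p \<in> Z (fst p))"
    by simp
  have fin: "finite (Z e) \<and> card (Z e) \<le> Suc n * n" for e
  proof
    show "finite (Z e)"
      using R(1) by (simp add: Z_def)
    have "card (Z e) \<le> (\<Sum>k\<le>n. card (R k e))"
      unfolding Z_def by (rule card_UN_le) simp
    also have "\<dots> \<le> (\<Sum>k\<le>n. n)"
      by (rule sum_mono) (rule R(2))
    finally show "card (Z e) \<le> Suc n * n"
      by simp
  qed
  have gap: "(0 < poly (Q e) y1) = (0 < poly (Q e) y2)" if "segment y1 y2 \<inter> Z e = {}" for e y1 y2
  proof (cases "Q e = 0")
    case False
    have "sgn (poly (Q e) y1) = sgn (poly (Q e) y2)"
    proof (rule rcf_sgn_eq_if_no_root)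
      fix z assume "z \<in> segment y1 y2"
      then have "z \<notin> R 0 e"
        using that by (auto simp: Z_def)
      then show "poly (Q e) z \<noteq> 0"
        using False by (simp add: R_def D_def)
    qed
    then show ?thesis
      by (simp add: sgn_if split: if_splits)
  qed simp
  have lsc: "eventually (\<lambda>e'. \<exists>z'\<in>Z e'. \<bar>z' - z\<bar> < \<delta>) F"
    if z: "z \<in> Z e" and \<delta>: "0 < \<delta>" and F: "tends_to S F e" for e z \<delta> F
  proof -
    obtain k where "iter_pderiv k (Q e) \<noteq> 0" "poly (iter_pderiv k (Q e)) z = 0"
      using z by (auto simp: Z_def R_def D_def)
    from ex_simple_root_derivative[OF this upolys_degree[OF Q]]
    obtain j where j: "j \<le> n" "poly (D j e) z = 0" "poly (pderiv (D j e)) z \<noteq> 0"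
      by (auto simp: D_def)
    obtain y1 y2 where y: "z - \<delta> < y1" "y1 < z" "z < y2" "y2 < z + \<delta>" "poly (D j e) y1 * poly (D j e) y2 < 0"
      using simple_root_sign_change[OF j(2,3) \<delta>] by blast
    have "(\<lambda>e. poly (D j e) c) \<in> pfuns S" for c
      using pfuns_poly[OF D, where a = "\<lambda>e. e" and b = "\<lambda>_. c"] by (auto intro: pfuns_base pfuns_const)
    then have "(\<lambda>e. - (poly (D j e) y1 * poly (D j e) y2)) \<in> pfuns S"
      by (intro pfuns_uminus pfuns_mult)
    then have "eventually (\<lambda>e'. 0 < - (poly (D j e') y1 * poly (D j e') y2)) F"
      using F y(5) by (auto simp: tends_to_def)
    then show ?thesis
    proof (rule eventually_mono)
      fix e' assume "0 < - (poly (D j e') y1 * poly (D j e') y2)"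
      then have neg: "poly (D j e') y1 * poly (D j e') y2 < 0"
        by simp
      have "y1 < y2"
        using y by simp
      then obtain z' where z': "y1 < z'" "z' < y2" "poly (D j e') z' = 0"
        using rcf_IVT[OF _ neg] by blast
      have "D j e' \<noteq> 0"
        using neg by auto
      then have "z' \<in> Z e'"
        using z' j(1) by (auto simp: Z_def R_def)
      moreover have "\<bar>z' - z\<bar> < \<delta>"
        using z' y by (auto simp: abs_less_iff)
      ultimately show "\<exists>z'\<in>Z e'. \<bar>z' - z\<bar> < \<delta>"
        by blast
    qed
  qed
  have "critical S (\<lambda>e y. 0 < poly (Q e) y) (Suc n * n) Z"
    unfolding critical_def using def fin gap lsc by blast
  then show ?thesis by blast
qed

theorem ex_critical:
  fixes S :: "('e \<Rightarrow> 'a::real_closed_field) set"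
  assumes "definable (scalar_ext S) P"
  shows "\<exists>K Z. critical S (\<lambda>e y. P (e, y)) K Z"
  using assms
proof (induction rule: definable.induct)
  case (definable_pos f)
  then obtain n Q where Q: "Q \<in> upolys S n" "\<And>e y. f (e, y) = poly (Q e) y"
    using pfuns_ext_upoly by blast
  show ?case
    unfolding Q(2) by (rule ex_critical_poly[OF Q(1)])
next
  case (definable_not P)
  then show ?case by (simp add: critical_def)
next
  case (definable_conj P Q)
  obtain K Z where Z: "critical S (\<lambda>e y. P (e, y)) K Z"
    using definable_conj.IH(1) by blast
  obtain L W where W: "critical S (\<lambda>e y. Q (e, y)) L W"
    using definable_conj.IH(2) by blast
  define V where "V e = Z e \<union> W e" for e
  have "definable (scalar_ext S) (\<lambda>p. snd p \<in> Z (fst p) \<or> snd p \<in> W (fst p))"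
    using Z W unfolding critical_def by (intro definable_disj) blast+
  then have "definable (scalar_ext S) (\<lambda>p. snd p \<in> V (fst p))"
    by (simp add: V_def)
  moreover have "finite (V e) \<and> card (V e) \<le> K + L" for e
  proof -
    have "finite (Z e)" "card (Z e) \<le> K" "finite (W e)" "card (W e) \<le> L"
      using Z W unfolding critical_def by blast+
    then show ?thesis
      using card_Un_le[of "Z e" "W e"] by (simp add: V_def)
  qed
  moreover have "(P (e, y1) \<and> Q (e, y1)) = (P (e, y2) \<and> Q (e, y2))" if "segment y1 y2 \<inter> V e = {}" for e y1 y2
  proof -
    have "segment y1 y2 \<inter> Z e = {}" "segment y1 y2 \<inter> W e = {}"
      using that unfolding V_def by blast+
    then have "P (e, y1) = P (e, y2)" "Q (e, y1) = Q (e, y2)"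
      using Z W unfolding critical_def by blast+
    then show ?thesis by simp
  qed
  moreover have "eventually (\<lambda>e'. \<exists>z'\<in>V e'. \<bar>z' - z\<bar> < \<delta>) F"
    if zV: "z \<in> V e" and prems: "0 < \<delta>" "tends_to S F e" for e z \<delta> F
  proof -
    consider "z \<in> Z e" | "z \<in> W e"
      using zV unfolding V_def by blast
    then show ?thesis
    proof cases
      case 1
      then have "eventually (\<lambda>e'. \<exists>z'\<in>Z e'. \<bar>z' - z\<bar> < \<delta>) F"
        using Z prems unfolding critical_def by blast
      then show ?thesis
        by (rule eventually_mono) (auto simp: V_def)
    next
      case 2
      then have "eventually (\<lambda>e'. \<exists>z'\<in>W e'. \<bar>z' - z\<bar> < \<delta>) F"
        using W prems unfolding critical_def by blast
      then show ?thesis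
        by (rule eventually_mono) (auto simp: V_def)
    qed
  qed
  ultimately have "critical S (\<lambda>e y. P (e, y) \<and> Q (e, y)) (K + L) V"
    unfolding critical_def by blast
  then show ?case by blast
qed

section \<open>Definable sets of scalars\<close>

lemma criticalD:
  assumes "critical S P K Z"
  shows "definable (scalar_ext S) (\<lambda>p. snd p \<in> Z (fst p))" "finite (Z e)" "card (Z e) \<le> K"
    "segment y1 y2 \<inter> Z e = {} \<Longrightarrow> P e y1 = P e y2"
    "z \<in> Z e \<Longrightarrow> 0 < \<delta> \<Longrightarrow> tends_to S F e \<Longrightarrow> eventually (\<lambda>e'. \<exists>z'\<in>Z e'. \<bar>z' - z\<bar> < \<delta>) F"
  using assms unfolding critical_def by blast+

abbreviation coord :: "('a \<Rightarrow> 'a) set" where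
  "coord \<equiv> {\<lambda>t. t}"

lemma pfuns_coord: "(\<lambda>t. t) \<in> pfuns coord"
  by (rule pfuns_base) simp

lemma ex_finite_breaks:
  fixes Q :: "'a::real_closed_field \<Rightarrow> bool"
  assumes "definable coord Q"
  shows "\<exists>Z. finite Z \<and> (\<forall>s t. segment s t \<inter> Z = {} \<longrightarrow> Q s = Q t)"
proof -
  have "definable (scalar_ext ({} :: (unit \<Rightarrow> 'a) set)) (\<lambda>p. Q (snd p))"
    by (rule definable_subst[OF assms]) (auto intro: pfuns_ext_snd)
  from ex_critical[OF this] obtain K Z where "critical {} (\<lambda>(e :: unit) y. Q y) K Z"
    by auto
  from criticalD(2,4)[OF this] show ?thesis
    by (intro exI[of _ "Z ()"]) blast
qed

lemma eventually_const_at_right_0: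
  fixes Q :: "'a::real_closed_field \<Rightarrow> bool"
  assumes "definable coord Q"
  shows "\<exists>\<epsilon>>0. \<forall>s t. 0 < s \<and> s < \<epsilon> \<and> 0 < t \<and> t < \<epsilon> \<longrightarrow> Q s = Q t"
proof -
  obtain Z where Z: "finite Z" "\<And>s t. segment s t \<inter> Z = {} \<Longrightarrow> Q s = Q t"
    using ex_finite_breaks[OF assms] by blast
  obtain \<epsilon> where \<epsilon>: "0 < \<epsilon>" "{0<..<\<epsilon>} \<inter> Z = {}"
    using finite_free_right[OF Z(1)] by blast
  have "Q s = Q t" if "0 < s" "s < \<epsilon>" "0 < t" "t < \<epsilon>" for s t
  proof (rule Z(2))
    have "segment s t \<subseteq> {0<..<\<epsilon>}"
      by (rule segment_subset_open_interval) (use that in auto)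
    then show "segment s t \<inter> Z = {}"
      using \<epsilon>(2) by blast
  qed
  with \<epsilon>(1) show ?thesis by blast
qed

text \<open>
  A definable initial segment of the line has an end point. This replaces completeness, which a real
  closed field need not have.
\<close>

lemma definable_cut:
  fixes Q :: "'a::real_closed_field \<Rightarrow> bool"
  assumes "definable coord Q" and down: "\<And>s t. s \<le> t \<Longrightarrow> Q t \<Longrightarrow> Q s" and "Q a" "\<not> Q b"
  shows "\<exists>c. (\<forall>x<c. Q x) \<and> (\<forall>x>c. \<not> Q x)"
proof -
  obtain Z where Z: "finite Z" "\<And>s t. segment s t \<inter> Z = {} \<Longrightarrow> Q s = Q t"
    using ex_finite_breaks[OF assms(1)] by blast
  define W where "W = insert a (insert b Z)"
  define u where "u = Max {z \<in> W. Q z}"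
  define v where "v = Min {z \<in> W. \<not> Q z}"
  have fin: "finite {z \<in> W. Q z}" "finite {z \<in> W. \<not> Q z}"
    using Z(1) by (auto simp: W_def)
  have "u \<in> {z \<in> W. Q z}"
    unfolding u_def by (rule Max_in[OF fin(1)]) (use assms in \<open>auto simp: W_def\<close>)
  then have u: "Q u" by simp
  have "v \<in> {z \<in> W. \<not> Q z}"
    unfolding v_def by (rule Min_in[OF fin(2)]) (use assms in \<open>auto simp: W_def\<close>)
  then have v: "\<not> Q v" by simp
  have uv: "u < v"
    using down u v by (meson not_le)
  have le_u: "z \<le> u" if "z \<in> Z" "Q z" for z
    unfolding u_def by (rule Max_ge[OF fin(1)]) (use that in \<open>auto simp: W_def\<close>)
  have ge_v: "v \<le> z" if "z \<in> Z" "\<not> Q z" for z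
    unfolding v_def by (rule Min_le[OF fin(2)]) (use that in \<open>auto simp: W_def\<close>)
  have free: "{u<..<v} \<inter> Z = {}"
    using le_u ge_v by (meson disjoint_iff greaterThanLessThan_iff not_le)
  obtain m where m: "u < m" "m < v"
    using dense[OF uv] by blast
  have same: "Q x = Q m" if "u < x" "x < v" for x
  proof (rule Z(2))
    have "segment x m \<subseteq> {u<..<v}"
      by (rule segment_subset_open_interval) (use that m in auto)
    then show "segment x m \<inter> Z = {}"
      using free by blast
  qed
  show ?thesis
  proof (cases "Q m")
    case True
    have "Q x" if "x < v" for x
      using same[of x] down[of x m] True m that by (meson not_le less_imp_le less_le_trans)
    moreover have "\<not> Q x" if "v < x" for x
      using down[of v x] v that by auto
    ultimately show ?thesis by blast
  next
    case False
    have "\<not> Q x" if "u < x" for x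
      using same[of x] down[of m x] False m that by (meson not_le less_imp_le less_le_trans)
    moreover have "Q x" if "x < u" for x
      using down[of x u] u that by auto
    ultimately show ?thesis by blast
  qed
qed

section \<open>Definable choice\<close>

text \<open>
  If \<open>P e\<close> holds somewhere, it holds on a whole interval between critical values or at a critical value.
  So it holds at one of finitely many sample points: the critical values, the midpoints of two of them,
  the points at distance \<open>1\<close> from one of them, and \<open>0\<close>. The choice is the least sample point in \<open>P e\<close>.
\<close>

theorem definable_choice:
  fixes S :: "('e \<Rightarrow> 'a::real_closed_field) set"
  assumes P: "definable (scalar_ext S) (\<lambda>p. P (fst p) (snd p))"
  shows "\<exists>c. (\<forall>e. (\<exists>y. P e y) \<longrightarrow> P e (c e)) \<and> definable (scalar_ext S) (\<lambda>p. snd p = c (fst p))"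
proof -
  obtain K Z where "critical S (\<lambda>e y. P (fst (e, y)) (snd (e, y))) K Z"
    using ex_critical[OF P] by blast
  then have cr: "critical S P K Z"
    by simp
  note Z = criticalD[OF cr]
  define sample where "sample e y \<longleftrightarrow> y = 0 \<or> (\<exists>z. z \<in> Z e \<and> (y = z + 1 \<or> y = z - 1 \<or> (\<exists>w. w \<in> Z e \<and> y + y = z + w)))" for e y
  have fin: "finite {y. sample e y}" for e
  proof (rule finite_subset)
    show "{y. sample e y} \<subseteq> {0} \<union> (\<lambda>z. z + 1) ` Z e \<union> (\<lambda>z. z - 1) ` Z e \<union> (\<lambda>(z, w). (z + w) / 2) ` (Z e \<times> Z e)"
    proof
      fix y assume "y \<in> {y. sample e y}"
      then have "y = 0 \<or> (\<exists>z\<in>Z e. y = z + 1) \<or> (\<exists>z\<in>Z e. y = z - 1) \<or> (\<exists>z\<in>Z e. \<exists>w\<in>Z e. y + y = z + w)"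
        by (auto simp: sample_def)
      moreover have "y = (z + w) / 2" if "y + y = z + w" for z w
        using that by (simp add: field_simps mult_2)
      ultimately show "y \<in> {0} \<union> (\<lambda>z. z + 1) ` Z e \<union> (\<lambda>z. z - 1) ` Z e \<union> (\<lambda>(z, w). (z + w) / 2) ` (Z e \<times> Z e)"
        by force
    qed
    show "finite ({0} \<union> (\<lambda>z. z + 1) ` Z e \<union> (\<lambda>z. z - 1) ` Z e \<union> (\<lambda>(z, w). (z + w) / 2) ` (Z e \<times> Z e))"
      using Z(2) by simp
  qed
  have hit: "\<exists>y. P e y \<and> sample e y" if "P e y" for e y
  proof (cases "y \<in> Z e")
    case True
    then have "sample e y"
      by (auto simp: sample_def)
    with that show ?thesis by blast
  next
    case False
    have same: "P e x" if "\<And>z. z \<in> Z e \<Longrightarrow> (z < y \<and> z < x) \<or> (y < z \<and> x < z)" for x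
    proof -
      have "segment y x \<inter> Z e = {}"
        using that by (fastforce simp: min_le_iff_disj le_max_iff_disj)
      then show ?thesis
        using Z(4) \<open>P e y\<close> by blast
    qed
    have side: "z < y \<or> y < z" if "z \<in> Z e" for z
      using that False by (metis neqE)
    consider (none) "Z e = {}" | (left) a where "left_neighbour (Z e) a y" "\<And>z. z \<in> Z e \<Longrightarrow> z < y"
      | (right) b where "right_neighbour (Z e) b y" "\<And>z. z \<in> Z e \<Longrightarrow> y < z"
      | (both) a b where "left_neighbour (Z e) a y" "right_neighbour (Z e) b y"
      using side ex_left_neighbour[OF Z(2)] ex_right_neighbour[OF Z(2)] by (metis all_not_in_conv)
    then show ?thesis
    proof cases
      case none
      then show ?thesis
        using same[of 0] by (auto simp: sample_def)
    next
      case left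
      have "P e (a + 1)"
      proof (rule same)
        fix z assume z: "z \<in> Z e"
        then have "z \<le> a"
          using left(1) left(2)[OF z] unfolding left_neighbour_def disjoint_iff
          by (meson greaterThanLessThan_iff not_le)
        then show "(z < y \<and> z < a + 1) \<or> (y < z \<and> a + 1 < z)"
          using left(2)[OF z] by (simp add: add_strict_increasing2 less_add_one le_less_trans)
      qed
      moreover have "sample e (a + 1)"
        using left(1) by (auto simp: sample_def left_neighbour_def)
      ultimately show ?thesis by blast
    next
      case right
      have "P e (b - 1)"
      proof (rule same)
        fix z assume z: "z \<in> Z e"
        then have "b \<le> z"
          using right(1) right(2)[OF z] unfolding right_neighbour_def disjoint_iff
          by (meson greaterThanLessThan_iff not_le)
        moreover have "b - 1 < b"
          by simp
        ultimately show "(z < y \<and> z < b - 1) \<or> (y < z \<and> b - 1 < z)"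
          using right(2)[OF z] by (meson less_le_trans)
      qed
      moreover have "sample e (b - 1)"
        using right(1) by (auto simp: sample_def right_neighbour_def)
      ultimately show ?thesis by blast
    next
      case both
      define m where "m = (a + b) / 2"
      have ab: "a < y" "y < b" "a \<in> Z e" "b \<in> Z e"
        using both by (auto simp: left_neighbour_def right_neighbour_def)
      then have m: "a < m" "m < b"
        by (auto simp: m_def field_simps)
      have "P e m"
      proof (rule same)
        fix z assume z: "z \<in> Z e"
        have "z \<le> a \<or> b \<le> z"
          using both side[OF z] z by (auto simp: left_neighbour_def right_neighbour_def disjoint_iff not_less)
        then show "(z < y \<and> z < m) \<or> (y < z \<and> m < z)"
          using ab m by (meson le_less_trans less_le_trans)
      qed
      moreover have "m + m = a + b"
        by (simp add: m_def)
      then have "sample e m"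
        using ab by (auto simp: sample_def)
      ultimately show ?thesis by blast
    qed
  qed
  define c where "c e = (if \<exists>y. P e y then Min {y. P e y \<and> sample e y} else 0)" for e
  have fin': "finite {y. P e y \<and> sample e y}" for e
    by (rule finite_subset[OF _ fin[of e]]) auto
  have c: "P e (c e) \<and> sample e (c e) \<and> (\<forall>y. P e y \<and> sample e y \<longrightarrow> c e \<le> y)" if "\<exists>y. P e y" for e
  proof -
    have "{y. P e y \<and> sample e y} \<noteq> {}"
      using hit that by blast
    then have "Min {y. P e y \<and> sample e y} \<in> {y. P e y \<and> sample e y}"
      by (rule Min_in[OF fin'])
    moreover have "Min {y. P e y \<and> sample e y} \<le> y" if "P e y \<and> sample e y" for y
      by (rule Min_le[OF fin']) (use that in auto)
    ultimately show ?thesis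
      using that by (simp add: c_def)
  qed
  have graph: "y = c e \<longleftrightarrow> (P e y \<and> sample e y \<and> (\<forall>y'. P e y' \<and> sample e y' \<longrightarrow> y \<le> y')) \<or> (\<not> (\<exists>y. P e y) \<and> y = 0)" for e y
  proof (cases "\<exists>y. P e y")
    case True
    then show ?thesis
      using c[OF True] by (metis antisym)
  next
    case False
    then show ?thesis
      by (auto simp: c_def)
  qed
  have Zd: "definable T (\<lambda>e. b e \<in> Z (a e))" if "\<And>s. s \<in> S \<Longrightarrow> (\<lambda>e. s (a e)) \<in> pfuns T" "b \<in> pfuns T"
    for T :: "('d \<Rightarrow> 'a) set" and a b
    by (rule definable_ext_subst[OF Z(1)]) (use that in auto)
  have sample_definable: "definable T (\<lambda>e. sample (a e) (b e))" if a: "\<And>s. s \<in> S \<Longrightarrow> (\<lambda>e. s (a e)) \<in> pfuns T" and b: "b \<in> pfuns T"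
    for T :: "('d \<Rightarrow> 'a) set" and a b
    unfolding sample_def
    by (intro definable_disj definable_conj definable_Ex definable_eq Zd pfuns_add pfuns_diff pfuns_const
        pfuns_ext_fst pfuns_ext_snd a b)
  have "definable (scalar_ext S) (\<lambda>p. (P (fst p) (snd p) \<and> sample (fst p) (snd p) \<and>
      (\<forall>y'. P (fst p) y' \<and> sample (fst p) y' \<longrightarrow> snd p \<le> y')) \<or> (\<not> (\<exists>y. P (fst p) y) \<and> snd p = 0))"
    by (intro definable_disj definable_conj definable_imp definable_not definable_Ex definable_All definable_eq definable_le
        definable_ext_subst[OF P] sample_definable pfuns_const pfuns_ext_fst pfuns_ext_snd pfuns_base)
  then have "definable (scalar_ext S) (\<lambda>p. snd p = c (fst p))"
    by (simp only: graph)
  then show ?thesis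
    using c by blast
qed

text \<open>
  The coordinates are chosen one after the other, each one subject to those already chosen.
\<close>

theorem definable_choice_vec:
  fixes S :: "('e \<Rightarrow> 'a::real_closed_field) set" and P :: "'e \<Rightarrow> 'a ^ 'n::finite \<Rightarrow> bool"
  assumes P: "definable (vector_ext S) (\<lambda>p. P (fst p) (snd p))"
  shows "\<exists>c. (\<forall>e. (\<exists>x. P e x) \<longrightarrow> P e (c e)) \<and> (\<forall>i. definable (scalar_ext S) (\<lambda>p. snd p = c (fst p) $ i))"
proof -
  have "\<exists>c. (\<forall>i\<in>I. definable (scalar_ext S) (\<lambda>p. snd p = c i (fst p))) \<and>
      (\<forall>e. (\<exists>x. P e x) \<longrightarrow> (\<exists>x. P e x \<and> (\<forall>i\<in>I. x $ i = c i e)))" if "finite I" for I :: "'n set"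
    using that
  proof (induction I)
    case empty
    show ?case by auto
  next
    case (insert i I)
    then obtain c where c: "\<And>j. j \<in> I \<Longrightarrow> definable (scalar_ext S) (\<lambda>p. snd p = c j (fst p))"
      "\<And>e. (\<exists>x. P e x) \<Longrightarrow> (\<exists>x. P e x \<and> (\<forall>j\<in>I. x $ j = c j e))"
      by blast
    define R where "R e y \<longleftrightarrow> (\<exists>x. P e x \<and> (\<forall>j\<in>I. x $ j = c j e) \<and> x $ i = y)" for e y
    have "definable (scalar_ext S) (\<lambda>p. R (fst p) (snd p))"
      unfolding R_def
      by (intro definable_Ex_vec definable_conj definable_vext_subst[OF P] definable_Ball_finite insert.hyps
          definable_ext_subst[OF c(1)] definable_eq pfuns_vext_fst pfuns_vext_nth pfuns_ext_fst pfuns_ext_snd pfuns_base)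
    from definable_choice[OF this] obtain d where
      d: "\<And>e. (\<exists>y. R e y) \<Longrightarrow> R e (d e)" "definable (scalar_ext S) (\<lambda>p. snd p = d (fst p))"
      by blast
    define c' where "c' = c(i := d)"
    have "definable (scalar_ext S) (\<lambda>p. snd p = c' j (fst p))" if "j \<in> insert i I" for j
      using that c(1) d(2) by (auto simp: c'_def)
    moreover have "\<exists>x. P e x \<and> (\<forall>j\<in>insert i I. x $ j = c' j e)" if "\<exists>x. P e x" for e
    proof -
      have "\<exists>y. R e y"
        using c(2)[OF that] by (auto simp: R_def)
      from d(1)[OF this] obtain x where "P e x" "\<forall>j\<in>I. x $ j = c j e" "x $ i = d e"
        by (auto simp: R_def)
      then show ?thesis
        using insert.hyps(2) by (intro exI[of _ x]) (auto simp: c'_def)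
    qed
    ultimately show ?case by blast
  qed
  from this[OF finite[of UNIV]] obtain c where
    c: "\<And>i. definable (scalar_ext S) (\<lambda>p. snd p = c i (fst p))"
      "\<And>e. (\<exists>x. P e x) \<Longrightarrow> (\<exists>x. P e x \<and> (\<forall>i. x $ i = c i e))"
    by auto
  have "P e (\<chi> i. c i e)" if ex: "\<exists>x. P e x" for e
  proof -
    obtain x where "P e x" "\<forall>i. x $ i = c i e"
      using c(2)[OF ex] by blast
    moreover from this have "x = (\<chi> i. c i e)"
      by (simp add: vec_eq_iff)
    ultimately show ?thesis by simp
  qed
  with c(1) show ?thesis
    by (intro exI[of _ "\<lambda>e. \<chi> i. c i e"]) simp
qed


section \<open>Continuity of definable functions near the origin\<close>

lemma pfuns_coord_poly:
  assumes "f \<in> pfuns coord"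
  shows "\<exists>p. \<forall>t. f t = poly p t"
  using assms
proof (induction rule: pfuns.induct)
  case (pfuns_const c)
  show ?case by (intro exI[of _ "[:c:]"]) simp
next
  case (pfuns_base s)
  then show ?case by (intro exI[of _ "[:0, 1:]"]) simp
next
  case (pfuns_add f g)
  then obtain p q where "\<forall>t. f t = poly p t" "\<forall>t. g t = poly q t" by blast
  then show ?case by (intro exI[of _ "p + q"]) simp
next
  case (pfuns_mult f g)
  then obtain p q where "\<forall>t. f t = poly p t" "\<forall>t. g t = poly q t" by blast
  then show ?case by (intro exI[of _ "p * q"]) simp
qed

lemma eventually_nhds_linordered_field:
  fixes c :: "'a::{linordered_field,linorder_topology}"
  shows "eventually P (nhds c) \<longleftrightarrow> (\<exists>\<delta>>0. \<forall>x. \<bar>x - c\<bar> < \<delta> \<longrightarrow> P x)"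
proof
  assume "eventually P (nhds c)"
  then obtain U where U: "open U" "c \<in> U" "\<And>x. x \<in> U \<Longrightarrow> P x"
    by (auto simp: eventually_nhds)
  obtain b where b: "c < b" "{c..<b} \<subseteq> U"
    using open_right[OF U(1,2), of "c + 1"] by auto
  obtain a where a: "a < c" "{a<..c} \<subseteq> U"
    using open_left[OF U(1,2), of "c - 1"] by auto
  show "\<exists>\<delta>>0. \<forall>x. \<bar>x - c\<bar> < \<delta> \<longrightarrow> P x"
  proof (intro exI[of _ "min (b - c) (c - a)"] conjI allI impI)
    show "0 < min (b - c) (c - a)"
      using a b by simp
    fix x assume "\<bar>x - c\<bar> < min (b - c) (c - a)"
    then have "a < x" "x < b"
      by (auto simp: abs_less_iff)
    then have "x \<in> U"
      using a(2) b(2) by (cases "c \<le> x") auto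
    then show "P x"
      by (rule U(3))
  qed
next
  assume "\<exists>\<delta>>0. \<forall>x. \<bar>x - c\<bar> < \<delta> \<longrightarrow> P x"
  then obtain \<delta> where \<delta>: "\<delta> > 0" "\<And>x. \<bar>x - c\<bar> < \<delta> \<Longrightarrow> P x"
    by blast
  have "open {c - \<delta><..<c + \<delta>}" "c \<in> {c - \<delta><..<c + \<delta>}"
    using \<delta>(1) by auto
  moreover have "P x" if "x \<in> {c - \<delta><..<c + \<delta>}" for x
    by (rule \<delta>(2)) (use that in \<open>auto simp: abs_less_iff\<close>)
  ultimately show "eventually P (nhds c)"
    unfolding eventually_nhds by blast
qed

lemma tends_to_nhds:
  fixes t :: "'a::{real_closed_field,linorder_topology}"
  shows "tends_to coord (nhds t) t"
  unfolding tends_to_def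
proof (intro ballI impI)
  fix f assume "f \<in> pfuns (coord :: ('a \<Rightarrow> 'a) set)" and pos: "0 < f t"
  then obtain p where p: "\<And>t. f t = poly p t"
    using pfuns_coord_poly by blast
  have "p \<noteq> 0"
    using pos p by auto
  then have Z: "finite {y. poly p y = 0}"
    by (rule poly_roots_finite)
  obtain l where l: "l < t" "{l<..<t} \<inter> {y. poly p y = 0} = {}"
    using finite_free_left[OF Z] by blast
  obtain u where u: "t < u" "{t<..<u} \<inter> {y. poly p y = 0} = {}"
    using finite_free_right[OF Z] by blast
  have "0 < f s" if "s \<in> {l<..<u}" for s
  proof -
    have "sgn (poly p t) = sgn (poly p s)"
    proof (rule rcf_sgn_eq_if_no_root)
      fix z assume "z \<in> segment t s"
      moreover have "segment t s \<subseteq> {l<..<u}"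
        by (rule segment_subset_open_interval) (use that l u in auto)
      ultimately have "z \<in> {l<..<u}"
        by blast
      then have "z \<in> {l<..<t} \<or> z = t \<or> z \<in> {t<..<u}"
        by auto
      then show "poly p z \<noteq> 0"
        using l(2) u(2) pos p by auto
    qed
    then show ?thesis
      using pos by (simp add: p sgn_if split: if_splits)
  qed
  then show "eventually (\<lambda>s. 0 < f s) (nhds t)"
    unfolding eventually_nhds using l(1) u(1) by (intro exI[of _ "{l<..<u}"]) auto
qed

text \<open>
  The set \<open>Z\<close> has at least \<open>m\<close> elements below \<open>u\<close>. Stated by iterated quantifiers, this is definable.
\<close>

fun at_least_below :: "('a::linorder) set \<Rightarrow> nat \<Rightarrow> 'a \<Rightarrow> bool" where
  "at_least_below Z 0 u = True"
| "at_least_below Z (Suc m) u = (\<exists>z. z < u \<and> z \<in> Z \<and> at_least_below Z m z)"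

lemma at_least_below_iff:
  assumes "finite Z"
  shows "at_least_below Z m u \<longleftrightarrow> m \<le> card {z \<in> Z. z < u}"
proof (induction m arbitrary: u)
  case 0
  then show ?case by simp
next
  case (Suc m)
  show ?case
  proof
    assume "at_least_below Z (Suc m) u"
    then obtain z where z: "z < u" "z \<in> Z" "m \<le> card {x \<in> Z. x < z}"
      using Suc by auto
    have "insert z {x \<in> Z. x < z} \<subseteq> {x \<in> Z. x < u}"
      using z by auto
    then have "card (insert z {x \<in> Z. x < z}) \<le> card {x \<in> Z. x < u}"
      using assms by (intro card_mono) auto
    then show "Suc m \<le> card {x \<in> Z. x < u}"
      using z(3) assms by simp
  next
    assume le: "Suc m \<le> card {x \<in> Z. x < u}"
    define z where "z = Max {x \<in> Z. x < u}"
    have fin: "finite {x \<in> Z. x < u}"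
      using assms by simp
    have "{x \<in> Z. x < u} \<noteq> {}"
      using le by (metis card.empty not_less_eq_eq zero_le)
    then have z: "z \<in> {x \<in> Z. x < u}"
      unfolding z_def by (rule Max_in[OF fin])
    have "{x \<in> Z. x < u} \<subseteq> insert z {x \<in> Z. x < z}"
      using Max_ge[OF fin] by (auto simp: z_def order.order_iff_strict)
    then have "card {x \<in> Z. x < u} \<le> card (insert z {x \<in> Z. x < z})"
      using assms by (intro card_mono) auto
    also have "\<dots> = Suc (card {x \<in> Z. x < z})"
      using assms by simp
    finally have "m \<le> card {x \<in> Z. x < z}"
      using le by simp
    then show "at_least_below Z (Suc m) u"
      using z Suc by auto
  qed
qed

lemma definable_at_least_below:
  fixes S :: "('e \<Rightarrow> 'a::real_closed_field) set"
  assumes Z: "definable (scalar_ext S) (\<lambda>p. snd p \<in> Z (fst p))"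
  shows "definable (scalar_ext S) (\<lambda>p. at_least_below (Z (fst p)) m (snd p))"
proof (induction m)
  case 0
  show ?case by (simp add: definable_const)
next
  case (Suc m)
  have "definable (scalar_ext S) (\<lambda>p. \<exists>z. z < snd p \<and> z \<in> Z (fst p) \<and> at_least_below (Z (fst p)) m z)"
    by (intro definable_Ex definable_conj definable_less definable_ext_subst[OF Z] definable_ext_subst[OF Suc]
        pfuns_ext_fst pfuns_ext_snd pfuns_base)
  then show ?case by simp
qed

text \<open>
  The map \<open>m\<close> is an increasing bijection between \<open>A\<close> and \<open>B\<close>, so that it preserves ranks.
\<close>

lemma perturbation_preserves_rank:
  fixes A B :: "'a::linordered_field set"
  assumes fin: "finite A" "finite B" and card: "card A = card B"
    and m: "\<And>z. z \<in> A \<Longrightarrow> m z \<in> B" and mono: "\<And>z w. z \<in> A \<Longrightarrow> w \<in> A \<Longrightarrow> z < w \<Longrightarrow> m z < m w"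
    and x: "x \<in> A" and y: "y \<in> B" and rank: "card {z \<in> A. z < x} = card {z \<in> B. z < y}"
  shows "m x = y"
proof -
  have inj: "inj_on m A"
    by (rule inj_onI) (metis mono neqE less_irrefl)
  then have img: "m ` A = B"
    using m fin card by (metis card_image card_subset_eq image_subsetI)
  obtain x' where x': "x' \<in> A" "y = m x'"
    using y img by auto
  have "{z \<in> B. z < y} = m ` {z \<in> A. z < x'}"
  proof -
    have "m z < m x' \<longleftrightarrow> z < x'" if "z \<in> A" for z
      using mono that x'(1) by (metis less_asym neqE)
    then show ?thesis
      unfolding img[symmetric] x'(2) by auto
  qed
  then have "card {z \<in> B. z < y} = card {z \<in> A. z < x'}"
    using inj by (simp add: card_image inj_on_subset[of m A])
  then have eq: "card {z \<in> A. z < x} = card {z \<in> A. z < x'}"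
    using rank by simp
  have less: "card {z \<in> A. z < u} < card {z \<in> A. z < v}" if "u < v" "u \<in> A" for u v
  proof (rule psubset_card_mono)
    show "finite {z \<in> A. z < v}"
      using fin(1) by simp
    have "u \<in> {z \<in> A. z < v} - {z \<in> A. z < u}" "{z \<in> A. z < u} \<subseteq> {z \<in> A. z < v}"
      using that by auto
    then show "{z \<in> A. z < u} \<subset> {z \<in> A. z < v}"
      by blast
  qed
  have "x = x'"
  proof (rule ccontr)
    assume "x \<noteq> x'"
    then have "x < x' \<or> x' < x"
      by auto
    then show False
      using less[OF _ x] less[OF _ x'(1)] eq by fastforce
  qed
  then show ?thesis
    using x'(2) by simp
qed

lemma ex_separation:
  fixes A :: "'a::linordered_field set"
  assumes "finite A"
  shows "\<exists>\<delta>>0. \<forall>z\<in>A. \<forall>w\<in>A. z < w \<longrightarrow> z + 2 * \<delta> \<le> w"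
proof -
  define D where "D = insert 1 ((\<lambda>(z, w). (w - z) / 2) ` {(z, w) \<in> A \<times> A. z < w})"
  have fin: "finite D"
    using assms finite_subset[of "{(z, w) \<in> A \<times> A. z < w}" "A \<times> A"] by (auto simp: D_def)
  have "Min D \<in> D"
    by (rule Min_in[OF fin]) (simp add: D_def)
  then have "0 < Min D"
    by (auto simp: D_def)
  moreover have "z + 2 * Min D \<le> w" if "z \<in> A" "w \<in> A" "z < w" for z w
  proof -
    have "Min D \<le> (w - z) / 2"
      by (rule Min_le[OF fin]) (use that in \<open>force simp: D_def\<close>)
    then show ?thesis
      by (simp add: field_simps)
  qed
  ultimately show ?thesis by blast
qed

text \<open>
  The value \<open>c t\<close> is one of the critical values of the graph at \<open>t\<close>. Near \<open>0\<close>, the number of critical values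
  and the rank of \<open>c t\<close> among them do not change, as definable predicates in one variable are eventually
  constant. By lower semicontinuity there is a critical value at \<open>s\<close> close to each one at \<open>t\<close>; as their
  numbers agree, there are no others, and the one of the given rank is close to \<open>c t\<close>.
\<close>

theorem definable_eventually_continuous:
  fixes c :: "'a::{real_closed_field,linorder_topology} \<Rightarrow> 'a"
  assumes c: "definable (scalar_ext coord) (\<lambda>p. snd p = c (fst p))"
  shows "\<exists>\<epsilon>>0. \<forall>t. 0 < t \<and> t < \<epsilon> \<longrightarrow> (c \<longlongrightarrow> c t) (nhds t)"
proof -
  obtain K Z where "critical coord (\<lambda>t y. snd (t, y) = c (fst (t, y))) K Z"
    using ex_critical[OF c] by blast
  then have cr: "critical coord (\<lambda>t y. y = c t) K Z"
    by simp
  note Z = criticalD[OF cr]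
  have cZ: "c t \<in> Z t" for t
  proof (rule ccontr)
    assume no: "c t \<notin> Z t"
    obtain u where u: "c t < u" "{c t<..<u} \<inter> Z t = {}"
      using finite_free_right[OF Z(2)] by blast
    obtain v where v: "c t < v" "v < u"
      using dense[OF u(1)] by blast
    have "segment (c t) v \<inter> Z t = {}"
    proof -
      have "x \<notin> Z t" if "x \<in> segment (c t) v" for x
      proof (cases "x = c t")
        case False
        then have "x \<in> {c t<..<u}"
          using that v by auto
        then show ?thesis
          using u(2) by blast
      qed (use no in simp)
      then show ?thesis by blast
    qed
    then have "v = c t"
      using Z(4) by blast
    then show False
      using v by simp
  qed
  note below = at_least_below_iff[OF Z(2)]
  have D: "definable coord (\<lambda>t. at_least_below (Z t) m (c t))" "definable coord (\<lambda>t. \<exists>u. at_least_below (Z t) m u)" for m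
  proof -
    have "definable coord (\<lambda>t. \<exists>u. u = c t \<and> at_least_below (Z t) m u)"
      by (intro definable_Ex definable_conj c definable_at_least_below Z(1))
    then show "definable coord (\<lambda>t. at_least_below (Z t) m (c t))"
      by simp
    show "definable coord (\<lambda>t. \<exists>u. at_least_below (Z t) m u)"
      by (intro definable_Ex definable_at_least_below Z(1))
  qed
  have "\<exists>\<epsilon>>0. \<forall>m\<in>{..K}. \<forall>s t. 0 < s \<and> s < \<epsilon> \<and> 0 < t \<and> t < \<epsilon> \<longrightarrow>
      at_least_below (Z s) m (c s) = at_least_below (Z t) m (c t) \<and>
      (\<exists>u. at_least_below (Z s) m u) = (\<exists>u. at_least_below (Z t) m u)" (is "\<exists>\<epsilon>>0. \<forall>m\<in>_. ?Q m \<epsilon>")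
  proof -
    have ex: "\<exists>\<epsilon>>0. ?Q m \<epsilon>" for m
    proof -
      obtain \<epsilon>1 where "\<epsilon>1 > 0" "\<forall>s t. 0 < s \<and> s < \<epsilon>1 \<and> 0 < t \<and> t < \<epsilon>1 \<longrightarrow>
          at_least_below (Z s) m (c s) = at_least_below (Z t) m (c t)"
        using eventually_const_at_right_0[OF D(1)] by blast
      moreover obtain \<epsilon>2 where "\<epsilon>2 > 0" "\<forall>s t. 0 < s \<and> s < \<epsilon>2 \<and> 0 < t \<and> t < \<epsilon>2 \<longrightarrow>
          (\<exists>u. at_least_below (Z s) m u) = (\<exists>u. at_least_below (Z t) m u)"
        using eventually_const_at_right_0[OF D(2)] by blast
      ultimately show ?thesis
        by (intro exI[of _ "min \<epsilon>1 \<epsilon>2"]) simp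
    qed
    have "\<exists>\<epsilon>>0. \<forall>m\<in>M. ?Q m \<epsilon>" if "finite M" for M
      using that
    proof (induction M)
      case empty
      show ?case by (intro exI[of _ 1]) simp
    next
      case (insert m M)
      then obtain \<epsilon>1 where 1: "\<epsilon>1 > 0" "\<forall>m\<in>M. ?Q m \<epsilon>1" by blast
      obtain \<epsilon>2 where 2: "\<epsilon>2 > 0" "?Q m \<epsilon>2" using ex by blast
      show ?case
        by (rule exI[of _ "min \<epsilon>1 \<epsilon>2"]) (use 1 2 in simp)
    qed
    then show ?thesis by blast
  qed
  then obtain \<epsilon> where \<epsilon>: "\<epsilon> > 0" and const: "\<And>m s t. m \<le> K \<Longrightarrow> 0 < s \<Longrightarrow> s < \<epsilon> \<Longrightarrow> 0 < t \<Longrightarrow> t < \<epsilon> \<Longrightarrow>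
      at_least_below (Z s) m (c s) = at_least_below (Z t) m (c t) \<and>
      (\<exists>u. at_least_below (Z s) m u) = (\<exists>u. at_least_below (Z t) m u)"
    by (metis atMost_iff)
  have le_card: "card {z \<in> Z t. z < u} \<le> card (Z t)" for t u
    by (rule card_mono[OF Z(2)]) auto
  have total: "(\<exists>u. at_least_below (Z t) m u) \<longleftrightarrow> m \<le> card (Z t)" for t m
  proof
    assume "\<exists>u. at_least_below (Z t) m u"
    then show "m \<le> card (Z t)"
      using le_card below le_trans by blast
  next
    assume m: "m \<le> card (Z t)"
    obtain u where "\<And>z. z \<in> Z t \<Longrightarrow> z < u"
    proof (cases "Z t = {}")
      case False
      have "z < Max (Z t) + 1" if "z \<in> Z t" for z
        using Max_ge[OF Z(2) that] by (simp add: le_less_trans less_add_one)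
      then show ?thesis using that by blast
    qed (use that in auto)
    then have "{z \<in> Z t. z < u} = Z t"
      by auto
    then show "\<exists>u. at_least_below (Z t) m u"
      using m below[of t m u] by auto
  qed
  have rank: "card {z \<in> Z s. z < c s} \<le> card {z \<in> Z t. z < c t}" and N: "card (Z s) \<le> card (Z t)"
    if "0 < s" "s < \<epsilon>" "0 < t" "t < \<epsilon>" for s t
  proof -
    have "card {z \<in> Z s. z < c s} \<le> K"
      using le_card Z(3) le_trans by blast
    from const[OF this that] show "card {z \<in> Z s. z < c s} \<le> card {z \<in> Z t. z < c t}"
      by (simp add: below)
    from const[OF Z(3)[of s] that] show "card (Z s) \<le> card (Z t)"
      by (simp add: total)
  qed
  have "(c \<longlongrightarrow> c t) (nhds t)" if t: "0 < t" "t < \<epsilon>" for t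
  proof -
    obtain \<delta>0 where \<delta>0: "\<delta>0 > 0" "\<And>z w. z \<in> Z t \<Longrightarrow> w \<in> Z t \<Longrightarrow> z < w \<Longrightarrow> z + 2 * \<delta>0 \<le> w"
      using ex_separation[OF Z(2)] by blast
    have close: "eventually (\<lambda>s. \<bar>c s - c t\<bar> < \<delta>) (nhds t)" if \<delta>: "0 < \<delta>" for \<delta>
    proof -
      define \<eta> where "\<eta> = min \<delta> \<delta>0"
      have \<eta>: "0 < \<eta>" "\<eta> \<le> \<delta>" "\<eta> \<le> \<delta>0"
        using \<delta> \<delta>0(1) by (auto simp: \<eta>_def)
      have "eventually (\<lambda>s. \<forall>z\<in>Z t. \<exists>z'\<in>Z s. \<bar>z' - z\<bar> < \<eta>) (nhds t)"
        by (intro eventually_ball_finite Z(2) ballI Z(5)[OF _ \<eta>(1) tends_to_nhds])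
      moreover have "eventually (\<lambda>s. s \<in> {0<..<\<epsilon>}) (nhds t)"
        by (rule eventually_nhds_in_open) (use t in auto)
      ultimately show ?thesis
      proof eventually_elim
        case (elim s)
        then obtain m where m: "\<And>z. z \<in> Z t \<Longrightarrow> m z \<in> Z s" "\<And>z. z \<in> Z t \<Longrightarrow> \<bar>m z - z\<bar> < \<eta>"
          by metis
        have s: "0 < s" "s < \<epsilon>"
          using elim by auto
        have "m (c t) = c s"
        proof (rule perturbation_preserves_rank[OF Z(2) Z(2) _ m(1) _ cZ cZ])
          show "card (Z t) = card (Z s)"
            using N[OF s t] N[OF t s] by simp
          show "card {z \<in> Z t. z < c t} = card {z \<in> Z s. z < c s}"
            using rank[OF s t] rank[OF t s] by simp
          fix z w assume zw: "z \<in> Z t" "w \<in> Z t" "z < w"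
          have "m z < z + \<eta>" "w - \<eta> < m w"
            using m(2)[OF zw(1)] m(2)[OF zw(2)] by (auto simp: abs_less_iff)
          moreover have "z + \<eta> \<le> w - \<eta>"
            using \<delta>0(2)[OF zw] \<eta>(3) by simp
          ultimately show "m z < m w"
            by (meson less_le_trans less_trans)
        qed
        then show "\<bar>c s - c t\<bar> < \<delta>"
          using m(2)[OF cZ[of t]] \<eta>(2) by (simp add: less_le_trans)
      qed
    qed
    show ?thesis
    proof (rule order_tendstoI)
      fix a assume "a < c t"
      then have "eventually (\<lambda>s. \<bar>c s - c t\<bar> < c t - a) (nhds t)"
        by (intro close) simp
      then show "eventually (\<lambda>s. a < c s) (nhds t)"
        by (rule eventually_mono) (auto simp: abs_less_iff)
    next
      fix a assume "c t < a"
      then have "eventually (\<lambda>s. \<bar>c s - c t\<bar> < a - c t) (nhds t)"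
        by (intro close) simp
      then show "eventually (\<lambda>s. c s < a) (nhds t)"
        by (rule eventually_mono) (auto simp: abs_less_iff)
    qed
  qed
  with \<epsilon> show ?thesis by blast
qed

section \<open>Hilbert's basis theorem\<close>

definition subring_set :: "'r::comm_ring_1 set \<Rightarrow> bool" where
  "subring_set A \<longleftrightarrow> 1 \<in> A \<and> (\<forall>x\<in>A. \<forall>y\<in>A. x + y \<in> A \<and> x * y \<in> A) \<and> (\<forall>x\<in>A. - x \<in> A)"

lemma subring_setD:
  assumes "subring_set A"
  shows "1 \<in> A" "0 \<in> A" "x \<in> A \<Longrightarrow> y \<in> A \<Longrightarrow> x + y \<in> A" "x \<in> A \<Longrightarrow> y \<in> A \<Longrightarrow> x * y \<in> A"
    "x \<in> A \<Longrightarrow> - x \<in> A" "x \<in> A \<Longrightarrow> x ^ n \<in> A"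
proof -
  show *: "1 \<in> A" "x \<in> A \<Longrightarrow> y \<in> A \<Longrightarrow> x + y \<in> A" "x \<in> A \<Longrightarrow> y \<in> A \<Longrightarrow> x * y \<in> A" "x \<in> A \<Longrightarrow> - x \<in> A" for x y
    using assms by (auto simp: subring_set_def)
  have "1 + - 1 \<in> A"
    by (intro * )
  then show "0 \<in> A" by simp
  show "x \<in> A \<Longrightarrow> x ^ n \<in> A"
    by (induction n) (auto intro: *)
qed

lemma subring_set_sum: "subring_set A \<Longrightarrow> (\<And>i. i \<in> I \<Longrightarrow> f i \<in> A) \<Longrightarrow> sum f I \<in> A"
  by (induction I rule: infinite_finite_induct) (auto intro: subring_setD)

text \<open>
  The ideal of \<open>A\<close> generated by \<open>S\<close>, for a subring \<open>A\<close> of the ambient ring.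
\<close>

inductive_set ideal_span :: "'r::comm_ring_1 set \<Rightarrow> 'r set \<Rightarrow> 'r set" for A S where
  ideal_span_zero: "0 \<in> ideal_span A S"
| ideal_span_step: "a \<in> A \<Longrightarrow> s \<in> S \<Longrightarrow> x \<in> ideal_span A S \<Longrightarrow> a * s + x \<in> ideal_span A S"

lemma ideal_span_add: "x \<in> ideal_span A S \<Longrightarrow> y \<in> ideal_span A S \<Longrightarrow> x + y \<in> ideal_span A S"
  by (induction rule: ideal_span.induct) (auto simp: add.assoc intro: ideal_span.intros)

lemma ideal_span_mult:
  assumes "subring_set A" "b \<in> A"
  shows "x \<in> ideal_span A S \<Longrightarrow> b * x \<in> ideal_span A S"
proof (induction rule: ideal_span.induct)
  case (ideal_span_step a s x)
  have "(b * a) * s + b * x \<in> ideal_span A S"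
    using ideal_span_step subring_setD(4)[OF assms(1,2)] by (intro ideal_span.intros) auto
  then show ?case
    by (simp add: algebra_simps)
qed (auto intro: ideal_span.intros)

lemma ideal_span_base: "subring_set A \<Longrightarrow> s \<in> S \<Longrightarrow> s \<in> ideal_span A S"
  using ideal_span_step[of 1 A s S 0] by (auto intro: ideal_span_zero subring_setD)

lemma ideal_span_subset:
  assumes "subring_set A" "S \<subseteq> ideal_span A T"
  shows "ideal_span A S \<subseteq> ideal_span A T"
proof
  fix x assume "x \<in> ideal_span A S"
  then show "x \<in> ideal_span A T"
    by induction (use assms in \<open>auto intro: ideal_span_zero ideal_span_add ideal_span_mult\<close>)
qed

lemma ideal_span_finite_part:
  assumes A: "subring_set A" and x: "x \<in> ideal_span A S"
  shows "\<exists>T\<subseteq>S. finite T \<and> x \<in> ideal_span A T"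
  using x
proof induction
  case ideal_span_zero
  show ?case by (intro exI[of _ "{}"]) (auto intro: ideal_span.intros)
next
  case (ideal_span_step a s x)
  then obtain T where T: "T \<subseteq> S" "finite T" "x \<in> ideal_span A T" by blast
  have "ideal_span A T \<subseteq> ideal_span A (insert s T)"
    by (rule ideal_span_subset[OF A]) (auto intro: ideal_span_base[OF A])
  then have "a * s + x \<in> ideal_span A (insert s T)"
    using ideal_span_step.hyps(1) T(3) by (intro ideal_span.ideal_span_step) auto
  then show ?case
    using T ideal_span_step.hyps(2) by (intro exI[of _ "insert s T"]) auto
qed

lemma ideal_span_finite_part_set:
  assumes A: "subring_set A" and G: "finite G" "G \<subseteq> ideal_span A S"
  shows "\<exists>T\<subseteq>S. finite T \<and> G \<subseteq> ideal_span A T"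
  using G
proof (induction G)
  case empty
  show ?case by (intro exI[of _ "{}"]) auto
next
  case (insert g G)
  then obtain T where T: "T \<subseteq> S" "finite T" "G \<subseteq> ideal_span A T" by auto
  obtain U where U: "U \<subseteq> S" "finite U" "g \<in> ideal_span A U"
    using ideal_span_finite_part[OF A] insert.prems by blast
  have "ideal_span A T \<subseteq> ideal_span A (T \<union> U)" "ideal_span A U \<subseteq> ideal_span A (T \<union> U)"
    by (rule ideal_span_subset[OF A], simp add: subset_iff ideal_span_base[OF A])+
  then show ?case
    using T U by (intro exI[of _ "T \<union> U"]) auto
qed

definition noetherian :: "'r::comm_ring_1 set \<Rightarrow> bool" where
  "noetherian A \<longleftrightarrow> (\<forall>S\<subseteq>A. \<exists>T\<subseteq>S. finite T \<and> S \<subseteq> ideal_span A T)"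

lemma noetherianD: "noetherian A \<Longrightarrow> S \<subseteq> A \<Longrightarrow> \<exists>T. T \<subseteq> S \<and> finite T \<and> S \<subseteq> ideal_span A T"
  by (simp add: noetherian_def)

definition coeffs_in :: "'r::comm_ring_1 set \<Rightarrow> 'r poly \<Rightarrow> bool" where
  "coeffs_in A P \<longleftrightarrow> (\<forall>k. poly.coeff P k \<in> A)"

definition adjoin :: "'r::comm_ring_1 set \<Rightarrow> 'r \<Rightarrow> 'r set" where
  "adjoin A v = {poly P v |P. coeffs_in A P}"

lemma coeffs_in_intros:
  assumes A: "subring_set A"
  shows "coeffs_in A 0" "coeffs_in A 1" "coeffs_in A P \<Longrightarrow> coeffs_in A Q \<Longrightarrow> coeffs_in A (P + Q)"
    "coeffs_in A P \<Longrightarrow> coeffs_in A Q \<Longrightarrow> coeffs_in A (P - Q)"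
    "coeffs_in A P \<Longrightarrow> coeffs_in A (- P)" "coeffs_in A P \<Longrightarrow> coeffs_in A Q \<Longrightarrow> coeffs_in A (P * Q)" "a \<in> A \<Longrightarrow> coeffs_in A (monom a n)"
proof -
  note D = subring_setD[OF A]
  show "coeffs_in A 0" "coeffs_in A P \<Longrightarrow> coeffs_in A Q \<Longrightarrow> coeffs_in A (P + Q)" "coeffs_in A P \<Longrightarrow> coeffs_in A (- P)"
    "a \<in> A \<Longrightarrow> coeffs_in A (monom a n)"
    using D by (auto simp: coeffs_in_def)
  show "coeffs_in A 1"
    using D by (auto simp: coeffs_in_def)
  show "coeffs_in A P \<Longrightarrow> coeffs_in A Q \<Longrightarrow> coeffs_in A (P - Q)"
    using D(3)[OF _ D(5)] by (auto simp: coeffs_in_def)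
  show "coeffs_in A P \<Longrightarrow> coeffs_in A Q \<Longrightarrow> coeffs_in A (P * Q)"
    using D by (auto simp: coeffs_in_def coeff_mult intro!: subring_set_sum[OF A])
qed

lemma adjoinI: "coeffs_in A P \<Longrightarrow> poly P v \<in> adjoin A v"
  by (auto simp: adjoin_def)

lemma subring_set_adjoin:
  assumes A: "subring_set A"
  shows "subring_set (adjoin A v)" "A \<subseteq> adjoin A v" "v \<in> adjoin A v"
proof -
  note O = coeffs_in_intros[OF A]
  show "subring_set (adjoin A v)"
    unfolding subring_set_def
  proof (intro conjI ballI)
    show "1 \<in> adjoin A v"
      using adjoinI[OF O(2)] by simp
    fix x y assume "x \<in> adjoin A v" "y \<in> adjoin A v"
    then obtain P Q where "coeffs_in A P" "x = poly P v" "coeffs_in A Q" "y = poly Q v"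
      by (auto simp: adjoin_def)
    then show "x + y \<in> adjoin A v" "x * y \<in> adjoin A v"
      using adjoinI[OF O(3)] adjoinI[OF O(6)] by (metis poly_add, metis poly_mult)
  next
    fix x assume "x \<in> adjoin A v"
    then obtain P where "coeffs_in A P" "x = poly P v"
      by (auto simp: adjoin_def)
    then show "- x \<in> adjoin A v"
      using adjoinI[OF O(5)] by (metis poly_minus)
  qed
  show "A \<subseteq> adjoin A v"
    using adjoinI[OF O(7), of _ 0] by (fastforce simp: poly_monom)
  show "v \<in> adjoin A v"
    using adjoinI[OF O(7)[OF subring_setD(1)[OF A], of 1], of v] by (simp add: poly_monom)
qed

text \<open>
  This is Hilbert's basis theorem. For an ideal \<open>I\<close>, the set \<open>L k\<close> contains the coefficients of degree \<open>k\<close> of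
  the polynomials of degree at most \<open>k\<close> with value in \<open>I\<close>. These ideals of \<open>A\<close> increase with \<open>k\<close>, and finitely
  many generators of their union lie in some \<open>L d\<close>. Polynomials for the generators of \<open>L 0\<close>, ..., \<open>L (d - 1)\<close>
  and of the union suffice to cancel the top coefficient of any polynomial with value in \<open>I\<close>.
\<close>

theorem noetherian_adjoin:
  assumes A: "subring_set A" and noeth: "noetherian A"
  shows "noetherian (adjoin A v)"
  unfolding noetherian_def
proof (intro allI impI)
  fix S assume S: "S \<subseteq> adjoin A v"
  let ?B = "adjoin A v"
  note B = subring_set_adjoin[OF A, of v]
  note O = coeffs_in_intros[OF A]
  define I where "I = ideal_span ?B S"
  have I_add: "x + y \<in> I" if "x \<in> I" "y \<in> I" for x y
    using that by (simp add: I_def ideal_span_add)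
  have I_mult: "b * x \<in> I" if "b \<in> ?B" "x \<in> I" for b x
    using that by (simp add: I_def ideal_span_mult[OF B(1)])
  define good where "good k P \<longleftrightarrow> coeffs_in A P \<and> degree P \<le> k \<and> poly P v \<in> I" for k P
  define L where "L k = {poly.coeff P k |P. good k P}" for k
  have LA: "L k \<subseteq> A" for k
    by (auto simp: L_def good_def coeffs_in_def)
  have shift: "good (k + j) (monom 1 j * P)" if "good k P" for k j P
  proof -
    have "poly (monom 1 j * P) v = v ^ j * poly P v"
      by (simp add: poly_monom)
    moreover have "v ^ j \<in> ?B"
      by (intro subring_setD(6)[OF B(1)] B(3))
    moreover have "degree (monom 1 j * P) \<le> j + k"
      using that by (intro order_trans[OF degree_mult_le] add_mono) (auto simp: good_def degree_monom_le)
    ultimately show ?thesis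
      using that I_mult O(6)[OF O(7)[OF subring_setD(1)[OF A], of j]] by (auto simp: good_def add.commute)
  qed
  have Lmono: "L k \<subseteq> L (k + j)" for k j
  proof
    fix c assume "c \<in> L k"
    then obtain P where P: "good k P" "c = poly.coeff P k"
      by (auto simp: L_def)
    have "poly.coeff (monom 1 j * P) (k + j) = c"
      by (simp add: coeff_monom_mult P(2))
    then show "c \<in> L (k + j)"
      unfolding L_def using shift[OF P(1), of j] by blast
  qed
  have "(\<Union>k. L k) \<subseteq> A"
    using LA by blast
  then obtain T' where T': "T' \<subseteq> (\<Union>k. L k)" "finite T'" "(\<Union>k. L k) \<subseteq> ideal_span A T'"
    using noetherianD[OF noeth] that by meson
  have "\<exists>d. T' \<subseteq> L d"
    using T'(2,1)
  proof (induction T')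
    case (insert t T)
    then obtain d k where "T \<subseteq> L d" "t \<in> L k"
      by auto
    then have "insert t T \<subseteq> L (d + k)"
      using Lmono[of d k] Lmono[of k d] by (auto simp: add.commute)
    then show ?case by blast
  qed simp
  then obtain d where d: "T' \<subseteq> L d" by blast
  have "\<exists>T\<subseteq>L k. finite T \<and> L k \<subseteq> ideal_span A T" for k
    by (rule noetherianD[OF noeth LA])
  then obtain T0 where T0: "\<And>k. T0 k \<subseteq> L k" "\<And>k. finite (T0 k)" "\<And>k. L k \<subseteq> ideal_span A (T0 k)"
    by metis
  define T where "T k = (if k < d then T0 k else T')" for k
  have T: "T k \<subseteq> L k" "finite (T k)" "L k \<subseteq> ideal_span A (T k)" if "k \<le> d" for k
  proof -
    have "L d \<subseteq> ideal_span A T'"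
      using T'(3) by blast
    then show "T k \<subseteq> L k" "finite (T k)" "L k \<subseteq> ideal_span A (T k)"
      using T0 T'(2) d that by (cases "k = d"; simp add: T_def)+
  qed
  have LT: "L n \<subseteq> ideal_span A (T (min n d))" for n
    using T0(3)[of n] T'(3) by (auto simp: T_def)
  define W where "W k t = (SOME P. good k P \<and> poly.coeff P k = t)" for k t
  have W: "good k (W k t)" "poly.coeff (W k t) k = t" if "t \<in> T k" "k \<le> d" for k t
  proof -
    have "\<exists>P. good k P \<and> poly.coeff P k = t"
      using T(1)[OF that(2)] that(1) by (auto simp: L_def)
    then have "good k (W k t) \<and> poly.coeff (W k t) k = t"
      unfolding W_def by (rule someI_ex)
    then show "good k (W k t)" "poly.coeff (W k t) k = t"
      by auto
  qed
  define G where "G = (\<Union>k\<le>d. (\<lambda>t. poly (W k t) v) ` T k)"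
  have G: "finite G" "G \<subseteq> I"
    using T(2) W(1) by (auto simp: G_def good_def)
  have lift: "\<exists>Q. good n Q \<and> poly.coeff Q n = c \<and> poly Q v \<in> ideal_span ?B G"
    if "c \<in> ideal_span A (T (min n d))" for c n
    using that
  proof induction
    case ideal_span_zero
    show ?case
      by (intro exI[of _ 0]) (auto simp: good_def O I_def intro: ideal_span.intros)
  next
    case (ideal_span_step a t x)
    define k where "k = min n d"
    have k: "k \<le> d" "k + (n - k) = n" "t \<in> T k"
      using ideal_span_step.hyps by (auto simp: k_def)
    obtain Q where Q: "good n Q" "poly.coeff Q n = x" "poly Q v \<in> ideal_span ?B G"
      using ideal_span_step.IH by blast
    define R where "R = monom a 0 * (monom 1 (n - k) * W k t)"
    have W': "good n (monom 1 (n - k) * W k t)"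
      using shift[OF W(1)[OF k(3,1)], of "n - k"] k(2) by simp
    have aB: "a \<in> ?B"
      using B(2) ideal_span_step.hyps(1) by blast
    have polyR: "poly R v = (a * v ^ (n - k)) * poly (W k t) v"
      by (simp add: R_def poly_monom algebra_simps)
    have Rn: "good n R"
    proof -
      have "poly R v = a * poly (monom 1 (n - k) * W k t) v"
        by (simp add: R_def poly_monom)
      moreover have "degree R \<le> n"
        using W' unfolding R_def by (intro order_trans[OF degree_mult_le]) (simp add: good_def monom_0)
      moreover have "coeffs_in A R"
        using W' O(6)[OF O(7)[OF ideal_span_step.hyps(1), of 0]] by (simp add: R_def good_def)
      ultimately show ?thesis
        using W' I_mult[OF aB] by (simp add: good_def)
    qed
    have "a * v ^ (n - k) \<in> ?B"
      by (intro subring_setD(4,6)[OF B(1)] aB B(3))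
    moreover have "poly (W k t) v \<in> G"
      using k by (auto simp: G_def)
    ultimately have "poly R v + poly Q v \<in> ideal_span ?B G"
      unfolding polyR by (rule ideal_span.ideal_span_step[OF _ _ Q(3)])
    moreover have "good n (R + Q)"
      using Rn Q(1) I_add O(3) by (auto simp: good_def intro: degree_add_le)
    moreover have "poly.coeff (R + Q) n = a * t + x"
      using W(2)[OF k(3,1)] Q(2) k(2) by (simp add: R_def monom_0 coeff_monom_mult)
    ultimately show ?case
      by (intro exI[of _ "R + Q"]) auto
  qed
  have uminus_span: "- x \<in> I" if "x \<in> I" for x
    using I_mult[of "- 1" x] that subring_setD(1,5)[OF B(1)] by simp
  (* induction on the degree bound, cancelling the top coefficient *)
  have red: "poly P v \<in> ideal_span ?B G" if "good n P" for n P
    using that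
  proof (induction n arbitrary: P rule: less_induct)
    case (less n)
    have "poly.coeff P n \<in> L n"
      using less.prems by (auto simp: L_def)
    then obtain Q where Q: "good n Q" "poly.coeff Q n = poly.coeff P n" "poly Q v \<in> ideal_span ?B G"
      using lift LT by blast
    have PQ: "good n (P - Q)"
      using less.prems Q(1) O(4) I_add[OF _ uminus_span] by (auto simp: good_def intro: degree_diff_le)
    have "poly (P - Q) v \<in> ideal_span ?B G"
    proof (cases n)
      case 0
      then have "P - Q = 0"
        using PQ Q(2) by (metis coeff_diff diff_self good_def le_zero_eq leading_coeff_0_iff)
      then show ?thesis
        by (simp only: poly_0 ideal_span_zero)
    next
      case (Suc m)
      have "degree (P - Q) \<le> m"
      proof (rule degree_le, intro allI impI)
        fix i assume "m < i"
        then consider "i = n" | "n < i"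
          using Suc by linarith
        then show "poly.coeff (P - Q) i = 0"
          using Q(2) PQ by cases (auto simp: good_def intro!: coeff_eq_0[of "P - Q", simplified])
      qed
      then have "good m (P - Q)"
        using PQ by (simp add: good_def)
      then show ?thesis
        by (rule less.IH[rotated]) (simp add: Suc)
    qed
    from ideal_span_add[OF this Q(3)] show ?case
      by simp
  qed
  have SG: "S \<subseteq> ideal_span ?B G"
  proof
    fix s assume s: "s \<in> S"
    then obtain P where P: "coeffs_in A P" "s = poly P v"
      using S by (auto simp: adjoin_def)
    have "s \<in> I"
      using s by (simp add: I_def ideal_span_base[OF B(1)])
    then show "s \<in> ideal_span ?B G"
      using red[of "degree P" P] P by (simp add: good_def)
  qed
  have GS: "G \<subseteq> ideal_span ?B S"
    using G(2) by (simp add: I_def)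
  obtain T where T: "T \<subseteq> S" "finite T" "G \<subseteq> ideal_span ?B T"
    using GS ideal_span_finite_part_set[OF B(1) G(1)] by meson
  then have "ideal_span ?B G \<subseteq> ideal_span ?B T"
    by (intro ideal_span_subset[OF B(1)])
  with SG have "S \<subseteq> ideal_span ?B T"
    by (rule order_trans)
  with T(1,2) show "\<exists>T\<subseteq>S. finite T \<and> S \<subseteq> ideal_span ?B T"
    by blast
qed

lemma single_power_variable:
  "Poly_Mapping.single (Poly_Mapping.single i k) (1 :: 'a::comm_ring_1) =
     Poly_Mapping.single (Poly_Mapping.single i 1) 1 ^ k" for i :: 'i and k :: nat
proof (induction k)
  case (Suc k)
  have "Poly_Mapping.single i (Suc k) = Poly_Mapping.single i 1 + Poly_Mapping.single i k"
    by (simp flip: single_add)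
  then show ?case
    by (simp add: mult_single del: One_nat_def flip: Suc)
qed simp

text \<open>
  The variables are adjoined to the field of constants one by one.
\<close>

theorem noetherian_mpoly: "noetherian (UNIV :: ('a::field, 'i::finite) mpoly set)"
proof -
  have "\<exists>A :: ('a, 'i) mpoly set. subring_set A \<and> noetherian A \<and> range (Poly_Mapping.single 0) \<subseteq> A \<and>
      (\<forall>i\<in>I. Poly_Mapping.single (Poly_Mapping.single i 1) 1 \<in> A)" if "finite I" for I :: "'i set"
    using that
  proof (induction I)
    case empty
    define A :: "('a, 'i) mpoly set" where "A = range (Poly_Mapping.single 0)"
    have "subring_set A"
      unfolding subring_set_def A_def
      by (auto simp: mult_single simp flip: single_add single_uminus intro!: range_eqI[of _ _ 1])
    moreover have "noetherian A"
      unfolding noetherian_def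
    proof (intro allI impI)
      fix S assume S: "S \<subseteq> A"
      show "\<exists>T\<subseteq>S. finite T \<and> S \<subseteq> ideal_span A T"
      proof (cases "S \<subseteq> {0}")
        case True
        then show ?thesis
          by (intro exI[of _ "{}"]) (auto intro: ideal_span_zero)
      next
        case False
        then obtain s where s: "s \<in> S" "s \<noteq> 0"
          by blast
        then obtain c where c: "s = Poly_Mapping.single 0 c"
          using S by (auto simp: A_def)
        have "x \<in> ideal_span A {s}" if x: "x \<in> S" for x
        proof -
          obtain b where b: "x = Poly_Mapping.single 0 b"
            using x S by (auto simp: A_def)
          have "c \<noteq> 0"
            using s(2) c by auto
          then have "x = Poly_Mapping.single 0 (b / c) * s + 0"
            by (simp add: b c mult_single)
          moreover have "Poly_Mapping.single 0 (b / c) \<in> A"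
            by (simp add: A_def)
          ultimately show ?thesis
            by (metis ideal_span.intros insertI1)
        qed
        then show ?thesis
          using s(1) by (intro exI[of _ "{s}"]) auto
      qed
    qed
    ultimately show ?case
      by (intro exI[of _ A]) (auto simp: A_def)
  next
    case (insert i I)
    then obtain A :: "('a, 'i) mpoly set" where A: "subring_set A" "noetherian A" "range (Poly_Mapping.single 0) \<subseteq> A"
      "\<forall>i\<in>I. Poly_Mapping.single (Poly_Mapping.single i 1) 1 \<in> A"
      by blast
    let ?B = "adjoin A (Poly_Mapping.single (Poly_Mapping.single i 1) 1)"
    have "subring_set ?B \<and> noetherian ?B \<and> range (Poly_Mapping.single 0) \<subseteq> ?B \<and>
        (\<forall>i\<in>insert i I. Poly_Mapping.single (Poly_Mapping.single i 1) 1 \<in> ?B)"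
      using subring_set_adjoin[OF A(1)] noetherian_adjoin[OF A(1,2)] A(3,4) by blast
    then show ?case by blast
  qed
  from this[OF finite[of UNIV]] obtain A :: "('a, 'i) mpoly set" where
    A: "subring_set A" "noetherian A" "range (Poly_Mapping.single 0) \<subseteq> A"
      "\<And>i. Poly_Mapping.single (Poly_Mapping.single i 1) 1 \<in> A"
    by blast
  have mon: "Poly_Mapping.single m c \<in> A" for m c
  proof -
    have "Poly_Mapping.single (\<Sum>i\<in>J. Poly_Mapping.single i (Poly_Mapping.lookup m i)) c \<in> A" if "finite J" for J
      using that
    proof (induction J)
      case empty
      then show ?case using A(3) by auto
    next
      case (insert i J)
      have "Poly_Mapping.single (\<Sum>i\<in>insert i J. Poly_Mapping.single i (Poly_Mapping.lookup m i)) c =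
          Poly_Mapping.single (Poly_Mapping.single i (Poly_Mapping.lookup m i)) 1 *
          Poly_Mapping.single (\<Sum>i\<in>J. Poly_Mapping.single i (Poly_Mapping.lookup m i)) c"
        using insert.hyps by (simp add: mult_single)
      also have "\<dots> \<in> A"
        by (intro subring_setD(4)[OF A(1)] insert.IH, subst single_power_variable)
          (intro subring_setD(6)[OF A(1)] A(4))
      finally show ?case .
    qed
    from this[OF finite[of UNIV]]
    have "Poly_Mapping.single (\<Sum>i\<in>UNIV. Poly_Mapping.single i (Poly_Mapping.lookup m i)) c \<in> A" .
    moreover have "(\<Sum>i\<in>UNIV. Poly_Mapping.single i (Poly_Mapping.lookup m i)) = m"
      by (rule poly_mapping_eqI) (simp add: lookup_sum lookup_single when_def)
    ultimately show ?thesis by simp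
  qed
  have "p \<in> A" for p
    using subring_set_sum[OF A(1) mon, of "\<lambda>m. m" "Poly_Mapping.lookup p" "Poly_Mapping.keys p"]
    by (simp add: sum_single_lookup)
  then have "A = UNIV"
    by blast
  then show ?thesis
    using A(2) by simp
qed

lemma mpoly_finite_basis:
  fixes B :: "('a::field, 'i::finite) mpoly set"
  shows "\<exists>T\<subseteq>B. finite T \<and> (\<forall>x. (\<forall>p\<in>T. mp_eval p x = 0) \<longrightarrow> (\<forall>p\<in>B. mp_eval p x = 0))"
proof -
  obtain T where T: "T \<subseteq> B" "finite T" "B \<subseteq> ideal_span UNIV T"
    using noetherian_mpoly unfolding noetherian_def by blast
  have "mp_eval p x = 0" if "\<forall>p\<in>T. mp_eval p x = 0" "p \<in> ideal_span UNIV T" for p x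
    using that(2) by induction (use that(1) in simp_all)
  then show ?thesis
    using T by blast
qed

section \<open>Rational functions on an irreducible variety\<close>

lemma mp_eval_diff [simp]: "mp_eval (p - q) x = mp_eval p x - mp_eval q x"
  using mp_eval_add[of p "- q" x] by simp

lemma irreducible_set_integral:
  fixes X :: "('a::idom ^ 'n::finite) set"
  assumes X: "algebraic_set X" "irreducible_set X" and z: "\<And>x. x \<in> X \<Longrightarrow> mp_eval A x * mp_eval B x = 0"
  shows "(\<forall>x\<in>X. mp_eval A x = 0) \<or> (\<forall>x\<in>X. mp_eval B x = 0)"
proof -
  have alg: "algebraic_set (X \<inter> zero_set {p})" for p
  proof -
    have "algebraic_set (\<Inter>{X, zero_set {p}})"
      by (rule algebraic_set_Inter) (use X(1) in \<open>auto simp: algebraic_set_def\<close>)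
    then show ?thesis by simp
  qed
  have "X = (X \<inter> zero_set {A}) \<union> (X \<inter> zero_set {B})"
    using z by (fastforce simp: zero_set_def)
  then have "X = X \<inter> zero_set {A} \<or> X = X \<inter> zero_set {B}"
    using X(2) alg unfolding irreducible_set_def by blast
  then show ?thesis
    by (auto simp: zero_set_def)
qed

text \<open>
  Irreducibility leaves no room for a proper closed subset that contains all points of \<open>X\<close> with \<open>Q \<noteq> 0\<close>:
  together with the zeros of \<open>Q\<close> it would cover \<open>X\<close>.
\<close>

lemma irreducible_set_dense:
  fixes X :: "('a::idom ^ 'n::finite) set"
  assumes X: "algebraic_set X" "irreducible_set X" and Q: "\<exists>x\<in>X. mp_eval Q x \<noteq> 0"
  defines "D \<equiv> {x \<in> X. mp_eval Q x \<noteq> 0}"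
  shows "openin (subtopology zariski X) D" "(subtopology zariski X) closure_of D = X"
proof -
  have "algebraic_set (zero_set {Q})"
    by (auto simp: algebraic_set_def)
  moreover have "- {x. mp_eval Q x \<noteq> 0} = zero_set {Q}"
    by (auto simp: zero_set_def)
  ultimately have "openin zariski {x. mp_eval Q x \<noteq> 0}"
    by (simp add: openin_zariski)
  then show "openin (subtopology zariski X) D"
    unfolding openin_subtopology D_def by blast
  have "{} = zero_set {1 :: ('a, 'n) mpoly}"
    by (auto simp: zero_set_def)
  then have "openin zariski (UNIV :: ('a ^ 'n) set)"
    by (auto simp: openin_zariski algebraic_set_def)
  then have top: "topspace (zariski :: ('a ^ 'n) topology) = UNIV"
    using openin_subset by blast
  define C where "C = (subtopology zariski X) closure_of D"
  have "closedin (subtopology zariski X) C"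
    by (simp add: C_def)
  then obtain F where F: "closedin zariski F" "C = F \<inter> X"
    by (auto simp: closedin_subtopology)
  have "algebraic_set F"
    using F(1) by (simp add: closedin_def top openin_zariski Compl_eq_Diff_UNIV[symmetric])
  then have "algebraic_set (\<Inter>{X, F})" "algebraic_set (\<Inter>{X, zero_set {Q}})"
    using X(1) by (intro algebraic_set_Inter; auto simp: algebraic_set_def)+
  then have alg: "algebraic_set (X \<inter> F)" "algebraic_set (X \<inter> zero_set {Q})"
    by simp_all
  have "D \<subseteq> C"
    unfolding C_def by (rule closure_of_subset) (auto simp: D_def top)
  then have "X = (X \<inter> F) \<union> (X \<inter> zero_set {Q})"
    using F(2) by (auto simp: D_def zero_set_def)
  then have "X = X \<inter> F \<or> X = X \<inter> zero_set {Q}"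
    using X(2) alg unfolding irreducible_set_def by blast
  moreover have "X \<noteq> X \<inter> zero_set {Q}"
    using Q by (auto simp: zero_set_def)
  ultimately show "(subtopology zariski X) closure_of D = X"
    using F(2) by (auto simp: C_def)
qed

lemma rational_function_members:
  fixes X :: "('a::field ^ 'n::finite) set"
  assumes "f \<in> rational_functions X"
  shows "\<exists>P0 Q0. (\<exists>x\<in>X. mp_eval Q0 x \<noteq> 0) \<and>
    f = {(restrict (mp_eval P) X, restrict (mp_eval Q) X) |P Q.
      (\<exists>x\<in>X. mp_eval Q x \<noteq> 0) \<and> (\<forall>x\<in>X. mp_eval P0 x * mp_eval Q x = mp_eval P x * mp_eval Q0 x)}"
proof -
  have car: "p \<in> carrier (polynomial_functions X) \<longleftrightarrow> (\<exists>P. p = restrict (mp_eval P) X)" for p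
    by (auto simp: polynomial_functions_def)
  have zero: "restrict (mp_eval Q) X = \<zero>\<^bsub>polynomial_functions X\<^esub> \<longleftrightarrow> \<not> (\<exists>x\<in>X. mp_eval Q x \<noteq> 0)" for Q
    by (auto simp: polynomial_functions_def restrict_def fun_eq_iff)
  have eq: "restrict (mp_eval P) X \<otimes>\<^bsub>polynomial_functions X\<^esub> restrict (mp_eval Q) X =
      restrict (mp_eval P') X \<otimes>\<^bsub>polynomial_functions X\<^esub> restrict (mp_eval Q') X \<longleftrightarrow>
      (\<forall>x\<in>X. mp_eval P x * mp_eval Q x = mp_eval P' x * mp_eval Q' x)" for P Q P' Q'
    by (auto simp: polynomial_functions_def restrict_def fun_eq_iff)
  obtain p0 q0 where pq: "p0 \<in> carrier (polynomial_functions X)"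
    "q0 \<in> carrier (polynomial_functions X) - {\<zero>\<^bsub>polynomial_functions X\<^esub>}" "f = fraction_rel X `` {(p0, q0)}"
    using assms by (auto simp: rational_functions_def quotient_def)
  obtain P0 Q0 where PQ: "p0 = restrict (mp_eval P0) X" "q0 = restrict (mp_eval Q0) X" "\<exists>x\<in>X. mp_eval Q0 x \<noteq> 0"
  proof -
    obtain P0 Q0 where *: "p0 = restrict (mp_eval P0) X" "q0 = restrict (mp_eval Q0) X"
      using pq(1,2) car by (metis DiffD1)
    moreover have "restrict (mp_eval Q0) X \<noteq> \<zero>\<^bsub>polynomial_functions X\<^esub>"
      using pq(2) *(2) by (metis DiffD2 singletonI)
    then have "\<exists>x\<in>X. mp_eval Q0 x \<noteq> 0"
      unfolding zero by (rule notnotD)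
    ultimately show ?thesis
      by (rule that)
  qed
  have "f = {(p, q). p0 \<in> carrier (polynomial_functions X) \<and> q0 \<in> carrier (polynomial_functions X) - {\<zero>\<^bsub>polynomial_functions X\<^esub>} \<and>
      p \<in> carrier (polynomial_functions X) \<and> q \<in> carrier (polynomial_functions X) - {\<zero>\<^bsub>polynomial_functions X\<^esub>} \<and>
      p0 \<otimes>\<^bsub>polynomial_functions X\<^esub> q = p \<otimes>\<^bsub>polynomial_functions X\<^esub> q0}"
    unfolding pq(3) fraction_rel_def Let_def by auto
  also have "\<dots> = {(restrict (mp_eval P) X, restrict (mp_eval Q) X) |P Q.
      (\<exists>x\<in>X. mp_eval Q x \<noteq> 0) \<and> (\<forall>x\<in>X. mp_eval P0 x * mp_eval Q x = mp_eval P x * mp_eval Q0 x)}" (is "?L = ?R")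
  proof (rule Set.set_eqI, rule iffI)
    fix pq assume "pq \<in> ?L"
    then obtain P Q where "pq = (restrict (mp_eval P) X, restrict (mp_eval Q) X)"
      "restrict (mp_eval Q) X \<noteq> \<zero>\<^bsub>polynomial_functions X\<^esub>"
      "restrict (mp_eval P0) X \<otimes>\<^bsub>polynomial_functions X\<^esub> restrict (mp_eval Q) X =
        restrict (mp_eval P) X \<otimes>\<^bsub>polynomial_functions X\<^esub> restrict (mp_eval Q0) X"
      by (auto simp: car PQ)
    then show "pq \<in> ?R"
      unfolding zero eq by blast
  next
    fix pq' assume "pq' \<in> ?R"
    then obtain P Q where "pq' = (restrict (mp_eval P) X, restrict (mp_eval Q) X)"
      "restrict (mp_eval Q) X \<noteq> \<zero>\<^bsub>polynomial_functions X\<^esub>"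
      "restrict (mp_eval P0) X \<otimes>\<^bsub>polynomial_functions X\<^esub> restrict (mp_eval Q) X =
        restrict (mp_eval P) X \<otimes>\<^bsub>polynomial_functions X\<^esub> restrict (mp_eval Q0) X"
      unfolding zero eq by blast
    then show "pq' \<in> ?L"
      using pq(1,2) by (auto simp: car PQ)
  qed
  finally show ?thesis
    using PQ(3) by blast
qed

text \<open>
  Finitely many denominators \<open>Q\<close> of \<open>f\<close> have the same common zeros as all of them. With the corresponding
  numerators \<open>N Q\<close>, the fraction of \<open>\<Sum>Q. N Q * Q\<close> and \<open>\<Sum>Q. Q * Q\<close> represents \<open>f\<close>, and over an ordered field its
  denominator vanishes only where all denominators do. Hence the domain of \<open>f\<close> is the non-vanishing set
  of a single polynomial.
\<close>

theorem rational_function_global_fraction: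
  fixes X :: "('a::linordered_field ^ 'n::finite) set"
  assumes X: "algebraic_set X" "irreducible_set X" and f: "f \<in> rational_functions X"
  shows "\<exists>P Q. rat_dom X f = {x \<in> X. mp_eval Q x \<noteq> 0} \<and>
    (\<forall>x\<in>X. mp_eval Q x \<noteq> 0 \<longrightarrow> rat_eval f x = mp_eval P x / mp_eval Q x)"
proof -
  obtain P0 Q0 where Q0: "\<exists>x\<in>X. mp_eval Q0 x \<noteq> 0" and f_eq:
    "f = {(restrict (mp_eval P) X, restrict (mp_eval Q) X) |P Q.
      (\<exists>x\<in>X. mp_eval Q x \<noteq> 0) \<and> (\<forall>x\<in>X. mp_eval P0 x * mp_eval Q x = mp_eval P x * mp_eval Q0 x)}"
    using rational_function_members[OF f] by blast
  define M where "M P Q \<longleftrightarrow> (\<exists>x\<in>X. mp_eval Q x \<noteq> 0) \<and>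
      (\<forall>x\<in>X. mp_eval P0 x * mp_eval Q x = mp_eval P x * mp_eval Q0 x)" for P Q
  have f_M: "f = {(restrict (mp_eval P) X, restrict (mp_eval Q) X) |P Q. M P Q}"
    unfolding f_eq M_def ..
  have cross: "mp_eval P x * mp_eval Q' x = mp_eval P' x * mp_eval Q x" if "M P Q" "M P' Q'" "x \<in> X" for P Q P' Q' x
  proof -
    have "mp_eval Q0 x * mp_eval (P * Q' - P' * Q) x = 0" if "x \<in> X" for x
    proof -
      have "mp_eval Q0 x * mp_eval (P * Q' - P' * Q) x =
          (mp_eval P x * mp_eval Q0 x) * mp_eval Q' x - (mp_eval P' x * mp_eval Q0 x) * mp_eval Q x"
        by (simp add: algebra_simps)
      also have "\<dots> = (mp_eval P0 x * mp_eval Q x) * mp_eval Q' x - (mp_eval P0 x * mp_eval Q' x) * mp_eval Q x"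
        using \<open>M P Q\<close> \<open>M P' Q'\<close> that by (simp add: M_def)
      finally show ?thesis by simp
    qed
    from irreducible_set_integral[OF X this] Q0 have "mp_eval (P * Q' - P' * Q) x = 0"
      using that(3) by blast
    then show ?thesis by simp
  qed
  define Den where "Den = {Q. \<exists>P. M P Q}"
  obtain T where T: "T \<subseteq> Den" "finite T" "\<And>x. \<forall>p\<in>T. mp_eval p x = 0 \<Longrightarrow> \<forall>p\<in>Den. mp_eval p x = 0"
    using mpoly_finite_basis[of Den] by blast
  have "\<forall>Q\<in>T. \<exists>P. M P Q"
    using T(1) by (auto simp: Den_def)
  then obtain N where N: "\<And>Q. Q \<in> T \<Longrightarrow> M (N Q) Q"
    by metis
  (* over an ordered field a sum of squares vanishes only where each term does *)
  define Qs where "Qs = (\<Sum>Q\<in>T. Q * Q)"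
  define Ps where "Ps = (\<Sum>Q\<in>T. N Q * Q)"
  have Qs: "mp_eval Qs x = (\<Sum>Q\<in>T. mp_eval Q x * mp_eval Q x)" for x
    by (simp add: Qs_def mp_eval_sum)
  have Ps: "mp_eval Ps x = (\<Sum>Q\<in>T. mp_eval (N Q) x * mp_eval Q x)" for x
    by (simp add: Ps_def mp_eval_sum)
  have Qs_nz: "mp_eval Qs x \<noteq> 0" if "Q \<in> Den" "mp_eval Q x \<noteq> 0" for Q x
  proof
    assume "mp_eval Qs x = 0"
    then have "\<forall>Q\<in>T. mp_eval Q x * mp_eval Q x = 0"
      unfolding Qs using T(2) by (subst (asm) sum_nonneg_eq_0_iff) auto
    then have "\<forall>Q\<in>T. mp_eval Q x = 0"
      by simp
    then show False
      using T(3) that by blast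
  qed
  have "M P0 Q0"
    using Q0 by (auto simp: M_def)
  then have "Q0 \<in> Den"
    by (auto simp: Den_def)
  then have Qs_ex: "\<exists>x\<in>X. mp_eval Qs x \<noteq> 0"
    using Q0 Qs_nz by blast
  have Ms: "M Ps Qs"
    unfolding M_def
  proof (intro conjI ballI)
    fix x assume x: "x \<in> X"
    have "mp_eval P0 x * mp_eval Qs x = (\<Sum>Q\<in>T. (mp_eval P0 x * mp_eval Q x) * mp_eval Q x)"
      by (simp add: Qs sum_distrib_left mult.assoc)
    also have "\<dots> = (\<Sum>Q\<in>T. (mp_eval (N Q) x * mp_eval Q0 x) * mp_eval Q x)"
      by (rule sum.cong) (use N x in \<open>auto simp: M_def\<close>)
    also have "\<dots> = mp_eval Ps x * mp_eval Q0 x"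
      by (simp add: Ps sum_distrib_left sum_distrib_right mult_ac)
    finally show "mp_eval P0 x * mp_eval Qs x = mp_eval Ps x * mp_eval Q0 x" .
  qed (rule Qs_ex)
  define D where "D = {x \<in> X. mp_eval Qs x \<noteq> 0}"
  have "rat_dom X f = D"
    unfolding rat_dom_def
  proof (rule Greatest_equality)
    have "regular_on f D"
      unfolding regular_on_def f_M using Ms by (fastforce simp: D_def)
    then show "openin (subtopology zariski X) D \<and> subtopology zariski X closure_of D = X \<and> regular_on f D"
      using irreducible_set_dense[OF X Qs_ex] by (simp add: D_def)
  next
    fix U assume U: "openin (subtopology zariski X) U \<and> subtopology zariski X closure_of U = X \<and> regular_on f U"
    then have UX: "U \<subseteq> X"
      using openin_subset by fastforce
    obtain P Q where "M P Q" and Q: "\<forall>x\<in>U. restrict (mp_eval Q) X x \<noteq> 0"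
      using U unfolding regular_on_def f_M by blast
    then have "Q \<in> Den"
      by (auto simp: Den_def)
    moreover have "mp_eval Q x \<noteq> 0" if "x \<in> U" for x
      using Q UX that by (metis restrict_apply' subsetD)
    ultimately show "U \<le> D"
      using Qs_nz UX by (auto simp: D_def)
  qed
  moreover have "rat_eval f x = mp_eval Ps x / mp_eval Qs x" if "x \<in> X" "mp_eval Qs x \<noteq> 0" for x
    unfolding rat_eval_def
  proof (rule the_equality)
    show "\<exists>(p, q)\<in>f. q x \<noteq> 0 \<and> mp_eval Ps x / mp_eval Qs x = p x / q x"
      unfolding f_M using Ms that by (intro bexI[of _ "(restrict (mp_eval Ps) X, restrict (mp_eval Qs) X)"]) auto
  next
    fix v assume "\<exists>(p, q)\<in>f. q x \<noteq> 0 \<and> v = p x / q x"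
    then obtain P Q where "M P Q" "restrict (mp_eval Q) X x \<noteq> 0"
      "v = restrict (mp_eval P) X x / restrict (mp_eval Q) X x"
      unfolding f_M by blast
    then show "v = mp_eval Ps x / mp_eval Qs x"
      using cross[of P Q Ps Qs x] Ms that by (simp add: frac_eq_eq)
  qed
  ultimately show ?thesis
    unfolding D_def by blast
qed

lemma algebraic_set_finite_zero_set:
  fixes X :: "('a::field ^ 'n::finite) set"
  assumes "algebraic_set X"
  shows "\<exists>T. finite T \<and> X = zero_set T"
proof -
  obtain B where B: "X = zero_set B"
    using assms by (auto simp: algebraic_set_def)
  obtain T where T: "T \<subseteq> B" "finite T" "\<And>x. \<forall>p\<in>T. mp_eval p x = 0 \<Longrightarrow> \<forall>p\<in>B. mp_eval p x = 0"
    using mpoly_finite_basis[of B] by blast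
  then have "X = zero_set T"
    unfolding B zero_set_def by blast
  then show ?thesis
    using T(2) by blast
qed

section \<open>Semi-algebraic sets and definable predicates\<close>

abbreviation coords :: "('a ^ 'i \<Rightarrow> 'a) set" where
  "coords \<equiv> range (\<lambda>i x. x $ i)"

lemma pfuns_mp_eval: "mp_eval p \<in> pfuns (coords :: ('a::comm_ring_1 ^ 'i::finite \<Rightarrow> 'a) set)"
  unfolding mp_eval_def[abs_def] mon_eval_def
  by (intro pfuns_sum pfuns_mult pfuns_const pfuns_prod pfuns_power pfuns_base rangeI)

lemma pfuns_mp_eval_subst:
  fixes b :: "'e \<Rightarrow> 'a::comm_ring_1 ^ 'i::finite"
  assumes "\<And>i. (\<lambda>e. b e $ i) \<in> pfuns T"
  shows "(\<lambda>e. mp_eval p (b e)) \<in> pfuns T"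
  by (rule pfuns_subst[OF pfuns_mp_eval]) (use assms in auto)

lemma pfuns_coords_imp_mp_eval:
  fixes f :: "'a::comm_ring_1 ^ 'i::finite \<Rightarrow> 'a"
  assumes "f \<in> pfuns coords"
  shows "\<exists>p. \<forall>x. f x = mp_eval p x"
  using assms
proof (induction rule: pfuns.induct)
  case (pfuns_const c)
  show ?case
    by (intro exI[of _ "Poly_Mapping.single 0 c"]) (simp add: mp_eval_single mon_eval_def)
next
  case (pfuns_base s)
  then obtain i where i: "s = (\<lambda>x. x $ i)"
    by auto
  have "mon_eval (Poly_Mapping.single i 1) x = x $ i" for x :: "'a ^ 'i"
  proof -
    have "mon_eval (Poly_Mapping.single i 1) x = (\<Prod>j\<in>UNIV. if j = i then x $ j else 1)"
      unfolding mon_eval_def by (rule prod.cong) (auto simp: lookup_single when_def)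
    then show ?thesis by simp
  qed
  then show ?case
    by (intro exI[of _ "Poly_Mapping.single (Poly_Mapping.single i 1) 1"]) (simp add: mp_eval_single i)
next
  case (pfuns_add f g)
  then obtain p q where "\<forall>x. f x = mp_eval p x" "\<forall>x. g x = mp_eval q x" by blast
  then show ?case by (intro exI[of _ "p + q"]) simp
next
  case (pfuns_mult f g)
  then obtain p q where "\<forall>x. f x = mp_eval p x" "\<forall>x. g x = mp_eval q x" by blast
  then show ?case by (intro exI[of _ "p * q"]) simp
qed

lemma semialgebraic_imp_definable:
  "semialgebraic S \<Longrightarrow> definable coords (\<lambda>x. x \<in> S)"
proof (induction rule: semialgebraic.induct)
  case (positive p)
  show ?case
    using definable_pos[OF pfuns_mp_eval[of p]] by simp
qed (simp_all add: definable_disj definable_conj definable_not)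

lemma definable_imp_semialgebraic:
  fixes P :: "'a::linordered_field ^ 'i::finite \<Rightarrow> bool"
  shows "definable coords P \<Longrightarrow> semialgebraic {x. P x}"
proof (induction rule: definable.induct)
  case (definable_pos f)
  then obtain p where "\<forall>x. f x = mp_eval p x"
    using pfuns_coords_imp_mp_eval by blast
  then show ?case
    using semialgebraic.positive[of p] by simp
next
  case (definable_not P)
  then show ?case
    using semialgebraic.complement[of "{x. P x}"] by (simp add: Collect_neg_eq)
next
  case (definable_conj P Q)
  then show ?case
    using semialgebraic.inter[of "{x. P x}" "{x. Q x}"] by (simp add: Collect_conj_eq)
qed

lemma definable_All_vec:
  fixes S :: "('e \<Rightarrow> 'a::real_closed_field) set" and P :: "'e \<Rightarrow> 'a ^ 'n::finite \<Rightarrow> bool"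
  assumes "definable (vector_ext S) (\<lambda>p. P (fst p) (snd p))"
  shows "definable S (\<lambda>e. \<forall>x. P e x)"
proof -
  have "definable S (\<lambda>e. \<not> (\<exists>x. \<not> P e x))"
    by (rule definable_not, rule definable_Ex_vec, rule definable_not, rule assms)
  then show ?thesis by simp
qed

lemma definable_arc_graph:
  fixes \<gamma> :: "'a::real_closed_field \<Rightarrow> 'a ^ 'n::finite"
  assumes "semialgebraic (arc_graph \<gamma>)"
  shows "definable (vector_ext coord) (\<lambda>p. fst p \<in> {0..1} \<and> snd p = \<gamma> (fst p))"
proof -
  define h where "h p = (\<chi> k. case k of None \<Rightarrow> fst p | Some i \<Rightarrow> snd p $ i)" for p :: "'a \<times> ('a ^ 'n)"
  have "definable (vector_ext coord) (\<lambda>p. h p \<in> arc_graph \<gamma>)"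
  proof (rule definable_subst[OF semialgebraic_imp_definable[OF assms]])
    fix s :: "'a ^ 'n option \<Rightarrow> 'a" assume "s \<in> coords"
    then obtain o' where s: "s = (\<lambda>x. x $ o')"
      by auto
    show "(\<lambda>p. s (h p)) \<in> pfuns (vector_ext coord)"
      using pfuns_vext_fst[OF pfuns_coord] pfuns_vext_nth by (cases o') (auto simp: s h_def)
  qed
  moreover have "h p \<in> arc_graph \<gamma> \<longleftrightarrow> fst p \<in> {0..1} \<and> snd p = \<gamma> (fst p)" for p
    by (auto simp: h_def arc_graph_def vec_eq_iff)
  ultimately show ?thesis by simp
qed

section \<open>Boundedness along arcs\<close>

text \<open>
  In this form boundedness of a fraction becomes a polynomial inequality.
\<close>

lemma order_bounded_iff_squares:
  "order_bounded S \<longleftrightarrow> (\<exists>M. \<forall>y\<in>S. y * y \<le> M)"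
proof
  assume "order_bounded S"
  then obtain l u where lu: "\<And>y. y \<in> S \<Longrightarrow> l \<le> y" "\<And>y. y \<in> S \<Longrightarrow> y \<le> u"
    by (auto simp: order_bounded_def bdd_below_def bdd_above_def)
  define B where "B = max \<bar>l\<bar> \<bar>u\<bar>"
  have "y * y \<le> B * B" if "y \<in> S" for y
  proof -
    have "\<bar>y\<bar> \<le> B"
      using lu[OF that] by (auto simp: B_def abs_if split: if_splits)
    then have "\<bar>y\<bar> * \<bar>y\<bar> \<le> B * B"
      by (intro mult_mono) auto
    then show ?thesis by simp
  qed
  then show "\<exists>M. \<forall>y\<in>S. y * y \<le> M" by blast
next
  assume "\<exists>M. \<forall>y\<in>S. y * y \<le> M"
  then obtain M where M: "\<And>y. y \<in> S \<Longrightarrow> y * y \<le> M" by blast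
  have "\<bar>y\<bar> \<le> M + 1" if "y \<in> S" for y
  proof (cases "\<bar>y\<bar> \<le> 1")
    case True
    have "0 \<le> y * y" by simp
    then have "0 \<le> M" using M[OF that] by (rule order_trans)
    then show ?thesis using True by simp
  next
    case False
    then have "\<bar>y\<bar> * 1 \<le> \<bar>y\<bar> * \<bar>y\<bar>"
      by (intro mult_left_mono) auto
    then show ?thesis
      using M[OF that] by simp
  qed
  then have "y \<le> M + 1" "- (M + 1) \<le> y" if "y \<in> S" for y
    using that unfolding abs_le_iff by (blast, metis minus_le_iff)
  then show "order_bounded S"
    unfolding order_bounded_def by (meson bdd_belowI bdd_aboveI)
qed

lemma square_quotient_le_iff:
  fixes p q M :: "'a::linordered_field"
  assumes "q \<noteq> 0"
  shows "(p / q) * (p / q) \<le> M \<longleftrightarrow> p * p \<le> M * (q * q)"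
proof -
  have "0 < q * q"
    using assms by (metis mult_neg_neg mult_pos_pos neqE)
  then show ?thesis
    by (simp add: pos_divide_le_eq)
qed

text \<open>
  Let \<open>A t\<close> state that \<open>g\<close> is bounded along the arc on the parameters from \<open>0\<close> to \<open>t\<close>. Local boundedness at
  the point \<open>\<gamma> c\<close> shows that the definable initial segment \<open>A\<close> cannot end at any \<open>c\<close> in the unit interval. An
  appeal to compactness of the interval would fail over a non-archimedean field.
\<close>

lemma locally_bounded_imp_bounded_along_arc:
  fixes X :: "('a::{real_closed_field,linorder_topology} ^ 'n::finite) set"
  assumes dom: "D = {x \<in> X. mp_eval Q x \<noteq> 0}"
    and g: "\<And>x. x \<in> D \<Longrightarrow> g x = mp_eval P x / mp_eval Q x"
    and lb: "\<And>x. x \<in> X \<Longrightarrow> \<exists>V. open V \<and> x \<in> V \<and> order_bounded (g ` (V \<inter> D))"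
    and arc: "semialgebraic_arc X \<gamma>" and sub: "\<gamma> ` {0<..1} \<subseteq> D"
  shows "order_bounded ((g \<circ> \<gamma>) ` {0<..1})"
proof -
  define Gr where "Gr s x \<longleftrightarrow> s \<in> {0..1} \<and> x = \<gamma> s" for s x
  define A where "A t \<longleftrightarrow> (\<exists>M. \<forall>s. 0 < s \<and> s \<le> t \<and> s \<le> 1 \<longrightarrow>
      (\<forall>x. Gr s x \<longrightarrow> mp_eval P x * mp_eval P x \<le> M * (mp_eval Q x * mp_eval Q x)))" for t
  have A: "A t \<longleftrightarrow> (\<exists>M. \<forall>s. 0 < s \<and> s \<le> t \<and> s \<le> 1 \<longrightarrow> g (\<gamma> s) * g (\<gamma> s) \<le> M)" for t
  proof -
    have "(\<forall>x. Gr s x \<longrightarrow> mp_eval P x * mp_eval P x \<le> M * (mp_eval Q x * mp_eval Q x)) \<longleftrightarrow>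
        g (\<gamma> s) * g (\<gamma> s) \<le> M" if s: "0 < s" "s \<le> 1" for s M
    proof -
      have d: "\<gamma> s \<in> D"
        using sub s by auto
      then have "mp_eval Q (\<gamma> s) \<noteq> 0"
        by (simp add: dom)
      from square_quotient_le_iff[OF this, of "mp_eval P (\<gamma> s)" M] show ?thesis
        using s by (simp add: g[OF d] Gr_def)
    qed
    then show ?thesis
      unfolding A_def by blast
  qed
  have "definable (vector_ext coord) (\<lambda>p. Gr (fst p) (snd p))"
    using arc unfolding Gr_def by (intro definable_arc_graph) (simp add: semialgebraic_arc_def)
  note Gr = definable_vext_subst[where P = Gr, OF this]
  have "definable (vector_ext (scalar_ext (scalar_ext coord))) (\<lambda>q. Gr (snd (fst q)) (snd q) \<longrightarrow>
      mp_eval P (snd q) * mp_eval P (snd q) \<le> snd (fst (fst q)) * (mp_eval Q (snd q) * mp_eval Q (snd q)))"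
  proof (intro definable_imp Gr definable_le pfuns_mult pfuns_mp_eval_subst pfuns_vext_nth)
    have s: "(\<lambda>q. snd (fst q)) \<in> pfuns (vector_ext (scalar_ext (scalar_ext coord)))"
      by (rule pfuns_vext_fst[OF pfuns_ext_snd])
    show "(\<lambda>q. f (snd (fst q))) \<in> pfuns (vector_ext (scalar_ext (scalar_ext coord)))" if "f \<in> coord" for f :: "'a \<Rightarrow> 'a"
      using s that by simp
    show "(\<lambda>q. snd (fst (fst q))) \<in> pfuns (vector_ext (scalar_ext (scalar_ext coord)))"
      by (rule pfuns_vext_fst[OF pfuns_ext_fst[OF pfuns_ext_snd]])
  qed
  then have "definable (scalar_ext (scalar_ext coord)) (\<lambda>q. \<forall>x. Gr (snd q) x \<longrightarrow>
      mp_eval P x * mp_eval P x \<le> snd (fst q) * (mp_eval Q x * mp_eval Q x))"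
    by (rule definable_All_vec)
  then have "definable (scalar_ext (scalar_ext coord)) (\<lambda>q. 0 < snd q \<and> snd q \<le> fst (fst q) \<and> snd q \<le> 1 \<longrightarrow>
      (\<forall>x. Gr (snd q) x \<longrightarrow> mp_eval P x * mp_eval P x \<le> snd (fst q) * (mp_eval Q x * mp_eval Q x)))"
    by (intro definable_imp definable_conj definable_less definable_le pfuns_const pfuns_ext_snd
        pfuns_ext_fst[OF pfuns_ext_fst[OF pfuns_coord]])
  then have "definable coord A"
    unfolding A_def[abs_def] by (intro definable_Ex definable_All)
  moreover have down: "A s" if "s \<le> t" "A t" for s t
    using that unfolding A by (meson order_trans)
  moreover have A0: "A 0"
    unfolding A by (intro exI[of _ 0]) auto
  ultimately have cut: "\<exists>c. (\<forall>x<c. A x) \<and> (\<forall>x>c. \<not> A x)" if "\<not> A 1"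
    using definable_cut[of A 0 1] that by blast
  have "A 1"
  proof (rule ccontr)
    assume nA: "\<not> A 1"
    obtain c where c: "\<And>x. x < c \<Longrightarrow> A x" "\<And>x. c < x \<Longrightarrow> \<not> A x"
      using cut[OF nA] by blast
    have c01: "c \<in> {0..1}"
      using c(1)[of 1] c(2)[of 0] A0 nA by (auto simp: not_less[symmetric])
    then have "\<gamma> c \<in> X"
      using arc by (auto simp: semialgebraic_arc_def)
    then obtain V where V: "open V" "\<gamma> c \<in> V" "order_bounded (g ` (V \<inter> D))"
      using lb by blast
    obtain M' where M': "\<And>x. x \<in> V \<Longrightarrow> x \<in> D \<Longrightarrow> g x * g x \<le> M'"
      using V(3) unfolding order_bounded_iff_squares by blast
    have "(\<gamma> \<longlongrightarrow> \<gamma> c) (at c within {0..1})"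
      using arc c01 by (auto simp: semialgebraic_arc_def continuous_on_def)
    then have "eventually (\<lambda>s. \<gamma> s \<in> V) (at c within {0..1})"
      using V(1,2) by (rule topological_tendstoD)
    then have "eventually (\<lambda>s. s \<noteq> c \<longrightarrow> s \<in> {0..1} \<longrightarrow> \<gamma> s \<in> V) (nhds c)"
      by (simp add: eventually_at_filter)
    then obtain \<delta> where \<delta>: "\<delta> > 0" "\<And>s. \<bar>s - c\<bar> < \<delta> \<Longrightarrow> s \<noteq> c \<Longrightarrow> s \<in> {0..1} \<Longrightarrow> \<gamma> s \<in> V"
      unfolding eventually_nhds_linordered_field by blast
    obtain M0 where M0: "\<And>s. 0 < s \<Longrightarrow> s \<le> c - \<delta> / 2 \<Longrightarrow> s \<le> 1 \<Longrightarrow> g (\<gamma> s) * g (\<gamma> s) \<le> M0"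
      using c(1)[of "c - \<delta> / 2"] \<delta>(1) unfolding A by auto
    have "g (\<gamma> s) * g (\<gamma> s) \<le> max M0 M'" if s: "0 < s" "s \<le> c + \<delta> / 2" "s \<le> 1" for s
    proof (cases "s \<le> c - \<delta> / 2")
      case True
      then show ?thesis
        using M0[of s] s by (simp add: le_max_iff_disj)
    next
      case False
      have half: "\<delta> / 2 < \<delta>"
        using \<delta>(1) by simp
      have "s < c + \<delta>"
        using s(2) half by (meson add_strict_left_mono le_less_trans)
      moreover have "c - \<delta> < s"
        using False half by (meson diff_strict_left_mono less_trans not_le)
      ultimately have "\<bar>s - c\<bar> < \<delta>"
        by (simp add: abs_less_iff algebra_simps)
      then have "\<gamma> s \<in> V"
        using \<delta>(2)[of s] V(2) s by (cases "s = c") auto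
      moreover have "\<gamma> s \<in> D"
        using sub s by auto
      ultimately show ?thesis
        using M' by (simp add: le_max_iff_disj)
    qed
    then have "A (c + \<delta> / 2)"
      unfolding A by blast
    then show False
      using c(2)[of "c + \<delta> / 2"] \<delta>(1) by simp
  qed
  then obtain M where "\<And>s. 0 < s \<Longrightarrow> s \<le> 1 \<Longrightarrow> g (\<gamma> s) * g (\<gamma> s) \<le> M"
    unfolding A by auto
  then show ?thesis
    unfolding order_bounded_iff_squares by (intro exI[of _ M]) auto
qed

section \<open>Curve selection\<close>

lemma eventually_nhds_scale:
  fixes t \<eta> :: "'a::{linordered_field,linorder_topology}"
  assumes "0 < \<eta>" "eventually P (nhds (\<eta> * t))"
  shows "eventually (\<lambda>s. P (\<eta> * s)) (nhds t)"
proof -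
  obtain \<delta> where \<delta>: "\<delta> > 0" "\<And>x. \<bar>x - \<eta> * t\<bar> < \<delta> \<Longrightarrow> P x"
    using assms(2) unfolding eventually_nhds_linordered_field by blast
  have "P (\<eta> * s)" if "\<bar>s - t\<bar> < \<delta> / \<eta>" for s
  proof (rule \<delta>(2))
    have "\<bar>\<eta> * s - \<eta> * t\<bar> = \<eta> * \<bar>s - t\<bar>"
      using assms(1) by (simp flip: right_diff_distrib add: abs_mult)
    also have "\<dots> < \<delta>"
      using that assms(1) by (simp add: pos_less_divide_eq mult.commute)
    finally show "\<bar>\<eta> * s - \<eta> * t\<bar> < \<delta>" .
  qed
  moreover have "0 < \<delta> / \<eta>"
    using \<delta>(1) assms(1) by simp
  ultimately show ?thesis
    unfolding eventually_nhds_linordered_field by blast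
qed

lemma open_box_around:
  fixes a :: "'a::{linordered_field,linorder_topology} ^ 'n::finite"
  shows "open {x. \<forall>i. x $ i - a $ i < t \<and> a $ i - x $ i < t}"
proof -
  have "{x. \<forall>i. x $ i - a $ i < t \<and> a $ i - x $ i < t} = (\<Inter>i. (\<lambda>x. x $ i) -` {a $ i - t<..<a $ i + t})"
    by (auto simp: algebra_simps)
  also have "open \<dots>"
    by (intro open_INT ballI finite open_vimage_vec_nth open_greaterThanLessThan)
  finally show ?thesis .
qed

text \<open>
  A definable choice of a point of \<open>R t\<close>, for each \<open>t > 0\<close>, is continuous for small positive \<open>t\<close>. It tends to
  \<open>a\<close> for \<open>t\<close> tending to \<open>0\<close>, because \<open>R t\<close> lies in the box of radius \<open>t\<close> around \<open>a\<close>. After a linear change of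
  the parameter it is an arc on the unit interval.
\<close>

theorem curve_selection:
  fixes a :: "'a::{real_closed_field,linorder_topology} ^ 'n::finite"
  assumes R: "definable (vector_ext coord) (\<lambda>p. R (fst p) (snd p))"
    and ex: "\<And>t. 0 < t \<Longrightarrow> \<exists>x. R t x"
    and near: "\<And>t x i. R t x \<Longrightarrow> x $ i - a $ i < t \<and> a $ i - x $ i < t"
    and X: "\<And>t x. R t x \<Longrightarrow> x \<in> X" "a \<in> X"
  shows "\<exists>\<gamma> \<eta>. 0 < \<eta> \<and> semialgebraic_arc X \<gamma> \<and> (\<forall>s. 0 < s \<and> s \<le> 1 \<longrightarrow> R (\<eta> * s) (\<gamma> s))"
proof -
  obtain c where c: "\<And>t. 0 < t \<Longrightarrow> R t (c t)" "\<And>i. definable (scalar_ext coord) (\<lambda>p. snd p = c (fst p) $ i)"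
    using definable_choice_vec[OF R] ex by blast
  have "\<exists>\<epsilon>>0. \<forall>i\<in>I. \<forall>t. 0 < t \<and> t < \<epsilon> \<longrightarrow> ((\<lambda>s. c s $ i) \<longlongrightarrow> c t $ i) (nhds t)"
    if "finite I" for I :: "'n set"
    using that
  proof (induction I)
    case empty
    show ?case by (intro exI[of _ 1]) simp
  next
    case (insert i I)
    then obtain \<epsilon>1 where 1: "\<epsilon>1 > 0" "\<forall>i\<in>I. \<forall>t. 0 < t \<and> t < \<epsilon>1 \<longrightarrow> ((\<lambda>s. c s $ i) \<longlongrightarrow> c t $ i) (nhds t)"
      by blast
    obtain \<epsilon>2 where 2: "\<epsilon>2 > 0" "\<forall>t. 0 < t \<and> t < \<epsilon>2 \<longrightarrow> ((\<lambda>s. c s $ i) \<longlongrightarrow> c t $ i) (nhds t)"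
      using definable_eventually_continuous[OF c(2)[of i]] by blast
    show ?case
      by (rule exI[of _ "min \<epsilon>1 \<epsilon>2"]) (use 1 2 in simp)
  qed
  from this[OF finite[of UNIV]] obtain \<epsilon> where \<epsilon>: "\<epsilon> > 0"
    "\<And>i t. 0 < t \<Longrightarrow> t < \<epsilon> \<Longrightarrow> ((\<lambda>s. c s $ i) \<longlongrightarrow> c t $ i) (nhds t)"
    by blast
  define \<eta> where "\<eta> = \<epsilon> / 2"
  have \<eta>: "0 < \<eta>" "\<eta> < \<epsilon>"
    using \<epsilon>(1) by (auto simp: \<eta>_def)
  define \<gamma> where "\<gamma> s = (if s \<le> 0 then a else c (\<eta> * s))" for s
  have R\<gamma>: "R (\<eta> * s) (\<gamma> s)" if "0 < s" for s
    using that \<eta>(1) c(1)[of "\<eta> * s"] by (simp add: \<gamma>_def)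
  have "\<gamma> s \<in> X" for s
    using R\<gamma>[of s] X by (cases "0 < s") (auto simp: \<gamma>_def)
  moreover have "continuous_on {0..1} \<gamma>"
    unfolding continuous_on_def
  proof (intro ballI vec_tendstoI)
    fix t i assume t: "t \<in> {0..1 :: 'a}"
    have within: "(f \<longlongrightarrow> l) (at t within {0..1})"
      if "\<And>U. open U \<Longrightarrow> l \<in> U \<Longrightarrow> eventually (\<lambda>s. s \<in> {0..1} \<longrightarrow> f s \<in> U) (nhds t)" for f :: "'a \<Rightarrow> 'a" and l
    proof (rule topological_tendstoI)
      fix U assume "open U" "l \<in> U"
      from that[OF this] show "eventually (\<lambda>s. f s \<in> U) (at t within {0..1})"
        unfolding eventually_at_filter by (rule eventually_mono) blast
    qed
    show "((\<lambda>s. \<gamma> s $ i) \<longlongrightarrow> \<gamma> t $ i) (at t within {0..1})"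
    proof (rule within)
      fix U assume U: "open U" "\<gamma> t $ i \<in> U"
      show "eventually (\<lambda>s. s \<in> {0..1} \<longrightarrow> \<gamma> s $ i \<in> U) (nhds t)"
      proof (cases "t = 0")
        case True
        have "eventually (\<lambda>u. u \<in> U) (nhds (a $ i))"
          using U True by (intro eventually_nhds_in_open) (auto simp: \<gamma>_def)
        then obtain \<delta> where \<delta>: "\<delta> > 0" "\<And>u. \<bar>u - a $ i\<bar> < \<delta> \<Longrightarrow> u \<in> U"
          unfolding eventually_nhds_linordered_field by blast
        have "\<gamma> s $ i \<in> U" if s: "\<bar>s - 0\<bar> < \<delta> / \<eta>" "s \<in> {0..1}" for s
        proof (cases "s = 0")
          case True
          then show ?thesis using U \<open>t = 0\<close> by simp
        next
          case False
          then have "0 < s" using s by auto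
          have "\<eta> * s < \<delta>"
            using s \<eta>(1) by (simp add: pos_less_divide_eq mult.commute)
          moreover have "\<gamma> s $ i - a $ i < \<eta> * s" "a $ i - \<gamma> s $ i < \<eta> * s"
            using near[OF R\<gamma>[OF \<open>0 < s\<close>]] by auto
          ultimately show ?thesis
            by (intro \<delta>(2)) (auto simp: abs_less_iff)
        qed
        moreover have "0 < \<delta> / \<eta>"
          using \<delta>(1) \<eta>(1) by simp
        ultimately show ?thesis
          unfolding eventually_nhds_linordered_field True by blast
      next
        case False
        then have t0: "0 < t" using t by auto
        have "\<eta> * t \<le> \<eta> * 1"
          using t \<eta>(1) by (intro mult_left_mono) auto
        then have "\<eta> * t < \<epsilon>"
          using \<eta>(2) by simp
        moreover have "0 < \<eta> * t"
          using t0 \<eta>(1) by simp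
        ultimately have "0 < \<eta> * t" "\<eta> * t < \<epsilon>"
          by blast+
        then have "((\<lambda>s. c s $ i) \<longlongrightarrow> c (\<eta> * t) $ i) (nhds (\<eta> * t))"
          by (rule \<epsilon>(2))
        then have "eventually (\<lambda>u. c u $ i \<in> U) (nhds (\<eta> * t))"
          using U t0 by (intro topological_tendstoD) (auto simp: \<gamma>_def)
        then have "eventually (\<lambda>s. c (\<eta> * s) $ i \<in> U) (nhds t)"
          by (rule eventually_nhds_scale[OF \<eta>(1)])
        moreover have "eventually (\<lambda>s. s \<in> {0<..}) (nhds t)"
          using t0 by (intro eventually_nhds_in_open) auto
        ultimately show ?thesis
          by eventually_elim (simp add: \<gamma>_def)
      qed
    qed
  qed
  moreover have "semialgebraic (arc_graph \<gamma>)"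
  proof -
    have cg: "definable coords (\<lambda>z :: 'a ^ 'n option. z $ Some i = c (\<eta> * z $ None) $ i)" for i
    proof (rule definable_ext_subst[where P = "\<lambda>t y. y = c t $ i", OF c(2)])
      have "(\<lambda>z :: 'a ^ 'n option. \<eta> * z $ None) \<in> pfuns coords"
        by (intro pfuns_mult pfuns_const pfuns_base rangeI)
      then show "(\<lambda>z :: 'a ^ 'n option. s (\<eta> * z $ None)) \<in> pfuns coords" if "s \<in> coord" for s :: "'a \<Rightarrow> 'a"
        using that by simp
    qed (intro pfuns_base rangeI)
    have "definable coords (\<lambda>z :: 'a ^ 'n option. 0 \<le> z $ None \<and> z $ None \<le> 1 \<and>
        ((z $ None = 0 \<and> (\<forall>i\<in>UNIV. z $ Some i = a $ i)) \<or>
         (0 < z $ None \<and> (\<forall>i\<in>UNIV. z $ Some i = c (\<eta> * z $ None) $ i))))"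
      by (intro cg definable_conj definable_disj definable_Ball_finite definable_eq definable_le definable_less finite
          pfuns_const pfuns_base rangeI)
    from definable_imp_semialgebraic[OF this]
    show ?thesis
      by (rule back_subst[of semialgebraic]) (auto simp: arc_graph_def \<gamma>_def not_le)
  qed
  ultimately have "semialgebraic_arc X \<gamma>"
    by (simp add: semialgebraic_arc_def)
  with \<eta>(1) R\<gamma> show ?thesis by blast
qed

text \<open>
  If \<open>g\<close> is unbounded in every neighbourhood of \<open>a\<close>, then for each \<open>t > 0\<close> there is a point within \<open>t\<close> of \<open>a\<close>
  where \<open>\<bar>g\<bar> > 1 / t\<close>. Curve selection makes an arc of such points, and \<open>g\<close> is unbounded along it.
\<close>

lemma bounded_along_arcs_imp_locally_bounded:
  fixes X :: "('a::{real_closed_field,linorder_topology} ^ 'n::finite) set"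
  assumes alg: "algebraic_set X" and dom: "D = {x \<in> X. mp_eval Q x \<noteq> 0}"
    and g: "\<And>x. x \<in> D \<Longrightarrow> g x = mp_eval P x / mp_eval Q x"
    and arcs: "\<And>\<gamma>. semialgebraic_arc X \<gamma> \<Longrightarrow> \<gamma> ` {0<..1} \<subseteq> D \<Longrightarrow> order_bounded ((g \<circ> \<gamma>) ` {0<..1})"
    and a: "a \<in> X"
  shows "\<exists>V. open V \<and> a \<in> V \<and> order_bounded (g ` (V \<inter> D))"
proof (rule ccontr)
  assume unb: "\<not> ?thesis"
  obtain T where T: "finite T" "X = zero_set T"
    using algebraic_set_finite_zero_set[OF alg] by blast
  define R where "R t x \<longleftrightarrow> (\<forall>p\<in>T. mp_eval p x = 0) \<and> \<not> mp_eval Q x = 0 \<and>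
      (\<forall>i\<in>UNIV. x $ i - a $ i < t \<and> a $ i - x $ i < t) \<and>
      mp_eval Q x * mp_eval Q x < (t * t) * (mp_eval P x * mp_eval P x)" for t x
  have RD: "R t x \<longleftrightarrow> x \<in> D \<and> (\<forall>i. x $ i - a $ i < t \<and> a $ i - x $ i < t) \<and>
      mp_eval Q x * mp_eval Q x < (t * t) * (mp_eval P x * mp_eval P x)" for t x
    by (auto simp: R_def dom T(2) zero_set_def)
  have "definable (vector_ext coord) (\<lambda>p. R (fst p) (snd p))"
    unfolding R_def
    by (intro definable_conj definable_not definable_Ball_finite T(1) finite definable_eq definable_less
        pfuns_mult pfuns_diff pfuns_const pfuns_mp_eval_subst pfuns_vext_nth pfuns_vext_fst pfuns_coord)
  moreover have "\<exists>x. R t x" if t: "0 < t" for t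
  proof (rule ccontr)
    assume none: "\<nexists>x. R t x"
    define V where "V = {x. \<forall>i. x $ i - a $ i < t \<and> a $ i - x $ i < t}"
    have "y * y \<le> 1 / (t * t)" if y: "y \<in> g ` (V \<inter> D)" for y
    proof -
      obtain x where x: "x \<in> V" "x \<in> D" "y = g x"
        using y by blast
      have "\<not> R t x"
        using none by blast
      then have "\<not> mp_eval Q x * mp_eval Q x < (t * t) * (mp_eval P x * mp_eval P x)"
        using x(1,2) unfolding RD V_def by blast
      then have "(t * t) * (mp_eval P x * mp_eval P x) \<le> mp_eval Q x * mp_eval Q x"
        by (simp only: not_less)
      then have "mp_eval P x * mp_eval P x \<le> 1 / (t * t) * (mp_eval Q x * mp_eval Q x)"
        using t by (simp add: pos_le_divide_eq mult.commute)
      moreover have "mp_eval Q x \<noteq> 0"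
        using x(2) by (simp add: dom)
      ultimately show ?thesis
        unfolding x(3) g[OF x(2)] by (subst square_quotient_le_iff)
    qed
    then have "order_bounded (g ` (V \<inter> D))"
      unfolding order_bounded_iff_squares by blast
    moreover have "open V"
      unfolding V_def by (rule open_box_around)
    moreover have "a \<in> V"
      using t by (simp add: V_def)
    ultimately show False
      using unb by blast
  qed
  ultimately have "\<exists>\<gamma> \<eta>. 0 < \<eta> \<and> semialgebraic_arc X \<gamma> \<and> (\<forall>s. 0 < s \<and> s \<le> 1 \<longrightarrow> R (\<eta> * s) (\<gamma> s))"
    by (rule curve_selection[where a = a]) (use a in \<open>auto simp: RD dom\<close>)
  then obtain \<gamma> \<eta> where \<eta>: "0 < \<eta>" and arc: "semialgebraic_arc X \<gamma>"
    and R\<gamma>: "\<And>s. 0 < s \<Longrightarrow> s \<le> 1 \<Longrightarrow> R (\<eta> * s) (\<gamma> s)"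
    by blast
  have D: "\<gamma> s \<in> D" if "0 < s" "s \<le> 1" for s
    using R\<gamma>[OF that] by (simp add: RD)
  then have "order_bounded ((g \<circ> \<gamma>) ` {0<..1})"
    by (intro arcs[OF arc]) auto
  then obtain M where "\<forall>y\<in>(g \<circ> \<gamma>) ` {0<..1}. y * y \<le> M"
    unfolding order_bounded_iff_squares by blast
  then have M: "g (\<gamma> s) * g (\<gamma> s) \<le> M" if "0 < s" "s \<le> 1" for s
    using that by auto
  (* at u = \<eta> * s, the choice of s makes u * (\<bar>M\<bar> + 1) < 1, whence u\<^sup>2 * M < 1 *)
  define k where "k = \<bar>M\<bar> + 1"
  have k: "1 \<le> k"
    by (simp add: k_def)
  define s where "s = 1 / (k * (\<eta> + 1))"
  define u where "u = \<eta> * s"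
  have "1 * 1 \<le> k * (\<eta> + 1)"
    using \<eta> k by (intro mult_mono) auto
  then have ge1: "1 \<le> k * (\<eta> + 1)"
    by simp
  then have s: "0 < s" "s \<le> 1"
    using less_le_trans[OF zero_less_one ge1] by (simp_all add: s_def divide_le_eq_1_pos)
  have "u * k = \<eta> / (\<eta> + 1)"
    using k by (auto simp: u_def s_def)
  also have "\<dots> < 1"
    using \<eta> by simp
  finally have u1: "u * k < 1" .
  have u0: "0 < u"
    using \<eta> s by (simp add: u_def)
  have "u * \<bar>M\<bar> \<le> u * k" "u * 1 \<le> u * k"
    using u0 k by (intro mult_left_mono; simp add: k_def)+
  then have uM: "u * \<bar>M\<bar> < 1" "u < 1"
    using u1 by (auto dest: le_less_trans)
  have "u * u * M \<le> u * (u * \<bar>M\<bar>)"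
    using u0 by (simp add: mult.assoc mult_left_mono)
  also have "\<dots> \<le> u * 1"
    using u0 uM by (intro mult_left_mono) auto
  finally have uuM: "u * u * M < 1"
    using uM by simp
  define p q where "p = mp_eval P (\<gamma> s)" and "q = mp_eval Q (\<gamma> s)"
  have q: "q \<noteq> 0"
    using D[OF s] by (simp add: dom q_def)
  then have qq: "0 < q * q"
    by (metis mult_neg_neg mult_pos_pos neqE)
  have "(p / q) * (p / q) \<le> M"
    using M[OF s] by (simp only: g[OF D[OF s]] p_def q_def)
  then have pM: "p * p \<le> M * (q * q)"
    using square_quotient_le_iff[OF q] by blast
  have "q * q < (u * u) * (p * p)"
    using R\<gamma>[OF s] by (simp add: RD p_def q_def u_def)
  also have "\<dots> \<le> (u * u) * (M * (q * q))"
    using pM by (intro mult_left_mono) auto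
  also have "\<dots> = (u * u * M) * (q * q)"
    by (simp only: mult.assoc)
  also have "\<dots> < 1 * (q * q)"
    using uuM qq by (intro mult_strict_right_mono)
  finally show False by simp
qed

theorem proposition3p5:
  fixes X :: "('a::{real_closed_field,linorder_topology} ^ 'n::finite) set"
    and f :: "('a, 'n) rational_function"
  assumes "algebraic_set X"
    and "irreducible_set X"
    and "nonsingular X"
    and "f \<in> rational_functions X"
  shows "f \<in> locally_bounded_functions X \<longleftrightarrow>
    (\<forall>\<gamma>. semialgebraic_arc X \<gamma> \<and> \<gamma> ` {0<..1} \<subseteq> rat_dom X f \<longrightarrow>
       order_bounded ((rat_eval f \<circ> \<gamma>) ` {0<..1}))"
proof -
  obtain P Q where dom: "rat_dom X f = {x \<in> X. mp_eval Q x \<noteq> 0}"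
    and "\<forall>x\<in>X. mp_eval Q x \<noteq> 0 \<longrightarrow> rat_eval f x = mp_eval P x / mp_eval Q x"
    using rational_function_global_fraction[OF assms(1,2,4)] by blast
  then have val: "rat_eval f x = mp_eval P x / mp_eval Q x" if "x \<in> rat_dom X f" for x
    using that by auto
  have lb: "f \<in> locally_bounded_functions X \<longleftrightarrow>
      (\<forall>x\<in>X. \<exists>V. open V \<and> x \<in> V \<and> order_bounded (rat_eval f ` (V \<inter> rat_dom X f)))"
    using assms(4) by (simp add: locally_bounded_functions_def)
  show ?thesis
  proof (intro iffI allI impI)
    fix \<gamma>
    assume "f \<in> locally_bounded_functions X"
      and "semialgebraic_arc X \<gamma> \<and> \<gamma> ` {0<..1} \<subseteq> rat_dom X f"
    then show "order_bounded ((rat_eval f \<circ> \<gamma>) ` {0<..1})"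
      unfolding lb by (intro locally_bounded_imp_bounded_along_arc[OF dom val]) auto
  next
    assume "\<forall>\<gamma>. semialgebraic_arc X \<gamma> \<and> \<gamma> ` {0<..1} \<subseteq> rat_dom X f \<longrightarrow>
       order_bounded ((rat_eval f \<circ> \<gamma>) ` {0<..1})"
    then show "f \<in> locally_bounded_functions X"
      unfolding lb by (intro ballI bounded_along_arcs_imp_locally_bounded[OF assms(1) dom val]) auto
  qed
qed

end
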